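(* Let $k=(k_1,k_2)\in\mathbb{R}^2$, $\lambda>0$, $\alpha\in[0,\infty]$, $x_0\in\mathbb{R}^2$, and for $x=(x_1,x_2)\in\mathbb{R}^2$ let $$\psi_k(x)=\sin(k_1x_1)\cos(k_2x_2),\qquad \xi_k(x)=\nabla^\perp\psi_k(x)=\big(k_2\sin(k_1x_1)\sin(k_2x_2),\,k_1\cos(k_1x_1)\cos(k_2x_2)\big),$$ $$b_\alpha(x)=\frac12\,\frac{\alpha}{\lambda+\alpha}\,D\xi_k(x)\,\xi_k(x).$$ Let $x^\alpha$ be the solution of the Stratonovich equation $$dx^\alpha(t)=\xi_k(x^\alpha(t))\circ dw(t)-b_\alpha(x^\alpha(t))\,dt,\qquad x^\alpha(0)=x_0,$$ where $w$ is a real-valued standard Brownian motion. Then the process $t\mapsto\psi_k(x^\alpha(t))$ is pathwise (almost surely) monotone: it is decreasing (non-strictly) when it lives in the region where $\psi_k>0$ and increasing (non-strictly) when it lives in the region where $\psi_k<0$.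
   Context: $\nabla^\perp\psi=(-\partial_2\psi,\partial_1\psi)$; $D\xi$ is the Jacobian matrix, $(D\xi)_{ij}=\partial_j\xi_i$; $\circ$ denotes the Stratonovich differential. For $\alpha=\infty$ the factor $\frac{\alpha}{\lambda+\alpha}$ is understood as $1$. *)

theory Defs
  imports "HOL-Probability.Probability"
begin

section \<open>The stream function and its velocity field\<close>

definition psi :: "real^2 \<Rightarrow> real^2 \<Rightarrow> real" where
  "psi k x = sin (k $ 1 * x $ 1) * cos (k $ 2 * x $ 2)"

definition perp_grad :: "(real^2 \<Rightarrow> real) \<Rightarrow> real^2 \<Rightarrow> real^2" where
  "perp_grad f x =
     vector [- frechet_derivative f (at x) (axis 2 1), frechet_derivative f (at x) (axis 1 1)]"

definition xi :: "real^2 \<Rightarrow> real^2 \<Rightarrow> real^2" where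
  "xi k = perp_grad (psi k)"

lemma xi_explicit:
  "xi k x = vector [k $ 2 * sin (k $ 1 * x $ 1) * sin (k $ 2 * x $ 2),
                    k $ 1 * cos (k $ 1 * x $ 1) * cos (k $ 2 * x $ 2)]"
proof -
  have "(psi k has_derivative
      (\<lambda>h. k $ 1 * h $ 1 * cos (k $ 1 * x $ 1) * cos (k $ 2 * x $ 2)
          - k $ 2 * h $ 2 * sin (k $ 1 * x $ 1) * sin (k $ 2 * x $ 2))) (at x)"
    unfolding psi_def[abs_def]
    by (auto intro!: derivative_eq_intros bounded_linear_imp_has_derivative
          bounded_linear_vec_nth simp: algebra_simps fun_eq_iff)
  from frechet_derivative_at[OF this, symmetric] show ?thesis
    by (simp add: xi_def perp_grad_def axis_def)
qed

definition damping :: "real \<Rightarrow> ennreal \<Rightarrow> real" where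
  "damping l \<alpha> = (if \<alpha> = \<infinity> then 1 else enn2real \<alpha> / (l + enn2real \<alpha>))"

definition drift :: "real^2 \<Rightarrow> real \<Rightarrow> ennreal \<Rightarrow> real^2 \<Rightarrow> real^2" where
  "drift k l \<alpha> x = (1/2 * damping l \<alpha>) *\<^sub>R (jacobian (xi k) (at x) *v xi k x)"


section \<open>Processes on a filtered probability space\<close>

text \<open>
  Processes have type \<open>real \<Rightarrow> 'a \<Rightarrow> 'b\<close>; only times \<open>t \<ge> 0\<close> are ever relevant.
  No completeness or right-continuity of the filtration is assumed.
\<close>

locale filtered_prob_space = prob_space M + filtration "space M" F
  for M :: "'a measure" and F :: "real \<Rightarrow> 'a measure" +
  assumes subalgebra_F: "subalgebra M (F t)"

definition adapted :: "(real \<Rightarrow> 'a measure) \<Rightarrow> (real \<Rightarrow> 'a \<Rightarrow> 'b::topological_space) \<Rightarrow> bool" where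
  "adapted F X \<longleftrightarrow> (\<forall>t\<ge>0. X t \<in> borel_measurable (F t))"

definition continuous_paths :: "'a measure \<Rightarrow> (real \<Rightarrow> 'a \<Rightarrow> 'b::topological_space) \<Rightarrow> bool" where
  "continuous_paths M X \<longleftrightarrow> (AE \<omega> in M. continuous_on {0..} (\<lambda>t. X t \<omega>))"

definition brownian_motion ::
  "'a measure \<Rightarrow> (real \<Rightarrow> 'a measure) \<Rightarrow> (real \<Rightarrow> 'a \<Rightarrow> real) \<Rightarrow> bool" where
  "brownian_motion M F w \<longleftrightarrow>
     adapted F w \<and> continuous_paths M w \<and> (AE \<omega> in M. w 0 \<omega> = 0) \<and>
     (\<forall>s t. 0 \<le> s \<longrightarrow> s < t \<longrightarrow>
        distributed M lborel (\<lambda>\<omega>. w t \<omega> - w s \<omega>) (normal_density 0 (sqrt (t - s))) \<and>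
        prob_space.indep_set M (sets (F s))
          (sets (vimage_algebra (space M) (\<lambda>\<omega>. w t \<omega> - w s \<omega>) borel)))"

definition martingale ::
  "'a measure \<Rightarrow> (real \<Rightarrow> 'a measure) \<Rightarrow> (real \<Rightarrow> 'a \<Rightarrow> real) \<Rightarrow> bool" where
  "martingale M F X \<longleftrightarrow>
     adapted F X \<and> (\<forall>t\<ge>0. integrable M (X t)) \<and>
     (\<forall>s t. 0 \<le> s \<longrightarrow> s \<le> t \<longrightarrow> (AE \<omega> in M. real_cond_exp M (F s) (X t) \<omega> = X s \<omega>))"

text \<open>
  Localizing sequences of finite stopping times suffice: any localizing sequence \<open>T n\<close>
  may be replaced by \<open>min (T n) n\<close>.
\<close>

definition continuous_local_martingale ::
  "'a measure \<Rightarrow> (real \<Rightarrow> 'a measure) \<Rightarrow> (real \<Rightarrow> 'a \<Rightarrow> real) \<Rightarrow> bool" where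
  "continuous_local_martingale M F X \<longleftrightarrow>
     adapted F X \<and> continuous_paths M X \<and>
     (\<exists>T :: nat \<Rightarrow> 'a \<Rightarrow> real.
        (\<forall>n. stopping_time F (T n)) \<and>
        (\<forall>n. \<forall>\<omega>\<in>space M. 0 \<le> T n \<omega> \<and> T n \<omega> \<le> T (Suc n) \<omega>) \<and>
        (AE \<omega> in M. filterlim (\<lambda>n. T n \<omega>) at_top sequentially) \<and>
        (\<forall>n. martingale M F (\<lambda>t \<omega>. X (min t (T n \<omega>)) \<omega> - X 0 \<omega>)))"

definition partition :: "real \<Rightarrow> nat \<Rightarrow> (nat \<Rightarrow> real) \<Rightarrow> bool" where
  "partition t n p \<longleftrightarrow> p 0 = 0 \<and> p n = t \<and> (\<forall>i<n. p i \<le> p (Suc i))"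

definition locally_bounded_variation :: "(real \<Rightarrow> real) \<Rightarrow> bool" where
  "locally_bounded_variation f \<longleftrightarrow>
     (\<forall>t\<ge>0. \<exists>B. \<forall>n p. partition t n p \<longrightarrow> (\<Sum>i<n. \<bar>f (p (Suc i)) - f (p i)\<bar>) \<le> B)"

definition continuous_semimartingale ::
  "'a measure \<Rightarrow> (real \<Rightarrow> 'a measure) \<Rightarrow> (real \<Rightarrow> 'a \<Rightarrow> real) \<Rightarrow> bool" where
  "continuous_semimartingale M F X \<longleftrightarrow>
     adapted F X \<and>
     (\<exists>N A. continuous_local_martingale M F N \<and>
        adapted F A \<and> continuous_paths M A \<and>
        (AE \<omega> in M. locally_bounded_variation (\<lambda>t. A t \<omega>)) \<and>
        (AE \<omega> in M. \<forall>t\<ge>0. X t \<omega> = N t \<omega> + A t \<omega>))"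


section \<open>Stratonovich integrals and equations\<close>

definition trapezoid_sum ::
  "(real \<Rightarrow> 'a \<Rightarrow> 'b::real_vector) \<Rightarrow> (real \<Rightarrow> 'a \<Rightarrow> real) \<Rightarrow> nat \<Rightarrow> (nat \<Rightarrow> real) \<Rightarrow> 'a \<Rightarrow> 'b" where
  "trapezoid_sum Y w n p \<omega> =
     (\<Sum>i<n. (w (p (Suc i)) \<omega> - w (p i) \<omega>) *\<^sub>R ((1/2) *\<^sub>R (Y (p i) \<omega> + Y (p (Suc i)) \<omega>)))"

text \<open>
  The Fisk-Stratonovich integral process \<open>I t = \<integral>\<^sub>0\<^sup>t Y \<circ> dw\<close>: for every \<open>t\<close>, the trapezoidal
  sums converge to \<open>I t\<close> in probability as the mesh of the partition of \<open>[0, t]\<close> tends to 0.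
  Measurability is required explicitly because \<^const>\<open>measure\<close> vanishes on non-measurable sets.
\<close>

definition has_stratonovich_integral ::
  "'a measure \<Rightarrow> (real \<Rightarrow> 'a \<Rightarrow> 'b::euclidean_space) \<Rightarrow> (real \<Rightarrow> 'a \<Rightarrow> real) \<Rightarrow>
   (real \<Rightarrow> 'a \<Rightarrow> 'b) \<Rightarrow> bool" where
  "has_stratonovich_integral M Y w I \<longleftrightarrow>
     (\<forall>t\<ge>0. Y t \<in> borel_measurable M \<and> w t \<in> borel_measurable M \<and> I t \<in> borel_measurable M) \<and>
     (\<forall>t\<ge>0. \<forall>\<epsilon>>0. \<exists>\<delta>>0. \<forall>n p. partition t n p \<longrightarrow> (\<forall>i<n. p (Suc i) - p i < \<delta>) \<longrightarrow>
        measure M {\<omega>\<in>space M. norm (trapezoid_sum Y w n p \<omega> - I t \<omega>) > \<epsilon>} < \<epsilon>)"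

text \<open>\<open>x\<close> solves \<open>dx = \<sigma>(x) \<circ> dw + \<beta>(x) dt\<close>, \<open>x(0) = x\<^sub>0\<close>.\<close>

definition stratonovich_solution ::
  "'a measure \<Rightarrow> (real \<Rightarrow> 'a measure) \<Rightarrow> (real \<Rightarrow> 'a \<Rightarrow> real) \<Rightarrow>
   (real^'d \<Rightarrow> real^'d) \<Rightarrow> (real^'d \<Rightarrow> real^'d) \<Rightarrow> real^'d \<Rightarrow> (real \<Rightarrow> 'a \<Rightarrow> real^'d) \<Rightarrow> bool" where
  "stratonovich_solution M F w \<sigma> \<beta> x0 x \<longleftrightarrow>
     adapted F x \<and> continuous_paths M x \<and>
     (\<forall>i. continuous_semimartingale M F (\<lambda>t \<omega>. x t \<omega> $ i)) \<and>
     (AE \<omega> in M. x 0 \<omega> = x0) \<and>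
     (\<exists>I. has_stratonovich_integral M (\<lambda>t \<omega>. \<sigma> (x t \<omega>)) w I \<and>
        (AE \<omega> in M. \<forall>t\<ge>0. x t \<omega> = x0 + I t \<omega> + integral {0..t} (\<lambda>s. \<beta> (x s \<omega>))))"

end

theory Submission
  imports Defs
begin

text \<open>
  Write \<open>g = \<nabla>\<psi>\<close>. The gradient is the velocity \<open>\<xi>\<close> turned by a right angle, so \<open>g \<sqdot> b\<close> equals
  \<open>rot_prod \<xi> b\<close> for the alternating form \<open>rot_prod a b = a\<^sub>2 b\<^sub>1 - a\<^sub>1 b\<^sub>2\<close>. Formally the Stratonovich chain
  rule gives \<open>d\<psi>(x) = rot_prod \<xi> \<xi> \<circ> dw - rot_prod \<xi> b dt\<close>. The noise disappears because the form is
  alternating, and \<open>rot_prod \<xi> b = c \<psi>\<close> with a rate \<open>c \<ge> 0\<close>. Hence \<open>\<psi>(x(t))\<close> solves the linear equation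
  \<open>y' = - c y\<close> path by path. It is \<open>y(0)\<close> times a positive decreasing factor, so it keeps its sign and
  moves monotonically towards 0.

  The substance of the proof is the chain rule, for the integral defined by trapezoidal sums. It is
  obtained on uniform grids of \<open>[0, t]\<close> directly, with no Ito integral and no bracket process. The
  function \<open>\<psi>\<close> is half the sum of the sines of two linear phases, and the trapezoidal rule for the sine
  has a cubic error. So \<open>\<psi>(x(t)) - \<psi>(x(0))\<close> is the sum of \<open>rot_prod m\<^sub>j (\<Delta>\<^sub>j x)\<close>, where \<open>m\<^sub>j\<close> is the mean
  of the two end values of \<open>\<xi>(x)\<close>, up to an error bounded by the quadratic variation of \<open>x\<close> times its
  modulus of continuity. The drift part of \<open>\<Delta>\<^sub>j x\<close> is a Riemann sum. What is left is
  \<open>alternating_Stratonovich_sums_vanish\<close>: the sum of \<open>B m\<^sub>j (\<Delta>\<^sub>j I)\<close> tends to 0 in probability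
  along a suitable sequence of uniform grids, for every alternating bounded bilinear \<open>B\<close>, where \<open>I\<close> is the Stratonovich integral of the process
  whose means are the \<open>m\<^sub>j\<close>.

  That theorem would be trivial if \<open>\<Delta>\<^sub>j I\<close> were the trapezoidal term \<open>m\<^sub>j \<Delta>\<^sub>j w\<close>, because \<open>B m\<^sub>j m\<^sub>j = 0\<close>. Only
  the partial sums of the errors \<open>e\<^sub>j = \<Delta>\<^sub>j I - m\<^sub>j \<Delta>\<^sub>j w\<close> are known to be small, however, and they occur here
  with varying weights. Two more grids settle this. On a much coarser grid the weights are almost
  constant, so that only the sums of the \<open>e\<^sub>j\<close> over its blocks enter. On a much finer grid \<open>\<Delta>\<^sub>j I\<close> is again
  a trapezoidal sum, which splits \<open>e\<^sub>j\<close> into a sum of increments of \<open>w\<close> with small adapted coefficients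
  (small in mean square by the isometry for Gaussian increments) and a covariation term. The latter is
  bounded by quadratic variations, so the oscillation of the weights makes its contribution small.

  The semimartingale hypothesis enters through a bound, in probability and uniform over the grids, for
  the quadratic variation of \<open>x\<close>. For the local martingale part this bound follows from the
  Bregman distance of the Huber function, a quadratic function continued with linear growth
  (\<open>martingale_truncated_quadratic_variation\<close>).
\<close>

section \<open>Convergence and boundedness in probability\<close>

context prob_space
begin

text \<open>
  The exceptional event is an arbitrary measurable superset. The notion therefore makes sense for
  random quantities that are not known to be measurable, such as a modulus of continuity, and it
  passes to dominated quantities at once.
\<close>

definition vanishing_in_prob :: "(nat \<Rightarrow> 'a \<Rightarrow> real) \<Rightarrow> bool" where
  "vanishing_in_prob X \<longleftrightarrow>
     (\<forall>\<epsilon>>0. \<forall>\<^sub>F n in sequentially. \<exists>E\<in>events. prob E < \<epsilon> \<and> (\<forall>\<omega>\<in>space M - E. \<bar>X n \<omega>\<bar> \<le> \<epsilon>))"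

definition bounded_in_prob :: "(nat \<Rightarrow> 'a \<Rightarrow> real) \<Rightarrow> bool" where
  "bounded_in_prob X \<longleftrightarrow>
     (\<forall>\<epsilon>>0. \<exists>K. \<forall>n. \<exists>E\<in>events. prob E < \<epsilon> \<and> (\<forall>\<omega>\<in>space M - E. \<bar>X n \<omega>\<bar> \<le> K))"

lemma vanishing_in_probD:
  assumes "vanishing_in_prob X" "\<epsilon> > 0"
  shows "\<forall>\<^sub>F n in sequentially. \<exists>E\<in>events. prob E < \<epsilon> \<and> (\<forall>\<omega>\<in>space M - E. \<bar>X n \<omega>\<bar> \<le> \<epsilon>)"
  using assms unfolding vanishing_in_prob_def by blast

lemma vanishing_in_probD2:
  assumes "vanishing_in_prob X" "\<epsilon> > 0" "\<delta> > 0"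
  shows "\<forall>\<^sub>F n in sequentially. \<exists>E\<in>events. prob E < \<epsilon> \<and> (\<forall>\<omega>\<in>space M - E. \<bar>X n \<omega>\<bar> \<le> \<delta>)"
proof -
  have "min \<epsilon> \<delta> > 0" using assms by auto
  from vanishing_in_probD[OF assms(1) this] show ?thesis
    by (rule eventually_mono) fastforce
qed

lemma bounded_in_probD:
  assumes "bounded_in_prob X" "\<epsilon> > 0"
  obtains K where "K > 0"
    and "\<And>n. \<exists>E\<in>events. prob E < \<epsilon> \<and> (\<forall>\<omega>\<in>space M - E. \<bar>X n \<omega>\<bar> \<le> K)"
proof -
  from assms obtain K where
    K: "\<And>n. \<exists>E\<in>events. prob E < \<epsilon> \<and> (\<forall>\<omega>\<in>space M - E. \<bar>X n \<omega>\<bar> \<le> K)"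
    unfolding bounded_in_prob_def by blast
  have "\<exists>E\<in>events. prob E < \<epsilon> \<and> (\<forall>\<omega>\<in>space M - E. \<bar>X n \<omega>\<bar> \<le> max K 1)" for n
    using K[of n] by (meson le_max_iff_disj)
  then show ?thesis by (intro that[of "max K 1"]) auto
qed

lemma null_set_absorb:
  assumes "E \<in> events" "prob E < \<epsilon>" "AE \<omega> in M. P \<omega>"
  obtains E' where "E' \<in> events" "prob E' < \<epsilon>" "E \<subseteq> E'" "\<And>\<omega>. \<omega> \<in> space M - E' \<Longrightarrow> P \<omega>"
proof -
  from AE_E[OF assms(3)] obtain N where
    N: "{\<omega> \<in> space M. \<not> P \<omega>} \<subseteq> N" "emeasure M N = 0" "N \<in> events" .
  have "prob (E \<union> N) \<le> prob E + prob N" using assms N by (intro measure_Un_le) auto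
  also have "prob N = 0" using N by (simp add: measure_def)
  finally show ?thesis using N assms by (intro that[of "E \<union> N"]) auto
qed

lemma vanishing_in_prob_mono:
  assumes "vanishing_in_prob X"
    and "\<forall>\<^sub>F n in sequentially. AE \<omega> in M. \<bar>Y n \<omega>\<bar> \<le> \<bar>X n \<omega>\<bar>"
  shows "vanishing_in_prob Y"
  unfolding vanishing_in_prob_def
proof (intro allI impI)
  fix \<epsilon> :: real assume "\<epsilon> > 0"
  from vanishing_in_probD[OF assms(1) this] assms(2)
  show "\<forall>\<^sub>F n in sequentially. \<exists>E\<in>events. prob E < \<epsilon> \<and> (\<forall>\<omega>\<in>space M - E. \<bar>Y n \<omega>\<bar> \<le> \<epsilon>)"
  proof eventually_elim
    case (elim n)
    then obtain E where E: "E \<in> events" "prob E < \<epsilon>" "\<forall>\<omega>\<in>space M - E. \<bar>X n \<omega>\<bar> \<le> \<epsilon>" by blast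
    from null_set_absorb[OF E(1,2) elim(2)] obtain E' where
      "E' \<in> events" "prob E' < \<epsilon>" "E \<subseteq> E'" "\<And>\<omega>. \<omega> \<in> space M - E' \<Longrightarrow> \<bar>Y n \<omega>\<bar> \<le> \<bar>X n \<omega>\<bar>" by blast
    with E(3) show ?case by (intro bexI[of _ E']) (auto intro: order_trans)
  qed
qed

lemma vanishing_in_prob_add:
  assumes "vanishing_in_prob X" "vanishing_in_prob Y"
  shows "vanishing_in_prob (\<lambda>n \<omega>. X n \<omega> + Y n \<omega>)"
  unfolding vanishing_in_prob_def
proof (intro allI impI)
  fix \<epsilon> :: real assume "\<epsilon> > 0"
  then have e: "\<epsilon>/2 > 0" by simp
  from vanishing_in_probD[OF assms(1) e] vanishing_in_probD[OF assms(2) e]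
  show "\<forall>\<^sub>F n in sequentially. \<exists>E\<in>events. prob E < \<epsilon> \<and> (\<forall>\<omega>\<in>space M - E. \<bar>X n \<omega> + Y n \<omega>\<bar> \<le> \<epsilon>)"
  proof eventually_elim
    case (elim n)
    then obtain E E' where E: "E \<in> events" "prob E < \<epsilon>/2" "\<forall>\<omega>\<in>space M - E. \<bar>X n \<omega>\<bar> \<le> \<epsilon>/2"
      "E' \<in> events" "prob E' < \<epsilon>/2" "\<forall>\<omega>\<in>space M - E'. \<bar>Y n \<omega>\<bar> \<le> \<epsilon>/2" by blast
    have "prob (E \<union> E') \<le> prob E + prob E'" using E by (intro measure_Un_le) auto
    moreover have "\<bar>X n \<omega> + Y n \<omega>\<bar> \<le> \<epsilon>" if "\<omega> \<in> space M - (E \<union> E')" for \<omega>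
    proof -
      have "\<bar>X n \<omega>\<bar> \<le> \<epsilon>/2" "\<bar>Y n \<omega>\<bar> \<le> \<epsilon>/2" using E that by auto
      then show ?thesis by linarith
    qed
    ultimately show ?case using E by (intro bexI[of _ "E \<union> E'"]) auto
  qed
qed

lemma bounded_in_prob_mult_vanishing:
  assumes "bounded_in_prob X" "vanishing_in_prob Y"
  shows "vanishing_in_prob (\<lambda>n \<omega>. X n \<omega> * Y n \<omega>)"
  unfolding vanishing_in_prob_def
proof (intro allI impI)
  fix \<epsilon> :: real assume e: "\<epsilon> > 0"
  then obtain K where K: "K > 0"
    "\<And>n. \<exists>E\<in>events. prob E < \<epsilon>/2 \<and> (\<forall>\<omega>\<in>space M - E. \<bar>X n \<omega>\<bar> \<le> K)"
    using bounded_in_probD[OF assms(1), of "\<epsilon>/2"] by auto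
  have "\<epsilon>/2 > 0" "\<epsilon>/K > 0" using e K by auto
  from vanishing_in_probD2[OF assms(2) this]
  show "\<forall>\<^sub>F n in sequentially. \<exists>E\<in>events. prob E < \<epsilon> \<and> (\<forall>\<omega>\<in>space M - E. \<bar>X n \<omega> * Y n \<omega>\<bar> \<le> \<epsilon>)"
  proof eventually_elim
    case (elim n)
    with K(2)[of n] obtain E E' where E: "E \<in> events" "prob E < \<epsilon>/2" "\<forall>\<omega>\<in>space M - E. \<bar>X n \<omega>\<bar> \<le> K"
      "E' \<in> events" "prob E' < \<epsilon>/2" "\<forall>\<omega>\<in>space M - E'. \<bar>Y n \<omega>\<bar> \<le> \<epsilon>/K" by blast
    have "prob (E \<union> E') \<le> prob E + prob E'" using E by (intro measure_Un_le) auto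
    moreover have "\<bar>X n \<omega> * Y n \<omega>\<bar> \<le> \<epsilon>" if "\<omega> \<in> space M - (E \<union> E')" for \<omega>
    proof -
      have "\<bar>X n \<omega> * Y n \<omega>\<bar> \<le> K * (\<epsilon>/K)"
        unfolding abs_mult using E that K by (intro mult_mono) auto
      then show ?thesis using K by simp
    qed
    ultimately show ?case using E by (intro bexI[of _ "E \<union> E'"]) auto
  qed
qed

lemma bounded_in_prob_const: "bounded_in_prob (\<lambda>n \<omega>. c)"
  unfolding bounded_in_prob_def by (auto intro!: exI[of _ "\<bar>c\<bar>"] bexI[of _ "{}"])

lemma vanishing_in_prob_cmult:
  "vanishing_in_prob X \<Longrightarrow> vanishing_in_prob (\<lambda>n \<omega>. c * X n \<omega>)"
  using bounded_in_prob_mult_vanishing[OF bounded_in_prob_const] .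

lemma vanishing_in_prob_sum:
  assumes "finite S" "\<And>b. b \<in> S \<Longrightarrow> vanishing_in_prob (X b)"
  shows "vanishing_in_prob (\<lambda>n \<omega>. \<Sum>b\<in>S. X b n \<omega>)"
  using assms
proof (induction S rule: finite_induct)
  case empty
  then show ?case by (auto simp: vanishing_in_prob_def intro!: bexI[of _ "{}"])
next
  case (insert b S)
  then show ?case by (simp add: vanishing_in_prob_add)
qed

lemma bounded_in_prob_mono:
  assumes "bounded_in_prob X" and "\<And>n. AE \<omega> in M. \<bar>Y n \<omega>\<bar> \<le> \<bar>X n \<omega>\<bar>"
  shows "bounded_in_prob Y"
  unfolding bounded_in_prob_def
proof (intro allI impI)
  fix \<epsilon> :: real assume "\<epsilon> > 0"
  then obtain K where K: "K > 0"
    "\<And>n. \<exists>E\<in>events. prob E < \<epsilon> \<and> (\<forall>\<omega>\<in>space M - E. \<bar>X n \<omega>\<bar> \<le> K)"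
    using bounded_in_probD[OF assms(1)] by auto
  have "\<exists>E\<in>events. prob E < \<epsilon> \<and> (\<forall>\<omega>\<in>space M - E. \<bar>Y n \<omega>\<bar> \<le> K)" for n
  proof -
    from K(2) obtain E where E: "E \<in> events" "prob E < \<epsilon>" "\<forall>\<omega>\<in>space M - E. \<bar>X n \<omega>\<bar> \<le> K" by blast
    from null_set_absorb[OF E(1,2) assms(2)[of n]] obtain E' where
      "E' \<in> events" "prob E' < \<epsilon>" "E \<subseteq> E'" "\<And>\<omega>. \<omega> \<in> space M - E' \<Longrightarrow> \<bar>Y n \<omega>\<bar> \<le> \<bar>X n \<omega>\<bar>" by blast
    with E(3) show ?thesis by (intro bexI[of _ E']) (auto intro: order_trans)
  qed
  then show "\<exists>K. \<forall>n. \<exists>E\<in>events. prob E < \<epsilon> \<and> (\<forall>\<omega>\<in>space M - E. \<bar>Y n \<omega>\<bar> \<le> K)" by blast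
qed

lemma bounded_in_prob_add:
  assumes "bounded_in_prob X" "bounded_in_prob Y"
  shows "bounded_in_prob (\<lambda>n \<omega>. X n \<omega> + Y n \<omega>)"
  unfolding bounded_in_prob_def
proof (intro allI impI)
  fix \<epsilon> :: real assume "\<epsilon> > 0"
  then have e: "\<epsilon>/2 > 0" by simp
  from bounded_in_probD[OF assms(1) e] obtain K where
    K: "\<And>n. \<exists>E\<in>events. prob E < \<epsilon>/2 \<and> (\<forall>\<omega>\<in>space M - E. \<bar>X n \<omega>\<bar> \<le> K)" by metis
  from bounded_in_probD[OF assms(2) e] obtain K' where
    K': "\<And>n. \<exists>E\<in>events. prob E < \<epsilon>/2 \<and> (\<forall>\<omega>\<in>space M - E. \<bar>Y n \<omega>\<bar> \<le> K')" by metis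
  have "\<exists>E\<in>events. prob E < \<epsilon> \<and> (\<forall>\<omega>\<in>space M - E. \<bar>X n \<omega> + Y n \<omega>\<bar> \<le> K + K')" for n
  proof -
    from K[of n] K'[of n] obtain E E' where E:
      "E \<in> events" "prob E < \<epsilon>/2" "\<forall>\<omega>\<in>space M - E. \<bar>X n \<omega>\<bar> \<le> K"
      "E' \<in> events" "prob E' < \<epsilon>/2" "\<forall>\<omega>\<in>space M - E'. \<bar>Y n \<omega>\<bar> \<le> K'" by blast
    have "prob (E \<union> E') \<le> prob E + prob E'" using E by (intro measure_Un_le) auto
    moreover have "\<bar>X n \<omega> + Y n \<omega>\<bar> \<le> K + K'" if "\<omega> \<in> space M - (E \<union> E')" for \<omega>
    proof -
      have "\<bar>X n \<omega>\<bar> \<le> K" "\<bar>Y n \<omega>\<bar> \<le> K'" using E that by auto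
      then show ?thesis by linarith
    qed
    ultimately show ?thesis using E by (intro bexI[of _ "E \<union> E'"]) auto
  qed
  then show "\<exists>K. \<forall>n. \<exists>E\<in>events. prob E < \<epsilon> \<and> (\<forall>\<omega>\<in>space M - E. \<bar>X n \<omega> + Y n \<omega>\<bar> \<le> K)" by blast
qed

lemma bounded_in_prob_cmult:
  assumes "bounded_in_prob X" shows "bounded_in_prob (\<lambda>n \<omega>. c * X n \<omega>)"
  unfolding bounded_in_prob_def
proof (intro allI impI)
  fix \<epsilon> :: real assume "\<epsilon> > 0"
  then obtain K where K: "\<And>n. \<exists>E\<in>events. prob E < \<epsilon> \<and> (\<forall>\<omega>\<in>space M - E. \<bar>X n \<omega>\<bar> \<le> K)"
    using bounded_in_probD[OF assms] by blast
  show "\<exists>K. \<forall>n. \<exists>E\<in>events. prob E < \<epsilon> \<and> (\<forall>\<omega>\<in>space M - E. \<bar>c * X n \<omega>\<bar> \<le> K)"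
  proof (intro exI allI)
    fix n
    from K obtain E where E: "E \<in> events" "prob E < \<epsilon>" "\<forall>\<omega>\<in>space M - E. \<bar>X n \<omega>\<bar> \<le> K" by blast
    have "\<bar>c * X n \<omega>\<bar> \<le> \<bar>c\<bar> * K" if "\<omega> \<in> space M - E" for \<omega>
      unfolding abs_mult using E(3) that by (intro mult_left_mono) auto
    with E show "\<exists>E\<in>events. prob E < \<epsilon> \<and> (\<forall>\<omega>\<in>space M - E. \<bar>c * X n \<omega>\<bar> \<le> \<bar>c\<bar> * K)" by blast
  qed
qed

lemma bounded_in_prob_subseq:
  "bounded_in_prob X \<Longrightarrow> bounded_in_prob (\<lambda>n. X (m n))"
  unfolding bounded_in_prob_def by blast

lemma vanishing_in_prob_power2D:
  assumes "vanishing_in_prob (\<lambda>n \<omega>. (X n \<omega>)\<^sup>2)"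
  shows "vanishing_in_prob X"
  unfolding vanishing_in_prob_def
proof (intro allI impI)
  fix \<epsilon> :: real assume e: "\<epsilon> > 0"
  then have "\<epsilon>\<^sup>2 > 0" by simp
  from vanishing_in_probD2[OF assms e this]
  show "\<forall>\<^sub>F n in sequentially. \<exists>E\<in>events. prob E < \<epsilon> \<and> (\<forall>\<omega>\<in>space M - E. \<bar>X n \<omega>\<bar> \<le> \<epsilon>)"
    by (rule eventually_mono) (use e in \<open>simp add: abs_le_square_iff[of _ \<epsilon>, symmetric]\<close>)
qed

lemma Markov_event:
  assumes "integrable M X" "\<And>\<omega>. \<omega> \<in> space M \<Longrightarrow> X \<omega> \<ge> 0" "expectation X < \<epsilon> * K" "K > 0"
  shows "\<exists>E\<in>events. prob E < \<epsilon> \<and> (\<forall>\<omega>\<in>space M - E. \<bar>X \<omega>\<bar> \<le> K)"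
proof (intro bexI conjI ballI)
  let ?E = "{\<omega>\<in>space M. X \<omega> \<ge> K}"
  show "?E \<in> events" using assms by measurable
  have "prob ?E \<le> expectation X / K"
    using assms by (intro integral_Markov_inequality_measure[where A="{}"]) auto
  also have "\<dots> < \<epsilon>" using assms by (simp add: field_simps)
  finally show "prob ?E < \<epsilon>" .
  show "\<bar>X \<omega>\<bar> \<le> K" if "\<omega> \<in> space M - ?E" for \<omega> using that assms(2)[of \<omega>] by auto
qed

lemma vanishing_in_prob_expectation:
  assumes "\<And>n. integrable M (X n)" "\<And>n \<omega>. \<omega> \<in> space M \<Longrightarrow> X n \<omega> \<ge> 0"
    and "(\<lambda>n. expectation (X n)) \<longlonglongrightarrow> 0"
  shows "vanishing_in_prob X"
  unfolding vanishing_in_prob_def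
proof (intro allI impI)
  fix \<epsilon> :: real assume e: "\<epsilon> > 0"
  then have "\<forall>\<^sub>F n in sequentially. expectation (X n) < \<epsilon> * \<epsilon>"
    using order_tendstoD(2)[OF assms(3), of "\<epsilon> * \<epsilon>"] by simp
  then show "\<forall>\<^sub>F n in sequentially. \<exists>E\<in>events. prob E < \<epsilon> \<and> (\<forall>\<omega>\<in>space M - E. \<bar>X n \<omega>\<bar> \<le> \<epsilon>)"
    by (rule eventually_mono) (use assms e in \<open>intro Markov_event; simp\<close>)
qed

lemma bounded_in_prob_expectation:
  assumes "\<And>n. integrable M (X n)" "\<And>n \<omega>. \<omega> \<in> space M \<Longrightarrow> X n \<omega> \<ge> 0"
    and "\<And>n. expectation (X n) \<le> C"
  shows "bounded_in_prob X"
  unfolding bounded_in_prob_def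
proof (intro allI impI)
  fix \<epsilon> :: real assume e: "\<epsilon> > 0"
  have "\<epsilon> * ((\<bar>C\<bar> + 1)/\<epsilon>) = \<bar>C\<bar> + 1" using e by simp
  then have "expectation (X n) < \<epsilon> * ((\<bar>C\<bar> + 1)/\<epsilon>)" for n using assms(3)[of n] by linarith
  then show "\<exists>K. \<forall>n. \<exists>E\<in>events. prob E < \<epsilon> \<and> (\<forall>\<omega>\<in>space M - E. \<bar>X n \<omega>\<bar> \<le> K)"
    using assms e by (intro exI[of _ "(\<bar>C\<bar> + 1)/\<epsilon>"] allI Markov_event) auto
qed

text \<open>
  This turns an approximation along grids, valid in probability only, into an almost sure identity.
\<close>

lemma AE_zero_if_vanishing_const:
  assumes "vanishing_in_prob (\<lambda>n. R)"
  shows "AE \<omega> in M. R \<omega> = 0"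
proof -
  have "\<exists>E\<in>events. prob E < \<epsilon> \<and> (\<forall>\<omega>\<in>space M - E. \<bar>R \<omega>\<bar> \<le> \<epsilon>)" if "\<epsilon> > 0" for \<epsilon>
    using vanishing_in_probD[OF assms that] by simp
  then have "\<exists>E. \<forall>n. E n \<in> events \<and> prob (E n) < 1 / real (Suc n) \<and>
      (\<forall>\<omega>\<in>space M - E n. \<bar>R \<omega>\<bar> \<le> 1 / real (Suc n))"
    by (intro choice allI) (metis of_nat_0_less_iff zero_less_Suc zero_less_divide_1_iff)
  then obtain E where E: "\<And>n. E n \<in> events" "\<And>n. prob (E n) < 1 / real (Suc n)"
    "\<And>n \<omega>. \<omega> \<in> space M - E n \<Longrightarrow> \<bar>R \<omega>\<bar> \<le> 1 / real (Suc n)" by blast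
  have "AE \<omega> in M. \<not> \<bar>R \<omega>\<bar> > 1 / real (Suc m)" for m
  proof (rule AE_I)
    let ?N = "\<Inter>n\<in>{m..}. E n"
    show "?N \<in> events" using E by auto
    show "{\<omega> \<in> space M. \<not> \<not> \<bar>R \<omega>\<bar> > 1 / real (Suc m)} \<subseteq> ?N"
    proof (intro subsetI INT_I)
      fix \<omega> n assume a: "\<omega> \<in> {\<omega> \<in> space M. \<not> \<not> \<bar>R \<omega>\<bar> > 1 / real (Suc m)}" "n \<in> {m..}"
      then have "1 / real (Suc n) \<le> 1 / real (Suc m)" by (simp add: frac_le)
      moreover have "\<omega> \<in> space M" "\<bar>R \<omega>\<bar> > 1 / real (Suc m)" using a by auto
      ultimately show "\<omega> \<in> E n" using E(3)[of \<omega> n] by (cases "\<omega> \<in> E n") auto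
    qed
    have "prob ?N \<le> \<epsilon>" if "\<epsilon> > 0" for \<epsilon>
    proof -
      obtain n0 where n0: "1 / real (Suc n0) < \<epsilon>" using nat_approx_posE[OF \<open>\<epsilon> > 0\<close>] by auto
      have "prob ?N \<le> prob (E (max m n0))" using E by (intro finite_measure_mono) auto
      also have "\<dots> \<le> 1 / real (Suc (max m n0))" using E(2) less_imp_le by blast
      also have "\<dots> \<le> 1 / real (Suc n0)" by (simp add: frac_le)
      finally show ?thesis using n0 by simp
    qed
    then have "prob ?N = 0" using field_le_epsilon[of "prob ?N" 0] by (intro antisym) auto
    then show "emeasure M ?N = 0" by (simp add: emeasure_eq_measure)
  qed
  then have "AE \<omega> in M. \<forall>m. \<not> \<bar>R \<omega>\<bar> > 1 / real (Suc m)" by (simp add: AE_all_countable)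
  then show ?thesis
  proof eventually_elim
    case (elim \<omega>)
    show ?case
    proof (rule ccontr)
      assume "R \<omega> \<noteq> 0"
      then have "\<bar>R \<omega>\<bar> > 0" by simp
      from nat_approx_posE[OF this] elim show False by blast
    qed
  qed
qed

text \<open>
  Continuity from below of the measure. It replaces an almost surely finite random threshold by a
  deterministic one at the cost of a small event.
\<close>

lemma exhausting_event:
  fixes P :: "nat \<Rightarrow> 'a \<Rightarrow> bool"
  assumes G: "\<And>m::nat. {\<omega>\<in>space M. P m \<omega>} \<in> events"
    and mono: "\<And>m \<omega>. \<omega> \<in> space M \<Longrightarrow> P m \<omega> \<Longrightarrow> P (Suc m) \<omega>"
    and ae: "AE \<omega> in M. \<exists>m. P m \<omega>" and "\<epsilon> > 0"
  shows "\<exists>m. \<exists>E\<in>events. prob E < \<epsilon> \<and> (\<forall>m'\<ge>m. \<forall>\<omega>\<in>space M - E. P m' \<omega>)"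
proof -
  let ?G = "\<lambda>m. {\<omega>\<in>space M. P m \<omega>}"
  have inc: "incseq ?G" by (intro incseq_SucI Collect_mono) (blast intro: mono)
  have "(\<lambda>m. prob (?G m)) \<longlonglongrightarrow> prob (\<Union>m. ?G m)"
    using G inc by (intro finite_Lim_measure_incseq) auto
  also have "prob (\<Union>m. ?G m) = 1"
    using ae G by (subst prob_eq_1) (auto)
  finally have "\<forall>\<^sub>F m in sequentially. prob (?G m) > 1 - \<epsilon>"
    using \<open>\<epsilon> > 0\<close> by (intro order_tendstoD(1)) auto
  then obtain m where m: "prob (?G m) > 1 - \<epsilon>" by (auto simp: eventually_sequentially)
  have "prob (space M - ?G m) < \<epsilon>" using m G by (subst prob_compl) auto
  moreover have "P m' \<omega>" if "m' \<ge> m" "\<omega> \<in> space M - (space M - ?G m)" for m' \<omega>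
  proof -
    have "\<omega> \<in> ?G m'" using that inc unfolding incseq_def by blast
    then show ?thesis by simp
  qed
  ultimately show ?thesis using sets.compl_sets[OF G[of m]] by blast
qed

lemma uniform_bound_event:
  fixes Z :: "'i::countable \<Rightarrow> 'a \<Rightarrow> real"
  assumes Z: "\<And>i. Z i \<in> borel_measurable M"
    and ae: "AE \<omega> in M. \<exists>B. \<forall>i. \<bar>Z i \<omega>\<bar> \<le> B" and "\<epsilon> > 0"
  shows "\<exists>K>0. \<exists>E\<in>events. prob E < \<epsilon> \<and> (\<forall>\<omega>\<in>space M - E. \<forall>i. \<bar>Z i \<omega>\<bar> \<le> K)"
proof -
  note Z[measurable]
  have ae': "AE \<omega> in M. \<exists>m::nat. \<forall>i. \<bar>Z i \<omega>\<bar> \<le> real m"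
    using ae by eventually_elim (meson order_trans real_arch_simple)
  have mono: "\<forall>i. \<bar>Z i \<omega>\<bar> \<le> real (Suc m)" if "\<forall>i. \<bar>Z i \<omega>\<bar> \<le> real m" for m \<omega>
  proof
    fix i
    from that have "\<bar>Z i \<omega>\<bar> \<le> real m" ..
    then show "\<bar>Z i \<omega>\<bar> \<le> real (Suc m)" by simp
  qed
  have meas: "{\<omega> \<in> space M. \<forall>i. \<bar>Z i \<omega>\<bar> \<le> real m} \<in> events" for m by measurable
  from exhausting_event[OF meas mono ae' \<open>\<epsilon> > 0\<close>] obtain m E where E: "E \<in> events" "prob E < \<epsilon>"
    "\<forall>m'\<ge>m. \<forall>\<omega>\<in>space M - E. \<forall>i. \<bar>Z i \<omega>\<bar> \<le> real m'"
    by blast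
  then have "\<forall>\<omega>\<in>space M - E. \<forall>i. \<bar>Z i \<omega>\<bar> \<le> real (Suc m)" using le_Suc_eq by blast
  then show ?thesis using E(1,2) by (intro exI[of _ "real (Suc m)"]) auto
qed

end

section \<open>Discrete stochastic integrals against Brownian motion\<close>

lemma (in prob_space) indep_var_if_indep_set:
  assumes ind: "indep_set (sets G) (sets (vimage_algebra (space M) D borel))"
    and h: "h \<in> borel_measurable G" and G: "subalgebra M G" and D: "D \<in> borel_measurable M"
  shows "indep_var borel h borel D"
  unfolding indep_var_eq indep_set_def
proof (intro conjI)
  have sp: "space G = space M" using G by (simp add: subalgebra_def)
  show "random_variable borel h" by (rule measurable_from_subalg[OF G h])
  show "random_variable borel D" by fact
  have 1: "sigma_sets (space M) {h -` A \<inter> space M |A. A \<in> sets borel} \<subseteq> sets G"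
    unfolding sp[symmetric] by (rule sets.sigma_sets_subset) (use measurable_sets[OF h] in auto)
  have 2: "sigma_sets (space M) {D -` A \<inter> space M |A. A \<in> sets borel}
      \<subseteq> sets (vimage_algebra (space M) D borel)"
    by (simp add: sets_vimage_algebra)
  show "indep_sets (case_bool (sigma_sets (space M) {h -` A \<inter> space M |A. A \<in> sets borel})
      (sigma_sets (space M) {D -` A \<inter> space M |A. A \<in> sets borel})) UNIV"
    by (rule indep_sets_mono_sets[OF ind[unfolded indep_set_def]])
       (use 1 2 in \<open>auto split: bool.split\<close>)
qed

lemma abs_mult_le_bound: "\<bar>b\<bar> \<le> K \<Longrightarrow> \<bar>a * b\<bar> \<le> \<bar>K * a\<bar>" for a b K :: real
  unfolding abs_mult mult.commute[of "\<bar>K\<bar>"] by (intro mult_left_mono) auto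

lemma abs_mult_le_bound': "\<bar>b\<bar> \<le> K \<Longrightarrow> \<bar>b * a\<bar> \<le> \<bar>K * a\<bar>" for a b K :: real
  unfolding abs_mult by (intro mult_right_mono) auto

lemma power2_le_if_abs_le: "\<bar>b\<bar> \<le> K \<Longrightarrow> b\<^sup>2 \<le> K\<^sup>2" for b K :: real
  by (simp add: abs_le_square_iff[symmetric])

context filtered_prob_space
begin

lemma measurable_F_M: "f \<in> borel_measurable (F t) \<Longrightarrow> f \<in> borel_measurable M"
  by (rule measurable_from_subalg[OF subalgebra_F])

lemma measurable_F_mono:
  assumes "s \<le> t" "f \<in> borel_measurable (F s)" shows "f \<in> borel_measurable (F t)"
  by (rule measurable_from_subalg[OF _ assms(2)])
     (use sets_F_mono[OF assms(1)] in \<open>auto simp: subalgebra_def space_F\<close>)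

lemma adapted_measurable: "adapted F X \<Longrightarrow> 0 \<le> t \<Longrightarrow> X t \<in> borel_measurable M"
  unfolding adapted_def using measurable_F_M by blast

text \<open>
  An increment of the Brownian motion is independent of the past, so a factor known at time \<open>s\<close>
  splits off in every moment.
\<close>

lemma brownian_increment:
  assumes bm: "brownian_motion M F w" and st: "0 \<le> s" "s < t"
    and h: "h \<in> borel_measurable (F s)" "integrable M h"
  shows "integrable M (\<lambda>\<omega>. h \<omega> * (w t \<omega> - w s \<omega>))"
    and "expectation (\<lambda>\<omega>. h \<omega> * (w t \<omega> - w s \<omega>)) = 0"
    and "integrable M (\<lambda>\<omega>. h \<omega> * (w t \<omega> - w s \<omega>)\<^sup>2)"
    and "expectation (\<lambda>\<omega>. h \<omega> * (w t \<omega> - w s \<omega>)\<^sup>2) = (t - s) * expectation h"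
proof -
  define D where "D = (\<lambda>\<omega>. w t \<omega> - w s \<omega>)"
  have dist: "distributed M lborel D (normal_density 0 (sqrt (t - s)))"
    and ind: "indep_set (sets (F s)) (sets (vimage_algebra (space M) D borel))"
    using bm st unfolding brownian_motion_def D_def by auto
  have D: "D \<in> borel_measurable M" using distributed_measurable[OF dist] by simp
  have pos: "sqrt (t - s) > 0" using st by simp
  have iv: "indep_var borel h borel D"
    by (rule indep_var_if_indep_set[OF ind h(1) subalgebra_F D])
  have iv2: "indep_var borel h borel (\<lambda>\<omega>. (D \<omega>)\<^sup>2)"
    using indep_var_compose[OF iv, of id borel "\<lambda>x. x\<^sup>2" borel] by (simp add: comp_def)
  have int1: "integrable M D"
    using distributed_integrable[OF dist, of "\<lambda>x. x"] integrable_normal_moment_nz_1[OF pos, of 0] by simp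
  have e1: "expectation D = 0" by (rule normal_distributed_expectation[OF pos dist])
  have int2: "integrable M (\<lambda>\<omega>. (D \<omega>)\<^sup>2)"
    using distributed_integrable[OF dist, of "\<lambda>x. x\<^sup>2"] integrable_normal_moment[OF pos, of 0 2] by simp
  have e2: "expectation (\<lambda>\<omega>. (D \<omega>)\<^sup>2) = t - s"
    using normal_distributed_variance[OF pos dist] st e1 by simp
  show "integrable M (\<lambda>\<omega>. h \<omega> * (w t \<omega> - w s \<omega>))"
    using indep_var_integrable[OF iv h(2) int1] by (simp add: D_def)
  show "expectation (\<lambda>\<omega>. h \<omega> * (w t \<omega> - w s \<omega>)) = 0"
    using indep_var_lebesgue_integral[OF iv h(2) int1] e1 by (simp add: D_def)
  show "integrable M (\<lambda>\<omega>. h \<omega> * (w t \<omega> - w s \<omega>)\<^sup>2)"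
    using indep_var_integrable[OF iv2 h(2) int2] by (simp add: D_def)
  show "expectation (\<lambda>\<omega>. h \<omega> * (w t \<omega> - w s \<omega>)\<^sup>2) = (t - s) * expectation h"
    using indep_var_lebesgue_integral[OF iv2 h(2) int2] e2 by (simp add: D_def)
qed

text \<open>
  The mixed terms vanish since each coefficient is known before the increment that it multiplies.
\<close>

lemma discrete_Ito_isometry:
  assumes bm: "brownian_motion M F w"
    and p: "0 \<le> p 0" "\<And>i. i < n \<Longrightarrow> p i < p (Suc i)"
    and h: "\<And>i. i < n \<Longrightarrow> h i \<in> borel_measurable (F (p i))"
      "\<And>i \<omega>. i < n \<Longrightarrow> \<omega> \<in> space M \<Longrightarrow> \<bar>h i \<omega>\<bar> \<le> K"
  shows "integrable M (\<lambda>\<omega>. (\<Sum>i<n. h i \<omega> * (w (p (Suc i)) \<omega> - w (p i) \<omega>))\<^sup>2)"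
    and "expectation (\<lambda>\<omega>. (\<Sum>i<n. h i \<omega> * (w (p (Suc i)) \<omega> - w (p i) \<omega>))\<^sup>2)
       = (\<Sum>i<n. (p (Suc i) - p i) * expectation (\<lambda>\<omega>. (h i \<omega>)\<^sup>2))"
proof -
  define S where "S m \<omega> = (\<Sum>i<m. h i \<omega> * (w (p (Suc i)) \<omega> - w (p i) \<omega>))" for m \<omega>
  have w: "w t \<in> borel_measurable (F t)" if "t \<ge> 0" for t
    using bm that by (auto simp: brownian_motion_def adapted_def)
  have "m \<le> n \<Longrightarrow> p m \<ge> 0 \<and> S m \<in> borel_measurable (F (p m)) \<and> integrable M (\<lambda>\<omega>. (S m \<omega>)\<^sup>2) \<and>
      expectation (\<lambda>\<omega>. (S m \<omega>)\<^sup>2) = (\<Sum>i<m. (p (Suc i) - p i) * expectation (\<lambda>\<omega>. (h i \<omega>)\<^sup>2))" for m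
  proof (induction m)
    case 0
    then show ?case using p by (simp add: S_def[abs_def])
  next
    case (Suc m)
    then have m: "m < n" and IH: "p m \<ge> 0" "S m \<in> borel_measurable (F (p m))"
      "integrable M (\<lambda>\<omega>. (S m \<omega>)\<^sup>2)"
      "expectation (\<lambda>\<omega>. (S m \<omega>)\<^sup>2) = (\<Sum>i<m. (p (Suc i) - p i) * expectation (\<lambda>\<omega>. (h i \<omega>)\<^sup>2))"
      by auto
    define D where "D = (\<lambda>\<omega>. w (p (Suc m)) \<omega> - w (p m) \<omega>)"
    have pm: "p m < p (Suc m)" using p m by auto
    note hm = h(1)[OF m] h(2)[OF m]
    have hM[measurable]: "h m \<in> borel_measurable M" and SM[measurable]: "S m \<in> borel_measurable M"
      using hm IH measurable_F_M by blast+
    have Sint: "integrable M (S m)" by (rule square_integrable_imp_integrable[OF SM IH(3)])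
    have Shm: "(\<lambda>\<omega>. S m \<omega> * h m \<omega>) \<in> borel_measurable (F (p m))" by (rule borel_measurable_times[OF IH(2) hm(1)])
    have Shint: "integrable M (\<lambda>\<omega>. S m \<omega> * h m \<omega>)"
      by (rule Bochner_Integration.integrable_bound[of _ "\<lambda>\<omega>. K * S m \<omega>"])
         (use Sint hm(2) in \<open>auto intro!: AE_I2 abs_mult_le_bound\<close>)
    have h2m: "(\<lambda>\<omega>. (h m \<omega>)\<^sup>2) \<in> borel_measurable (F (p m))" by (rule borel_measurable_power[OF hm(1)])
    have h2int: "integrable M (\<lambda>\<omega>. (h m \<omega>)\<^sup>2)"
      by (rule integrable_const_bound[of _ "K\<^sup>2"])
         (use hm(2) in \<open>auto intro!: AE_I2 power2_le_if_abs_le\<close>)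
    note b1 = brownian_increment[OF bm IH(1) pm Shm Shint, folded D_def]
    note b2 = brownian_increment[OF bm IH(1) pm h2m h2int, folded D_def]
    have eq: "(S (Suc m) \<omega>)\<^sup>2 = (S m \<omega>)\<^sup>2 + 2 * (S m \<omega> * h m \<omega> * D \<omega>) + (h m \<omega>)\<^sup>2 * (D \<omega>)\<^sup>2" for \<omega>
      by (simp add: S_def D_def power2_eq_square algebra_simps)
    have int: "integrable M (\<lambda>\<omega>. (S (Suc m) \<omega>)\<^sup>2)"
      unfolding eq using IH(3) b1(1) b2(3)
      by (intro Bochner_Integration.integrable_add integrable_mult_right) (auto simp: D_def)
    have "expectation (\<lambda>\<omega>. (S (Suc m) \<omega>)\<^sup>2)
        = expectation (\<lambda>\<omega>. (S m \<omega>)\<^sup>2) + 2 * expectation (\<lambda>\<omega>. S m \<omega> * h m \<omega> * D \<omega>)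
          + expectation (\<lambda>\<omega>. (h m \<omega>)\<^sup>2 * (D \<omega>)\<^sup>2)"
      unfolding eq using IH(3) b1(1) b2(3) by (simp add: D_def)
    also have "\<dots> = (\<Sum>i<Suc m. (p (Suc i) - p i) * expectation (\<lambda>\<omega>. (h i \<omega>)\<^sup>2))"
      using b1(2) b2(4) IH(4) by (simp add: D_def)
    finally have e: "expectation (\<lambda>\<omega>. (S (Suc m) \<omega>)\<^sup>2) =
      (\<Sum>i<Suc m. (p (Suc i) - p i) * expectation (\<lambda>\<omega>. (h i \<omega>)\<^sup>2))" .
    have "S (Suc m) \<in> borel_measurable (F (p (Suc m)))"
    proof -
      have [measurable]: "S m \<in> borel_measurable (F (p (Suc m)))" "h m \<in> borel_measurable (F (p (Suc m)))"
        "w (p (Suc m)) \<in> borel_measurable (F (p (Suc m)))" "w (p m) \<in> borel_measurable (F (p (Suc m)))"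
        using IH hm(1) w pm by (auto intro: measurable_F_mono[of "p m"])
      have "(\<lambda>\<omega>. S m \<omega> + h m \<omega> * (w (p (Suc m)) \<omega> - w (p m) \<omega>)) \<in> borel_measurable (F (p (Suc m)))"
        by measurable
      then show ?thesis by (simp add: S_def[abs_def])
    qed
    with int e IH pm show ?case by auto
  qed
  from this[of n] show "integrable M (\<lambda>\<omega>. (\<Sum>i<n. h i \<omega> * (w (p (Suc i)) \<omega> - w (p i) \<omega>))\<^sup>2)"
    "expectation (\<lambda>\<omega>. (\<Sum>i<n. h i \<omega> * (w (p (Suc i)) \<omega> - w (p i) \<omega>))\<^sup>2)
       = (\<Sum>i<n. (p (Suc i) - p i) * expectation (\<lambda>\<omega>. (h i \<omega>)\<^sup>2))"
    by (simp_all add: S_def)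
qed

end

section \<open>Quadratic variation of continuous semimartingales\<close>

text \<open>
  The Huber function is quadratic on \<open>[-l, l]\<close> and continued linearly in a differentiable way; its
  derivative is \<open>2 * clip l\<close>.
\<close>

definition huber :: "real \<Rightarrow> real \<Rightarrow> real" where
  "huber l x = (if \<bar>x\<bar> \<le> l then x\<^sup>2 else 2 * l * \<bar>x\<bar> - l\<^sup>2)"

definition clip :: "real \<Rightarrow> real \<Rightarrow> real" where
  "clip l x = max (- l) (min l x)"

lemma huber_bounds:
  assumes "l \<ge> 0" shows "0 \<le> huber l x" "huber l x \<le> 2 * l * \<bar>x\<bar>"
proof -
  have "2 * l * \<bar>x\<bar> - l\<^sup>2 \<ge> 0" if "\<bar>x\<bar> > l"
  proof -
    have "l * l \<le> l * \<bar>x\<bar>" using that assms by (intro mult_left_mono) auto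
    moreover have "l * \<bar>x\<bar> \<ge> 0" using assms by simp
    ultimately show ?thesis by (simp add: power2_eq_square)
  qed
  then show "0 \<le> huber l x" by (auto simp: huber_def)
  have "x\<^sup>2 \<le> 2 * l * \<bar>x\<bar>" if "\<bar>x\<bar> \<le> l"
  proof -
    have "\<bar>x\<bar> * \<bar>x\<bar> \<le> l * \<bar>x\<bar>" using that by (intro mult_right_mono) auto
    moreover have "l * \<bar>x\<bar> \<ge> 0" using assms by simp
    ultimately show ?thesis by (simp add: power2_eq_square)
  qed
  then show "huber l x \<le> 2 * l * \<bar>x\<bar>" by (auto simp: huber_def)
qed

text \<open>
  The right-hand side is the Bregman distance of the convex function \<open>huber l\<close>. It is nonnegative, and
  equal to the squared increment as long as both points lie in the quadratic range.
\<close>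

lemma huber_Bregman:
  assumes l: "l \<ge> 0"
  shows "(if \<bar>x\<bar> \<le> l \<and> \<bar>y\<bar> \<le> l then (y - x)\<^sup>2 else 0)
    \<le> huber l y - huber l x - 2 * clip l x * (y - x)"
proof -
  have *: "0 \<le> (l - x) * (2 * y - l - x)" if "\<bar>x\<bar> \<le> l" "y > l"
    using that by (intro mult_nonneg_nonneg) auto
  have **: "0 \<le> (l + x) * (- 2 * y - l + x)" if "\<bar>x\<bar> \<le> l" "y < - l"
    using that by (intro mult_nonneg_nonneg) auto
  consider "\<bar>x\<bar> \<le> l" "\<bar>y\<bar> \<le> l" | "\<bar>x\<bar> \<le> l" "y > l" | "\<bar>x\<bar> \<le> l" "y < - l"
    | "x > l" | "x < - l" by linarith
  then show ?thesis
  proof cases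
    case 1
    then have c: "clip l x = x" "huber l x = x\<^sup>2" "huber l y = y\<^sup>2" by (auto simp: clip_def huber_def)
    show ?thesis unfolding c using 1 by (simp add: power2_eq_square algebra_simps)
  next
    case 2
    then have c: "clip l x = x" "huber l x = x\<^sup>2" "huber l y = 2 * l * y - l\<^sup>2" using l
      by (auto simp: clip_def huber_def)
    show ?thesis unfolding c using 2 *[OF 2] l by (simp add: power2_eq_square algebra_simps)
  next
    case 3
    then have c: "clip l x = x" "huber l x = x\<^sup>2" "huber l y = - 2 * l * y - l\<^sup>2" using l
      by (auto simp: clip_def huber_def)
    show ?thesis unfolding c using 3 **[OF 3] l by (simp add: power2_eq_square algebra_simps)
  next
    case 4
    have c: "clip l x = l" "huber l x = 2 * l * x - l\<^sup>2" using 4 l by (auto simp: clip_def huber_def)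
    have "2 * l * y - l\<^sup>2 \<le> huber l y"
      using zero_le_power2[of "y - l"] mult_left_mono[OF abs_ge_self l, of y]
      by (simp add: huber_def power2_eq_square algebra_simps)
    moreover have "\<not> (\<bar>x\<bar> \<le> l \<and> \<bar>y\<bar> \<le> l)" using 4 by auto
    ultimately show ?thesis unfolding c by (simp only: if_False) (simp add: power2_eq_square algebra_simps)
  next
    case 5
    have c: "clip l x = - l" "huber l x = - 2 * l * x - l\<^sup>2" using 5 l by (auto simp: clip_def huber_def)
    have "- 2 * l * y - l\<^sup>2 \<le> huber l y"
      using zero_le_power2[of "y + l"] mult_left_mono[OF abs_ge_minus_self l, of y]
      by (simp add: huber_def power2_eq_square algebra_simps)
    moreover have "\<not> (\<bar>x\<bar> \<le> l \<and> \<bar>y\<bar> \<le> l)" using 5 by auto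
    ultimately show ?thesis unfolding c by (simp only: if_False) (simp add: power2_eq_square algebra_simps)
  qed
qed

lemma huber_measurable[measurable]: "huber l \<in> borel_measurable borel"
  unfolding huber_def[abs_def] by measurable

lemma clip_measurable[measurable]: "clip l \<in> borel_measurable borel"
  unfolding clip_def[abs_def] by measurable

context filtered_prob_space
begin

text \<open>
  The defining conditional expectation, tested against a bounded variable known at time \<open>s\<close>.
\<close>

lemma martingale_increment_orthogonal:
  assumes Y: "martingale M F Y" and st: "0 \<le> s" "s \<le> t"
    and f: "f \<in> borel_measurable (F s)" "\<And>\<omega>. \<omega> \<in> space M \<Longrightarrow> \<bar>f \<omega>\<bar> \<le> K"
  shows "integrable M (\<lambda>\<omega>. f \<omega> * (Y t \<omega> - Y s \<omega>))"
    and "expectation (\<lambda>\<omega>. f \<omega> * (Y t \<omega> - Y s \<omega>)) = 0"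
proof -
  interpret S: finite_measure_subalgebra M "F s"
    by unfold_locales (rule subalgebra_F)
  have int: "integrable M (Y s)" "integrable M (Y t)" using Y st by (auto simp: martingale_def)
  have [measurable]: "f \<in> borel_measurable M" using f measurable_F_M by blast
  have fint: "integrable M (\<lambda>\<omega>. f \<omega> * Y r \<omega>)" if "integrable M (Y r)" for r
    by (rule Bochner_Integration.integrable_bound[of _ "\<lambda>\<omega>. K * Y r \<omega>"])
       (use that f(2) in \<open>auto intro!: AE_I2 abs_mult_le_bound'\<close>)
  show "integrable M (\<lambda>\<omega>. f \<omega> * (Y t \<omega> - Y s \<omega>))"
    using fint int by (simp add: right_diff_distrib)
  have "AE \<omega> in M. real_cond_exp M (F s) (Y t) \<omega> = Y s \<omega>"
    using Y st by (auto simp: martingale_def)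
  then have ae: "AE \<omega> in M. f \<omega> * real_cond_exp M (F s) (Y t) \<omega> = f \<omega> * Y s \<omega>"
    by eventually_elim simp
  have "expectation (\<lambda>\<omega>. f \<omega> * Y t \<omega>) = expectation (\<lambda>\<omega>. f \<omega> * real_cond_exp M (F s) (Y t) \<omega>)"
    using S.real_cond_exp_intg(2)[OF fint[OF int(2)] f(1)] int(2) by simp
  also have "\<dots> = expectation (\<lambda>\<omega>. f \<omega> * Y s \<omega>)"
    by (rule integral_cong_AE) (use ae int in \<open>auto intro: measurable_from_subalg[OF subalgebra_F]\<close>)
  finally show "expectation (\<lambda>\<omega>. f \<omega> * (Y t \<omega> - Y s \<omega>)) = 0"
    using fint int by (simp add: right_diff_distrib)
qed

text \<open>
  Summing the Bregman distances of the Huber function telescopes in expectation, because the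
  derivative term is orthogonal to the martingale increment. The linear growth of the Huber function
  makes the bound finite although \<open>Y\<close> need not be square integrable; the truncation costs only
  the event that some \<open>\<bar>Y\<bar>\<close> on the grid exceeds \<open>l\<close>.
\<close>

lemma martingale_truncated_quadratic_variation:
  assumes Y: "martingale M F Y" and l: "l \<ge> 0"
    and p: "0 \<le> p 0" "\<And>i. i < n \<Longrightarrow> p i \<le> p (Suc i)"
  defines "Z \<equiv> \<lambda>i \<omega>. if \<bar>Y (p i) \<omega>\<bar> \<le> l \<and> \<bar>Y (p (Suc i)) \<omega>\<bar> \<le> l
      then (Y (p (Suc i)) \<omega> - Y (p i) \<omega>)\<^sup>2 else 0"
  shows "integrable M (\<lambda>\<omega>. \<Sum>i<n. Z i \<omega>)"
    and "expectation (\<lambda>\<omega>. \<Sum>i<n. Z i \<omega>) \<le> 2 * l * expectation (\<lambda>\<omega>. \<bar>Y (p n) \<omega>\<bar>)"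
proof -
  have pn: "0 \<le> p i" if "i \<le> n" for i
    using that
  proof (induction i)
    case (Suc i)
    then have "p i \<ge> 0" "p i \<le> p (Suc i)" using p(2)[of i] by auto
    then show ?case by (rule order_trans)
  qed (rule p)
  have Yint: "integrable M (Y (p i))" and Yad: "Y (p i) \<in> borel_measurable (F (p i))" if "i \<le> n" for i
    using Y pn[OF that] by (auto simp: martingale_def adapted_def)
  have Hint: "integrable M (\<lambda>\<omega>. huber l (Y (p i) \<omega>))" if "i \<le> n" for i
    by (rule Bochner_Integration.integrable_bound[of _ "\<lambda>\<omega>. 2 * l * Y (p i) \<omega>"])
       (use Yint[OF that] huber_bounds[OF l] l in \<open>auto simp: abs_mult intro!: AE_I2\<close>)
  have Zint: "integrable M (Z i)" if "i < n" for i
  proof (rule integrable_const_bound[of _ "(2 * l)\<^sup>2"])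
    have [measurable]: "Y (p i) \<in> borel_measurable M" "Y (p (Suc i)) \<in> borel_measurable M"
      using Yint[of i] Yint[of "Suc i"] that by auto
    show "Z i \<in> borel_measurable M" unfolding Z_def by measurable
    show "AE \<omega> in M. norm (Z i \<omega>) \<le> (2 * l)\<^sup>2"
    proof (intro AE_I2)
      fix \<omega>
      have "(b - a)\<^sup>2 \<le> (2 * l)\<^sup>2" if "\<bar>a\<bar> \<le> l" "\<bar>b\<bar> \<le> l" for a b :: real
        using that l by (subst abs_le_square_iff[symmetric]) auto
      then show "norm (Z i \<omega>) \<le> (2 * l)\<^sup>2" by (auto simp: Z_def)
    qed
  qed
  then show "integrable M (\<lambda>\<omega>. \<Sum>i<n. Z i \<omega>)" by auto
  have step: "expectation (Z i) \<le> expectation (\<lambda>\<omega>. huber l (Y (p (Suc i)) \<omega>))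
      - expectation (\<lambda>\<omega>. huber l (Y (p i) \<omega>))" if i: "i < n" for i
  proof -
    have 1: "integrable M (\<lambda>\<omega>. clip l (Y (p i) \<omega>) * (Y (p (Suc i)) \<omega> - Y (p i) \<omega>))"
      "expectation (\<lambda>\<omega>. clip l (Y (p i) \<omega>) * (Y (p (Suc i)) \<omega> - Y (p i) \<omega>)) = 0"
      using Yad[of i] i pn[of i] p(2)[OF i] l
      by (auto intro!: martingale_increment_orthogonal[OF Y, where K=l] simp: clip_def[of l])
    have "expectation (Z i) \<le> expectation (\<lambda>\<omega>. huber l (Y (p (Suc i)) \<omega>) - huber l (Y (p i) \<omega>)
        - 2 * (clip l (Y (p i) \<omega>) * (Y (p (Suc i)) \<omega> - Y (p i) \<omega>)))"
    proof (rule integral_mono)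
      show "Z i \<omega> \<le> huber l (Y (p (Suc i)) \<omega>) - huber l (Y (p i) \<omega>)
        - 2 * (clip l (Y (p i) \<omega>) * (Y (p (Suc i)) \<omega> - Y (p i) \<omega>))" for \<omega>
        using huber_Bregman[OF l, of "Y (p i) \<omega>" "Y (p (Suc i)) \<omega>"] unfolding Z_def
        by (simp only: mult.assoc)
    qed (use Zint[OF i] Hint[of i] Hint[of "Suc i"] 1 i in auto)
    also have "\<dots> = expectation (\<lambda>\<omega>. huber l (Y (p (Suc i)) \<omega>))
      - expectation (\<lambda>\<omega>. huber l (Y (p i) \<omega>))"
      using Hint[of i] Hint[of "Suc i"] 1 i by simp
    finally show ?thesis .
  qed
  have "expectation (\<lambda>\<omega>. \<Sum>i<n. Z i \<omega>) = (\<Sum>i<n. expectation (Z i))"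
    using Zint by (intro Bochner_Integration.integral_sum) auto
  also have "\<dots> \<le> (\<Sum>i<n. expectation (\<lambda>\<omega>. huber l (Y (p (Suc i)) \<omega>))
      - expectation (\<lambda>\<omega>. huber l (Y (p i) \<omega>)))"
    by (intro sum_mono step) auto
  also have "\<dots> = expectation (\<lambda>\<omega>. huber l (Y (p n) \<omega>)) - expectation (\<lambda>\<omega>. huber l (Y (p 0) \<omega>))"
    by (rule sum_lessThan_telescope)
  also have "\<dots> \<le> expectation (\<lambda>\<omega>. huber l (Y (p n) \<omega>))"
    using huber_bounds(1)[OF l] by simp
  also have "\<dots> \<le> expectation (\<lambda>\<omega>. 2 * l * \<bar>Y (p n) \<omega>\<bar>)"
    by (rule integral_mono) (use Hint[of n] Yint[of n] huber_bounds[OF l] in auto)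
  finally show "expectation (\<lambda>\<omega>. \<Sum>i<n. Z i \<omega>) \<le> 2 * l * expectation (\<lambda>\<omega>. \<bar>Y (p n) \<omega>\<bar>)" by simp
qed

end

text \<open>
  The division by zero for \<open>n = 0\<close> makes the grid constantly 0; every sum over it is empty then.
\<close>

definition grid :: "real \<Rightarrow> nat \<Rightarrow> nat \<Rightarrow> real" where
  "grid t n i = t * real i / real n"

lemma grid_0[simp]: "grid t n 0 = 0" by (simp add: grid_def)
lemma grid_self[simp]: "n > 0 \<Longrightarrow> grid t n n = t" by (simp add: grid_def)
lemma grid_nonneg[simp]: "t \<ge> 0 \<Longrightarrow> grid t n i \<ge> 0" by (simp add: grid_def)
lemma grid_Suc: "grid t n (Suc i) = grid t n i + t / real n"
  by (simp add: grid_def field_simps add_divide_distrib)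
lemma grid_le: "t \<ge> 0 \<Longrightarrow> i \<le> n \<Longrightarrow> grid t n i \<le> t"
  by (cases "n = 0") (auto simp: grid_def field_simps intro!: mult_left_mono)
lemma grid_mono: "t \<ge> 0 \<Longrightarrow> i \<le> j \<Longrightarrow> grid t n i \<le> grid t n j"
  by (auto simp: grid_def intro!: divide_right_mono mult_left_mono)
lemma grid_refine: "r > 0 \<Longrightarrow> grid t (m * r) (j * r) = grid t m j"
  by (simp add: grid_def)
lemma partition_grid: "t \<ge> 0 \<Longrightarrow> n > 0 \<Longrightarrow> partition t n (grid t n)"
  by (auto simp: partition_def intro: grid_mono)

context filtered_prob_space
begin

text \<open>
  Three small events are removed: the localizing time has not passed \<open>t\<close>, the stopped path is large
  somewhere on a grid, or the truncated quadratic variation is large. The first two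
  do not depend on the grid.
\<close>

lemma local_martingale_bounded_quadratic_variation:
  assumes N: "continuous_local_martingale M F N" and t: "t \<ge> 0"
  shows "bounded_in_prob (\<lambda>n \<omega>. \<Sum>i<n. (N (grid t n (Suc i)) \<omega> - N (grid t n i) \<omega>)\<^sup>2)"
  unfolding bounded_in_prob_def
proof (intro allI impI)
  fix \<epsilon> :: real assume "\<epsilon> > 0"
  then have e3: "\<epsilon>/3 > 0" by simp
  from N obtain T where T: "\<And>n::nat. stopping_time F (T n)"
    "\<And>n \<omega>. \<omega> \<in> space M \<Longrightarrow> 0 \<le> T n \<omega> \<and> T n \<omega> \<le> T (Suc n) \<omega>"
    "AE \<omega> in M. filterlim (\<lambda>n. T n \<omega>) at_top sequentially"
    "\<And>n. martingale M F (\<lambda>t \<omega>. N (min t (T n \<omega>)) \<omega> - N 0 \<omega>)"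
    and Nad: "adapted F N" and cont: "AE \<omega> in M. continuous_on {0..} (\<lambda>t. N t \<omega>)"
    unfolding continuous_local_martingale_def continuous_paths_def by blast
  have [measurable]: "T n \<in> borel_measurable M" for n
    using measurable_stopping_time[OF T(1), of M n] subalgebra_F by (auto simp: subalgebra_def)
  have ae1: "AE \<omega> in M. \<exists>m. t < T m \<omega>"
    using T(3)
  proof eventually_elim
    case (elim \<omega>)
    then have "\<forall>\<^sub>F n in sequentially. t < T n \<omega>" by (auto simp: filterlim_at_top_dense)
    then show ?case by (auto simp: eventually_sequentially)
  qed
  have meas: "{\<omega> \<in> space M. t < T m \<omega>} \<in> events" for m by measurable
  have mono: "t < T (Suc m) \<omega>" if "\<omega> \<in> space M" "t < T m \<omega>" for m \<omega>
    using T(2)[OF that(1), of m] that(2) by linarith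
  from exhausting_event[OF meas mono ae1 e3] obtain m E1 where E1: "E1 \<in> events" "prob E1 < \<epsilon>/3"
    "\<forall>m'\<ge>m. \<forall>\<omega>\<in>space M - E1. t < T m' \<omega>"
    by blast
  define Y where "Y s \<omega> = N (min s (T m \<omega>)) \<omega> - N 0 \<omega>" for s \<omega>
  have Y: "martingale M F Y" using T(4)[of m] by (simp add: Y_def[abs_def])
  have YM: "Y s \<in> borel_measurable M" if "s \<ge> 0" for s
    using Y that adapted_measurable by (auto simp: martingale_def)
  define Z where "Z = (\<lambda>(n, i) \<omega>. if i \<le> n then Y (grid t n i) \<omega> else 0)"
  have ae2: "AE \<omega> in M. \<exists>B. \<forall>i. \<bar>Z i \<omega>\<bar> \<le> B"
    using cont AE_space
  proof eventually_elim
    case (elim \<omega>)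
    have "compact ((\<lambda>t. N t \<omega>) ` {0..t})"
      by (intro compact_continuous_image continuous_on_subset[OF elim(1)]) auto
    then obtain B where "\<forall>s\<in>{0..t}. \<bar>N s \<omega>\<bar> \<le> B"
      by (auto dest!: compact_imp_bounded simp: bounded_iff)
    then have B: "\<bar>N s \<omega>\<bar> \<le> B" if "0 \<le> s" "s \<le> t" for s using that by auto
    have "\<bar>Z ni \<omega>\<bar> \<le> 2 * B" for ni
    proof -
      obtain n i where ni: "ni = (n, i)" by (cases ni)
      have B0: "\<bar>N 0 \<omega>\<bar> \<le> B" using B t by auto
      have "\<bar>N (min (grid t n i) (T m \<omega>)) \<omega>\<bar> \<le> B" if "i \<le> n"
        using T(2)[of \<omega> m] elim(2) t grid_le[OF t that] by (intro B) (auto simp: min_def)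
      then show ?thesis using B0 by (auto simp: ni Z_def Y_def)
    qed
    then show ?case by blast
  qed
  have ZM: "Z ni \<in> borel_measurable M" for ni
    using YM t by (cases ni) (simp add: Z_def)
  \<comment> \<open>The level \<open>l\<close> bounds the stopped martingale on all grids at once, so that the truncation below
    is inactive off \<open>E2\<close>.\<close>
  from uniform_bound_event[OF ZM ae2 e3] obtain l E2 where l: "l > 0"
    and E2: "E2 \<in> events" "prob E2 < \<epsilon>/3" "\<forall>\<omega>\<in>space M - E2. \<forall>i. \<bar>Z i \<omega>\<bar> \<le> l"
    by blast
  define C where "C = 2 * l * expectation (\<lambda>\<omega>. \<bar>Y t \<omega>\<bar>)"
  define K where "K = (C + 1) / (\<epsilon>/3)"
  have C: "C \<ge> 0" unfolding C_def using l by (intro mult_nonneg_nonneg) auto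
  have K: "K > 0" "C < \<epsilon>/3 * K" using C \<open>\<epsilon> > 0\<close> by (auto simp: K_def)
  have "\<exists>E\<in>events. prob E < \<epsilon> \<and>
     (\<forall>\<omega>\<in>space M - E. \<bar>\<Sum>i<n. (N (grid t n (Suc i)) \<omega> - N (grid t n i) \<omega>)\<^sup>2\<bar> \<le> K)" for n
  proof (cases "n = 0")
    case True
    then show ?thesis using K \<open>\<epsilon> > 0\<close> by (intro bexI[of _ "{}"]) auto
  next
    case False
    define V where "V \<omega> = (\<Sum>i<n. if \<bar>Y (grid t n i) \<omega>\<bar> \<le> l \<and> \<bar>Y (grid t n (Suc i)) \<omega>\<bar> \<le> l
      then (Y (grid t n (Suc i)) \<omega> - Y (grid t n i) \<omega>)\<^sup>2 else 0)" for \<omega>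
    have V: "integrable M V" "expectation V \<le> C"
      using martingale_truncated_quadratic_variation[OF Y, of l "grid t n" n] l t False grid_mono[OF t]
      unfolding C_def V_def by auto
    have "V \<omega> \<ge> 0" for \<omega> unfolding V_def by (intro sum_nonneg) simp
    moreover have "expectation V < \<epsilon>/3 * K" using V(2) K(2) by linarith
    ultimately have "\<exists>E\<in>events. prob E < \<epsilon>/3 \<and> (\<forall>\<omega>\<in>space M - E. \<bar>V \<omega>\<bar> \<le> K)"
      using K(1) V(1) by (intro Markov_event)
    then obtain E3 where E3: "E3 \<in> events" "prob E3 < \<epsilon>/3" "\<And>\<omega>. \<omega> \<in> space M - E3 \<Longrightarrow> \<bar>V \<omega>\<bar> \<le> K"
      by blast
    have "prob (E1 \<union> E2 \<union> E3) \<le> prob E1 + prob E2 + prob E3"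
      using measure_Un_le[of E1 M E2] measure_Un_le[of "E1 \<union> E2" M E3] E1 E2 E3 by auto
    then have "prob (E1 \<union> E2 \<union> E3) < \<epsilon>" using E1 E2 E3 by linarith
    moreover have "\<bar>\<Sum>i<n. (N (grid t n (Suc i)) \<omega> - N (grid t n i) \<omega>)\<^sup>2\<bar> \<le> K"
      if w: "\<omega> \<in> space M - (E1 \<union> E2 \<union> E3)" for \<omega>
    proof -
      have "V \<omega> = (\<Sum>i<n. (N (grid t n (Suc i)) \<omega> - N (grid t n i) \<omega>)\<^sup>2)"
        unfolding V_def
      proof (rule sum.cong)
        fix i assume "i \<in> {..<n}"
        then have i: "i \<le> n" "Suc i \<le> n" by auto
        have Tm: "t < T m \<omega>" using E1(3) w by blast
        have "Y (grid t n j) \<omega> = N (grid t n j) \<omega> - N 0 \<omega>" "\<bar>Y (grid t n j) \<omega>\<bar> \<le> l" if "j \<le> n" for j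
        proof -
          show "Y (grid t n j) \<omega> = N (grid t n j) \<omega> - N 0 \<omega>"
            using grid_le[OF t that] Tm by (simp add: Y_def)
          have "\<bar>Z (n, j) \<omega>\<bar> \<le> l" using E2(3) w by blast
          then show "\<bar>Y (grid t n j) \<omega>\<bar> \<le> l" using that by (simp add: Z_def)
        qed
        from this[OF i(1)] this[OF i(2)]
        show "(if \<bar>Y (grid t n i) \<omega>\<bar> \<le> l \<and> \<bar>Y (grid t n (Suc i)) \<omega>\<bar> \<le> l
            then (Y (grid t n (Suc i)) \<omega> - Y (grid t n i) \<omega>)\<^sup>2 else 0)
          = (N (grid t n (Suc i)) \<omega> - N (grid t n i) \<omega>)\<^sup>2" by simp
      qed simp
      then show ?thesis using E3(3)[of \<omega>] w by simp
    qed
    ultimately show ?thesis using E1 E2 E3 by (intro bexI[of _ "E1 \<union> E2 \<union> E3"]) auto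
  qed
  then show "\<exists>K. \<forall>n. \<exists>E\<in>events. prob E < \<epsilon> \<and>
     (\<forall>\<omega>\<in>space M - E. \<bar>\<Sum>i<n. (N (grid t n (Suc i)) \<omega> - N (grid t n i) \<omega>)\<^sup>2\<bar> \<le> K)" by blast
qed

text \<open>
  The sum of the squares is at most the square of the variation along the grid. The total variation of
  a path need not be measurable, but countably many grids suffice.
\<close>

lemma finite_variation_bounded_quadratic_variation:
  assumes A: "adapted F A" "AE \<omega> in M. locally_bounded_variation (\<lambda>t. A t \<omega>)" and t: "t \<ge> 0"
  shows "bounded_in_prob (\<lambda>n \<omega>. \<Sum>i<n. (A (grid t n (Suc i)) \<omega> - A (grid t n i) \<omega>)\<^sup>2)"
  unfolding bounded_in_prob_def
proof (intro allI impI)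
  fix \<epsilon> :: real assume e: "\<epsilon> > 0"
  define Z where "Z n \<omega> = (\<Sum>i<n. \<bar>A (grid t n (Suc i)) \<omega> - A (grid t n i) \<omega>\<bar>)" for n \<omega>
  have AM[measurable]: "A (grid t n i) \<in> borel_measurable M" for n i
    using A(1) t by (intro adapted_measurable) auto
  have ae1: "AE \<omega> in M. \<exists>B. \<forall>n. \<bar>Z n \<omega>\<bar> \<le> B"
    using A(2)
  proof eventually_elim
    case (elim \<omega>)
    then obtain B where B: "\<And>n p. partition t n p \<Longrightarrow> (\<Sum>i<n. \<bar>A (p (Suc i)) \<omega> - A (p i) \<omega>\<bar>) \<le> B"
      using t unfolding locally_bounded_variation_def by blast
    have "\<bar>Z n \<omega>\<bar> \<le> max B 0" for n
      using B[OF partition_grid[OF t], of n] by (cases "n = 0") (auto simp: Z_def sum_nonneg)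
    then show ?case by blast
  qed
  have ZM: "Z n \<in> borel_measurable M" for n unfolding Z_def by measurable
  from uniform_bound_event[OF ZM ae1 e] obtain K E where K: "K > 0" "E \<in> events" "prob E < \<epsilon>"
    "\<forall>\<omega>\<in>space M - E. \<forall>n. \<bar>Z n \<omega>\<bar> \<le> K"
    by blast
  have "\<bar>\<Sum>i<n. (A (grid t n (Suc i)) \<omega> - A (grid t n i) \<omega>)\<^sup>2\<bar> \<le> K\<^sup>2" if "\<omega> \<in> space M - E" for n \<omega>
  proof -
    have "sqrt (\<Sum>i<n. (A (grid t n (Suc i)) \<omega> - A (grid t n i) \<omega>)\<^sup>2) \<le> Z n \<omega>"
      using L2_set_le_sum[of "{..<n}" "\<lambda>i. \<bar>A (grid t n (Suc i)) \<omega> - A (grid t n i) \<omega>\<bar>"]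
      by (simp add: L2_set_def Z_def)
    also have "\<bar>Z n \<omega>\<bar> \<le> K" using K(4) that by blast
    then have "Z n \<omega> \<le> K" by simp
    finally show ?thesis using K by (simp add: sum_nonneg real_sqrt_le_iff' sqrt_le_D)
  qed
  then show "\<exists>K. \<forall>n. \<exists>E\<in>events. prob E < \<epsilon> \<and>
     (\<forall>\<omega>\<in>space M - E. \<bar>\<Sum>i<n. (A (grid t n (Suc i)) \<omega> - A (grid t n i) \<omega>)\<^sup>2\<bar> \<le> K)"
    using K by blast
qed

lemma semimartingale_bounded_quadratic_variation:
  assumes X: "continuous_semimartingale M F X" and t: "t \<ge> 0"
  shows "bounded_in_prob (\<lambda>n \<omega>. \<Sum>i<n. (X (grid t n (Suc i)) \<omega> - X (grid t n i) \<omega>)\<^sup>2)"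
proof -
  from X obtain N A where N: "continuous_local_martingale M F N" and A: "adapted F A"
    "AE \<omega> in M. locally_bounded_variation (\<lambda>t. A t \<omega>)"
    and eq: "AE \<omega> in M. \<forall>t\<ge>0. X t \<omega> = N t \<omega> + A t \<omega>"
    unfolding continuous_semimartingale_def by blast
  let ?q = "\<lambda>Y n \<omega>. \<Sum>i<n. (Y (grid t n (Suc i)) \<omega> - Y (grid t n i) \<omega>)\<^sup>2"
  have b: "bounded_in_prob (\<lambda>n \<omega>. (?q N n \<omega> + ?q A n \<omega>) + (?q N n \<omega> + ?q A n \<omega>))"
    using local_martingale_bounded_quadratic_variation[OF N t]
      finite_variation_bounded_quadratic_variation[OF A t] by (intro bounded_in_prob_add)
  show ?thesis
  proof (rule bounded_in_prob_mono[OF b])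
    fix n
    show "AE \<omega> in M. \<bar>?q X n \<omega>\<bar> \<le> \<bar>(?q N n \<omega> + ?q A n \<omega>) + (?q N n \<omega> + ?q A n \<omega>)\<bar>"
      using eq
    proof eventually_elim
      case (elim \<omega>)
      have "?q X n \<omega> \<le> (\<Sum>i<n. 2 * (N (grid t n (Suc i)) \<omega> - N (grid t n i) \<omega>)\<^sup>2
          + 2 * (A (grid t n (Suc i)) \<omega> - A (grid t n i) \<omega>)\<^sup>2)"
      proof (rule sum_mono)
        fix i
        have ab: "(a + b)\<^sup>2 \<le> 2 * a\<^sup>2 + 2 * b\<^sup>2" for a b :: real
          using zero_le_power2[of "a - b"] by (simp add: power2_eq_square algebra_simps)
        have "X (grid t n (Suc i)) \<omega> - X (grid t n i) \<omega> =
          (N (grid t n (Suc i)) \<omega> - N (grid t n i) \<omega>) + (A (grid t n (Suc i)) \<omega> - A (grid t n i) \<omega>)"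
          using elim t by simp
        then show "(X (grid t n (Suc i)) \<omega> - X (grid t n i) \<omega>)\<^sup>2
          \<le> 2 * (N (grid t n (Suc i)) \<omega> - N (grid t n i) \<omega>)\<^sup>2
          + 2 * (A (grid t n (Suc i)) \<omega> - A (grid t n i) \<omega>)\<^sup>2" using ab by simp
      qed
      also have "\<dots> = (?q N n \<omega> + ?q A n \<omega>) + (?q N n \<omega> + ?q A n \<omega>)"
        by (simp add: sum.distrib sum_distrib_left[symmetric])
      finally show ?case by (simp add: sum_nonneg)
    qed
  qed
qed

end

section \<open>Moduli of continuity on grids\<close>

text \<open>
  The modulus of continuity on \<open>[0, t]\<close> at scale \<open>t / (n + 1)\<close>.
\<close>

definition modulus :: "real \<Rightarrow> (real \<Rightarrow> 'a \<Rightarrow> 'b::real_normed_vector) \<Rightarrow> nat \<Rightarrow> 'a \<Rightarrow> real" where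
  "modulus t Z n \<omega> =
     Sup {norm (Z s \<omega> - Z s' \<omega>) | s s'. s \<in> {0..t} \<and> s' \<in> {0..t} \<and> \<bar>s - s'\<bar> \<le> t / real (Suc n)}"

lemma modulus_bound:
  assumes cont: "continuous_on {0..t} (\<lambda>s. Z s \<omega>)"
    and "s \<in> {0..t}" "s' \<in> {0..t}" "\<bar>s - s'\<bar> \<le> t / real (Suc n)"
  shows "norm (Z s \<omega> - Z s' \<omega>) \<le> modulus t Z n \<omega>"
  unfolding modulus_def
proof (rule cSup_upper)
  have "bounded ((\<lambda>s. Z s \<omega>) ` {0..t})"
    by (intro compact_imp_bounded compact_continuous_image cont) auto
  then obtain B where "\<forall>s\<in>{0..t}. norm (Z s \<omega>) \<le> B"
    by (auto simp: bounded_iff)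
  then have B: "norm (Z s \<omega>) \<le> B" if "s \<in> {0..t}" for s using that by blast
  show "bdd_above {norm (Z s \<omega> - Z s' \<omega>) | s s'. s \<in> {0..t} \<and> s' \<in> {0..t} \<and> \<bar>s - s'\<bar> \<le> t / real (Suc n)}"
  proof (rule bdd_aboveI[of _ "2 * B"])
    fix y assume "y \<in> {norm (Z s \<omega> - Z s' \<omega>) | s s'. s \<in> {0..t} \<and> s' \<in> {0..t} \<and> \<bar>s - s'\<bar> \<le> t / real (Suc n)}"
    then obtain s s' where y: "y = norm (Z s \<omega> - Z s' \<omega>)" "s \<in> {0..t}" "s' \<in> {0..t}" by blast
    show "y \<le> 2 * B"
      using norm_triangle_ineq4[of "Z s \<omega>" "Z s' \<omega>"] B[OF y(2)] B[OF y(3)] y(1) by linarith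
  qed
qed (use assms in blast)

lemma modulus_le:
  assumes t: "t > 0"
    and le: "\<And>s s'. s \<in> {0..t} \<Longrightarrow> s' \<in> {0..t} \<Longrightarrow> \<bar>s - s'\<bar> \<le> t / real (Suc n) \<Longrightarrow> norm (Z s \<omega> - Z s' \<omega>) \<le> \<eta>"
  shows "modulus t Z n \<omega> \<le> \<eta>"
  unfolding modulus_def
proof (rule cSup_least)
  have "norm (Z 0 \<omega> - Z 0 \<omega>) \<in> {norm (Z s \<omega> - Z s' \<omega>) | s s'. s \<in> {0..t} \<and> s' \<in> {0..t} \<and> \<bar>s - s'\<bar> \<le> t / real (Suc n)}"
    using t by (intro CollectI exI[of _ 0]) auto
  then show "{norm (Z s \<omega> - Z s' \<omega>) | s s'. s \<in> {0..t} \<and> s' \<in> {0..t} \<and> \<bar>s - s'\<bar> \<le> t / real (Suc n)} \<noteq> {}"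
    by blast
qed (use le in blast)

lemma modulus_nonneg:
  assumes t: "t > 0" and cont: "continuous_on {0..t} (\<lambda>s. Z s \<omega>)"
  shows "modulus t Z n \<omega> \<ge> 0"
  using modulus_bound[where Z=Z and \<omega>=\<omega> and s=0 and s'=0, OF cont] t by simp

definition grid_floor :: "real \<Rightarrow> nat \<Rightarrow> real \<Rightarrow> nat" where
  "grid_floor t n s = nat \<lfloor>real n * s / t\<rfloor>"

lemma grid_floor:
  assumes t: "t > 0" and s: "s \<in> {0..t}" and n: "n > 0"
  shows "grid_floor t n s \<le> n" "\<bar>s - grid t n (grid_floor t n s)\<bar> \<le> t / real n"
proof -
  have nn: "0 \<le> real n * s / t" using s t by auto
  have "real n * s / t \<le> real n" using s t n by (simp add: field_simps)
  then show "grid_floor t n s \<le> n" unfolding grid_floor_def using nn by linarith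
  have r: "real (grid_floor t n s) = of_int \<lfloor>real n * s / t\<rfloor>" using nn by (simp add: grid_floor_def)
  have "\<bar>real n * s / t - real (grid_floor t n s)\<bar> \<le> 1" unfolding r by linarith
  moreover have "s - grid t n (grid_floor t n s) = (t / real n) * (real n * s / t - real (grid_floor t n s))"
    using t n by (simp add: grid_def field_simps)
  ultimately show "\<bar>s - grid t n (grid_floor t n s)\<bar> \<le> t / real n"
    using t n by (simp add: abs_mult divide_right_mono mult_left_le)
qed

lemma grid_floor_tendsto:
  assumes t: "t > 0" and s: "s \<in> {0..t}"
  shows "(\<lambda>n. grid t n (grid_floor t n s)) \<longlonglongrightarrow> s"
proof -
  have "(\<lambda>n. grid t n (grid_floor t n s) - s) \<longlonglongrightarrow> 0"
  proof (rule Lim_null_comparison)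
    show "\<forall>\<^sub>F n in sequentially. norm (grid t n (grid_floor t n s) - s) \<le> t * (1 / real n)"
      using eventually_gt_at_top[of 0]
      by eventually_elim (use grid_floor(2)[OF t s] in \<open>simp add: abs_minus_commute\<close>)
    show "(\<lambda>n. t * (1 / real n)) \<longlonglongrightarrow> 0" using tendsto_mult_right_zero[OF lim_1_over_n] by simp
  qed
  then show ?thesis by (simp add: LIM_zero_iff)
qed

text \<open>
  Grid points are dense in \<open>[0, t]\<close>, so for continuous paths they control the modulus at every smaller
  scale. The strict inequality \<open>n > m\<close> leaves room for approximating two times by grid points.
\<close>

lemma modulus_dense:
  assumes t: "t > 0" and cont: "continuous_on {0..t} (\<lambda>s. Z s \<omega>)"
    and g: "\<And>n i j. i \<le> n \<Longrightarrow> j \<le> n \<Longrightarrow> \<bar>grid t n i - grid t n j\<bar> \<le> t / real (Suc m) \<Longrightarrow>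
        norm (Z (grid t n i) \<omega> - Z (grid t n j) \<omega>) \<le> \<eta>"
    and n: "n > m"
  shows "modulus t Z n \<omega> \<le> \<eta>"
proof (rule modulus_le[OF t])
  fix s s' assume s: "s \<in> {0..t}" "s' \<in> {0..t}" "\<bar>s - s'\<bar> \<le> t / real (Suc n)"
  let ?g = "\<lambda>s n. grid t n (grid_floor t n s)"
  have lim: "(\<lambda>n. Z (?g s n) \<omega>) \<longlonglongrightarrow> Z s \<omega>" if "s \<in> {0..t}" for s
  proof (rule continuous_on_tendsto_compose[OF cont grid_floor_tendsto[OF t that] that])
    show "\<forall>\<^sub>F n in sequentially. ?g s n \<in> {0..t}"
      using eventually_gt_at_top[of 0]
      by eventually_elim (use t grid_le[of t] grid_floor(1)[OF t that] in auto)
  qed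
  have "t / real (Suc n) < t / real (Suc m)" using t n by (intro divide_strict_left_mono) auto
  with s have lt: "\<bar>s - s'\<bar> < t / real (Suc m)" by linarith
  have "(\<lambda>n. \<bar>?g s n - ?g s' n\<bar>) \<longlonglongrightarrow> \<bar>s - s'\<bar>"
    by (intro tendsto_intros grid_floor_tendsto t s)
  from order_tendstoD(2)[OF this lt] eventually_gt_at_top[of 0]
  have "\<forall>\<^sub>F n in sequentially. norm (Z (?g s n) \<omega> - Z (?g s' n) \<omega>) \<le> \<eta>"
    by eventually_elim (use g grid_floor(1)[OF t s(1)] grid_floor(1)[OF t s(2)] in auto)
  moreover have "(\<lambda>n. norm (Z (?g s n) \<omega> - Z (?g s' n) \<omega>)) \<longlonglongrightarrow> norm (Z s \<omega> - Z s' \<omega>)"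
    by (intro tendsto_intros lim s)
  ultimately show "norm (Z s \<omega> - Z s' \<omega>) \<le> \<eta>"
    by (intro tendsto_upperbound[where F=sequentially]) auto
qed

text \<open>
  Uniform continuity of the paths gives almost sure convergence. To pass to convergence in probability
  the modulus is compared with its countable version over grid points, which is measurable.
\<close>

lemma (in prob_space) modulus_vanishing:
  fixes Z :: "real \<Rightarrow> 'a \<Rightarrow> 'b::euclidean_space"
  assumes t: "t > 0" and Z: "\<And>s. s \<ge> 0 \<Longrightarrow> Z s \<in> borel_measurable M"
    and cont: "continuous_paths M Z"
  shows "vanishing_in_prob (modulus t Z)"
  unfolding vanishing_in_prob_def
proof (intro allI impI)
  fix \<epsilon> :: real assume e: "\<epsilon> > 0"
  define P where "P m \<omega> \<longleftrightarrow> (\<forall>n i j. i \<le> n \<longrightarrow> j \<le> n \<longrightarrow> \<bar>grid t n i - grid t n j\<bar> \<le> t / real (Suc m) \<longrightarrow>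
    norm (Z (grid t n i) \<omega> - Z (grid t n j) \<omega>) \<le> \<epsilon>)" for m \<omega>
  have [measurable]: "Z (grid t n i) \<in> borel_measurable M" for n i using t Z by auto
  have meas: "{\<omega> \<in> space M. P m \<omega>} \<in> events" for m unfolding P_def by measurable
  have mono: "P (Suc m) \<omega>" if "P m \<omega>" for m \<omega>
    unfolding P_def
  proof (intro allI impI)
    fix n i j assume a: "i \<le> n" "j \<le> n" "\<bar>grid t n i - grid t n j\<bar> \<le> t / real (Suc (Suc m))"
    have "t / real (Suc (Suc m)) \<le> t / real (Suc m)" using t by (intro divide_left_mono) auto
    with a that show "norm (Z (grid t n i) \<omega> - Z (grid t n j) \<omega>) \<le> \<epsilon>"
      unfolding P_def by (meson order_trans)
  qed
  have c: "AE \<omega> in M. continuous_on {0..t} (\<lambda>s. Z s \<omega>)"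
    using cont unfolding continuous_paths_def
    by eventually_elim (auto elim: continuous_on_subset)
  have ae: "AE \<omega> in M. \<exists>m. P m \<omega>"
    using c
  proof eventually_elim
    case (elim \<omega>)
    have "uniformly_continuous_on {0..t} (\<lambda>s. Z s \<omega>)"
      by (rule compact_uniformly_continuous[OF elim]) simp
    then obtain d where d: "d > 0"
      "\<And>s s'. s \<in> {0..t} \<Longrightarrow> s' \<in> {0..t} \<Longrightarrow> dist s' s < d \<Longrightarrow> dist (Z s' \<omega>) (Z s \<omega>) < \<epsilon>"
      using e unfolding uniformly_continuous_on_def by metis
    obtain m where m: "1 / real (Suc m) < d / t" using nat_approx_posE[of "d / t"] d t by auto
    then have m': "t / real (Suc m) < d" using t by (simp add: field_simps)
    have "P m \<omega>" unfolding P_def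
    proof (intro allI impI)
      fix n i j assume a: "i \<le> n" "j \<le> n" "\<bar>grid t n i - grid t n j\<bar> \<le> t / real (Suc m)"
      have "dist (Z (grid t n i) \<omega>) (Z (grid t n j) \<omega>) < \<epsilon>"
        using a m' t by (intro d(2)) (auto simp: dist_real_def grid_le)
      then show "norm (Z (grid t n i) \<omega> - Z (grid t n j) \<omega>) \<le> \<epsilon>" by (simp add: dist_norm)
    qed
    then show ?case ..
  qed
  from exhausting_event[OF meas mono ae e] obtain m E where E: "E \<in> events" "prob E < \<epsilon>"
    "\<forall>m'\<ge>m. \<forall>\<omega>\<in>space M - E. P m' \<omega>" by blast
  from null_set_absorb[OF E(1,2) c] obtain E' where E': "E' \<in> events" "prob E' < \<epsilon>" "E \<subseteq> E'"
    "\<And>\<omega>. \<omega> \<in> space M - E' \<Longrightarrow> continuous_on {0..t} (\<lambda>s. Z s \<omega>)" by blast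
  have "\<bar>modulus t Z n \<omega>\<bar> \<le> \<epsilon>" if "n > m" "\<omega> \<in> space M - E'" for n \<omega>
  proof -
    have "P m \<omega>" using E(3) E'(3) that by blast
    then have "modulus t Z n \<omega> \<le> \<epsilon>"
      by (intro modulus_dense[where Z=Z and \<omega>=\<omega>, OF t E'(4)[OF that(2)] _ that(1)]) (simp add: P_def)
    then show ?thesis using modulus_nonneg[where Z=Z and \<omega>=\<omega> and n=n, OF t E'(4)[OF that(2)]] by simp
  qed
  then show "\<forall>\<^sub>F n in sequentially. \<exists>E\<in>events. prob E < \<epsilon> \<and> (\<forall>\<omega>\<in>space M - E. \<bar>modulus t Z n \<omega>\<bar> \<le> \<epsilon>)"
    using E' by (auto intro!: eventually_mono[OF eventually_gt_at_top[of m]])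
qed

section \<open>The Ito isometry on blocks of a grid\<close>

lemma sum_blocks: "(\<Sum>i<m * c. f i) = (\<Sum>j<m. \<Sum>r<c. f (j * c + r))" for f :: "nat \<Rightarrow> 'b::comm_monoid_add"
proof -
  have "(\<Sum>r<c. f (j * c + r)) = sum f {j * c..<j * c + c}" for j
    using sum.shift_bounds_nat_ivl[of f 0 "j * c" c, symmetric]
    by (simp add: atLeast0LessThan add.commute)
  then show ?thesis by (simp add: sum.nat_group)
qed

context filtered_prob_space
begin

text \<open>
  By the isometry the expectation is the time average of the second moments of the coefficients. These
  are uniformly small since the coefficients are bounded, and small off a small event.
  Grouping into blocks is needed when the single block sums enter quadratically.
\<close>

lemma block_Ito_vanishing:
  assumes bm: "brownian_motion M F w" and t: "t > 0"
    and pos: "\<And>n. m n > 0" "\<And>n. c n > 0"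
    and h: "\<And>n i. i < m n * c n \<Longrightarrow> h n i \<in> borel_measurable (F (grid t (m n * c n) i))"
      "\<And>n i \<omega>. i < m n * c n \<Longrightarrow> \<bar>h n i \<omega>\<bar> \<le> C"
    and small: "vanishing_in_prob Z" "\<And>n. AE \<omega> in M. \<forall>i<m n * c n. \<bar>h n i \<omega>\<bar> \<le> \<bar>Z n \<omega>\<bar>"
  shows "vanishing_in_prob (\<lambda>n \<omega>. \<Sum>j<m n. (\<Sum>r<c n. h n (j * c n + r) \<omega> *
      (w (grid t (m n * c n) (Suc (j * c n + r))) \<omega> - w (grid t (m n * c n) (j * c n + r)) \<omega>))\<^sup>2)"
proof (rule vanishing_in_prob_expectation)
  let ?g = "\<lambda>n. grid t (m n * c n)"
  let ?S = "\<lambda>n j \<omega>. \<Sum>r<c n. h n (j * c n + r) \<omega> * (w (?g n (Suc (j * c n + r))) \<omega> - w (?g n (j * c n + r)) \<omega>)"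
  have idx: "j * c n + r < m n * c n" if "j < m n" "r < c n" for j r n
  proof -
    have "j * c n + r < Suc j * c n" using that by simp
    also have "\<dots> \<le> m n * c n" using that by (intro mult_right_mono) auto
    finally show ?thesis .
  qed
  have lt: "?g n i < ?g n (Suc i)" for n i
    using t pos by (simp add: grid_Suc)
  have step: "?g n (Suc i) - ?g n i = t / real (m n * c n)" for n i
    by (simp add: grid_Suc)
  have *: "integrable M (\<lambda>\<omega>. (?S n j \<omega>)\<^sup>2)"
    "expectation (\<lambda>\<omega>. (?S n j \<omega>)\<^sup>2) = (\<Sum>r<c n. t / real (m n * c n) * expectation (\<lambda>\<omega>. (h n (j * c n + r) \<omega>)\<^sup>2))"
    if "j < m n" for n j
    using discrete_Ito_isometry[OF bm, of "\<lambda>r. ?g n (j * c n + r)" "c n" "\<lambda>r. h n (j * c n + r)" C]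
      idx[OF that] lt h t step by auto
  show "integrable M (\<lambda>\<omega>. \<Sum>j<m n. (?S n j \<omega>)\<^sup>2)" for n using * by auto
  show "(\<Sum>j<m n. (?S n j \<omega>)\<^sup>2) \<ge> 0" for n \<omega> by (intro sum_nonneg) auto
  have e: "expectation (\<lambda>\<omega>. \<Sum>j<m n. (?S n j \<omega>)\<^sup>2)
      = (\<Sum>i<m n * c n. t / real (m n * c n) * expectation (\<lambda>\<omega>. (h n i \<omega>)\<^sup>2))" for n
    using * by (simp add: sum_blocks Bochner_Integration.integral_sum)
  show "(\<lambda>n. expectation (\<lambda>\<omega>. \<Sum>j<m n. (?S n j \<omega>)\<^sup>2)) \<longlonglongrightarrow> 0"
    unfolding e
  proof (rule LIMSEQ_I)
    fix r :: real assume r: "r > 0"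
    \<comment> \<open>Chosen so that \<open>t * (\<eta>\<^sup>2 + C\<^sup>2 * \<eta>)\<close> is less than \<open>r\<close>; the square is absorbed by \<open>\<eta> \<le> 1\<close>.\<close>
    define \<eta> where "\<eta> = min 1 (r / (2 * t * (1 + C\<^sup>2)))"
    have C2: "1 + C\<^sup>2 > 0" by (simp add: add_pos_nonneg)
    have eta: "\<eta> > 0" "\<eta> \<le> 1" "t * (1 + C\<^sup>2) * \<eta> < r"
    proof -
      show "\<eta> > 0" "\<eta> \<le> 1" using r t C2 by (auto simp: \<eta>_def)
      have "t * (1 + C\<^sup>2) * \<eta> \<le> t * (1 + C\<^sup>2) * (r / (2 * t * (1 + C\<^sup>2)))"
        using t C2 by (intro mult_left_mono) (auto simp: \<eta>_def)
      also have "\<dots> = r / 2" using t less_imp_neq[OF C2] by (simp add: divide_simps)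
      finally show "t * (1 + C\<^sup>2) * \<eta> < r" using r by simp
    qed
    from vanishing_in_probD[OF small(1) eta(1)] obtain n0 where
      n0: "\<And>n. n \<ge> n0 \<Longrightarrow> \<exists>E\<in>events. prob E < \<eta> \<and> (\<forall>\<omega>\<in>space M - E. \<bar>Z n \<omega>\<bar> \<le> \<eta>)"
      by (auto simp: eventually_sequentially)
    have "norm ((\<Sum>i<m n * c n. t / real (m n * c n) * expectation (\<lambda>\<omega>. (h n i \<omega>)\<^sup>2)) - 0) < r" if n: "n \<ge> n0" for n
    proof -
      from n0[OF n] obtain E where E: "E \<in> events" "prob E < \<eta>" "\<forall>\<omega>\<in>space M - E. \<bar>Z n \<omega>\<bar> \<le> \<eta>" by blast
      from null_set_absorb[OF E(1,2) small(2)[of n]] obtain E' where E': "E' \<in> events" "prob E' < \<eta>" "E \<subseteq> E'"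
        "\<And>\<omega>. \<omega> \<in> space M - E' \<Longrightarrow> \<forall>i<m n * c n. \<bar>h n i \<omega>\<bar> \<le> \<bar>Z n \<omega>\<bar>" by blast
      have bound: "expectation (\<lambda>\<omega>. (h n i \<omega>)\<^sup>2) \<le> (1 + C\<^sup>2) * \<eta>" if i: "i < m n * c n" for i
      proof -
        have hM: "h n i \<in> borel_measurable M" using h(1)[OF i] by (rule measurable_F_M)
        have ind: "integrable M (indicator E' :: 'a \<Rightarrow> real)"
          using E'(1) by (simp add: emeasure_eq_measure)
        have "expectation (\<lambda>\<omega>. (h n i \<omega>)\<^sup>2) \<le> expectation (\<lambda>\<omega>. \<eta>\<^sup>2 + C\<^sup>2 * indicator E' \<omega>)"
        proof (rule integral_mono)
          show "integrable M (\<lambda>\<omega>. (h n i \<omega>)\<^sup>2)"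
            by (rule integrable_const_bound[of _ "C\<^sup>2"])
               (use hM h(2)[OF i] in \<open>auto intro!: AE_I2 power2_le_if_abs_le\<close>)
          show "integrable M (\<lambda>\<omega>. \<eta>\<^sup>2 + C\<^sup>2 * indicator E' \<omega>)"
            by (intro Bochner_Integration.integrable_add integrable_mult_right ind) simp
          fix \<omega> assume w: "\<omega> \<in> space M"
          show "(h n i \<omega>)\<^sup>2 \<le> \<eta>\<^sup>2 + C\<^sup>2 * indicator E' \<omega>"
          proof (cases "\<omega> \<in> E'")
            case True
            then show ?thesis using power2_le_if_abs_le[OF h(2)[OF i, of \<omega>]] by (simp add: add_increasing)
          next
            case False
            have "\<bar>h n i \<omega>\<bar> \<le> \<bar>Z n \<omega>\<bar>" using E'(4) w False i by blast
            also have "\<dots> \<le> \<eta>" using E(3) E'(3) w False by blast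
            finally show ?thesis using False power2_le_if_abs_le by simp
          qed
        qed
        also have "\<dots> = \<eta>\<^sup>2 + C\<^sup>2 * prob E'"
          using ind E'(1) by (subst Bochner_Integration.integral_add)
            (auto simp: prob_space Int_absorb1 sets.sets_into_space)
        also have "\<dots> \<le> \<eta> + C\<^sup>2 * \<eta>"
          using E' eta by (intro add_mono mult_left_mono) (auto simp: power2_eq_square mult_left_le)
        finally show ?thesis by (simp add: algebra_simps)
      qed
      have "(\<Sum>i<m n * c n. t / real (m n * c n) * expectation (\<lambda>\<omega>. (h n i \<omega>)\<^sup>2))
          \<le> (\<Sum>i<m n * c n. t / real (m n * c n) * ((1 + C\<^sup>2) * \<eta>))"
        using t bound by (intro sum_mono mult_left_mono) auto
      also have "\<dots> = t * (1 + C\<^sup>2) * \<eta>" using pos[of n] by simp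
      also have "\<dots> < r" by (rule eta)
      finally have "(\<Sum>i<m n * c n. t / real (m n * c n) * expectation (\<lambda>\<omega>. (h n i \<omega>)\<^sup>2)) < r" .
      moreover have "(\<Sum>i<m n * c n. t / real (m n * c n) * expectation (\<lambda>\<omega>. (h n i \<omega>)\<^sup>2)) \<ge> 0"
        using t by (intro sum_nonneg mult_nonneg_nonneg) auto
      ultimately show ?thesis by simp
    qed
    then show "\<exists>n0. \<forall>n\<ge>n0. norm ((\<Sum>i<m n * c n. t / real (m n * c n) * expectation (\<lambda>\<omega>. (h n i \<omega>)\<^sup>2)) - 0) < r"
      by blast
  qed
qed

lemma Ito_vanishing:
  assumes bm: "brownian_motion M F w" and t: "t > 0"
    and pos: "\<And>n. c n > 0"
    and h: "\<And>n i. i < c n \<Longrightarrow> h n i \<in> borel_measurable (F (grid t (c n) i))"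
      "\<And>n i \<omega>. i < c n \<Longrightarrow> \<bar>h n i \<omega>\<bar> \<le> C"
    and small: "vanishing_in_prob Z" "\<And>n. AE \<omega> in M. \<forall>i<c n. \<bar>h n i \<omega>\<bar> \<le> \<bar>Z n \<omega>\<bar>"
  shows "vanishing_in_prob (\<lambda>n \<omega>. \<Sum>i<c n. h n i \<omega> * (w (grid t (c n) (Suc i)) \<omega> - w (grid t (c n) i) \<omega>))"
proof (rule vanishing_in_prob_power2D)
  have "vanishing_in_prob (\<lambda>n \<omega>. \<Sum>j<1::nat. (\<Sum>r<c n. h n (j * c n + r) \<omega> *
      (w (grid t (1 * c n) (Suc (j * c n + r))) \<omega> - w (grid t (1 * c n) (j * c n + r)) \<omega>))\<^sup>2)"
    by (rule block_Ito_vanishing[OF bm t _ pos _ _ small(1)], unfold mult_1)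
       (simp, rule h(1), assumption, rule h(2), assumption, rule small(2))
  then show "vanishing_in_prob (\<lambda>n \<omega>. (\<Sum>i<c n. h n i \<omega> *
      (w (grid t (c n) (Suc i)) \<omega> - w (grid t (c n) i) \<omega>))\<^sup>2)" by simp
qed

lemma brownian_bounded_quadratic_variation:
  assumes bm: "brownian_motion M F w" and t: "t > 0"
  shows "bounded_in_prob (\<lambda>n \<omega>. \<Sum>i<n. (w (grid t n (Suc i)) \<omega> - w (grid t n i) \<omega>)\<^sup>2)"
proof (rule bounded_in_prob_expectation)
  fix n
  have *: "integrable M (\<lambda>\<omega>. (w (grid t n (Suc i)) \<omega> - w (grid t n i) \<omega>)\<^sup>2)"
    "expectation (\<lambda>\<omega>. (w (grid t n (Suc i)) \<omega> - w (grid t n i) \<omega>)\<^sup>2) = t / real n" if "i < n" for i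
  proof -
    have le: "0 \<le> grid t n i" "grid t n i < grid t n (Suc i)" using t that by (simp_all add: grid_Suc)
    have one: "(\<lambda>_. 1) \<in> borel_measurable (F (grid t n i))" "integrable M (\<lambda>_. 1 :: real)" by simp_all
    show "integrable M (\<lambda>\<omega>. (w (grid t n (Suc i)) \<omega> - w (grid t n i) \<omega>)\<^sup>2)"
      using brownian_increment(3)[OF bm le one] by simp
    show "expectation (\<lambda>\<omega>. (w (grid t n (Suc i)) \<omega> - w (grid t n i) \<omega>)\<^sup>2) = t / real n"
      using brownian_increment(4)[OF bm le one] by (simp add: grid_Suc prob_space)
  qed
  show "integrable M (\<lambda>\<omega>. \<Sum>i<n. (w (grid t n (Suc i)) \<omega> - w (grid t n i) \<omega>)\<^sup>2)"
    using * by auto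
  have "expectation (\<lambda>\<omega>. \<Sum>i<n. (w (grid t n (Suc i)) \<omega> - w (grid t n i) \<omega>)\<^sup>2) = (\<Sum>i<n. t / real n)"
    using * by (subst Bochner_Integration.integral_sum) auto
  also have "\<dots> \<le> t" using t by simp
  finally show "expectation (\<lambda>\<omega>. \<Sum>i<n. (w (grid t n (Suc i)) \<omega> - w (grid t n i) \<omega>)\<^sup>2) \<le> t" .
qed (auto intro: sum_nonneg)

end

section \<open>Trapezoidal sums on nested grids\<close>

text \<open>
  The trapezoidal sum up to the coarse grid point \<open>grid t m l\<close>, evaluated on the grid that divides each
  of the \<open>m\<close> cells into \<open>r\<close> equal parts.
\<close>

definition partial_trapezoid ::
  "(real \<Rightarrow> 'a \<Rightarrow> 'b::euclidean_space) \<Rightarrow> (real \<Rightarrow> 'a \<Rightarrow> real) \<Rightarrow> real \<Rightarrow> nat \<Rightarrow> nat \<Rightarrow> nat \<Rightarrow> 'a \<Rightarrow> 'b" where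
  "partial_trapezoid Y w t m r l \<omega> = trapezoid_sum Y w (l * r) (grid t (m * r)) \<omega>"

text \<open>
  The definition of the integral is used at the finitely many coarse grid points, with one mesh for
  all of them. The tolerance \<open>1 / (m + 1)\<^sup>2\<close> is chosen so that both the probabilities and the errors
  stay small after summation over the \<open>m + 1\<close> points.
\<close>

lemma (in filtered_prob_space) trapezoid_approximation:
  assumes si: "has_stratonovich_integral M Y w I" and t: "t > 0"
  shows "\<exists>r>0. \<exists>E\<in>events. prob E \<le> 1 / real (Suc m) \<and> (\<forall>\<omega>\<in>space M - E. \<forall>l\<le>m.
     norm (partial_trapezoid Y w t m r l \<omega> - I (grid t m l) \<omega>) \<le> 1 / (real (Suc m))\<^sup>2)"
proof -
  define e where "e = 1 / (real (Suc m))\<^sup>2"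
  have e: "e > 0" by (simp add: e_def)
  have "\<forall>l. \<exists>\<delta>>0. \<forall>n p. partition (grid t m l) n p \<longrightarrow> (\<forall>i<n. p (Suc i) - p i < \<delta>) \<longrightarrow>
        prob {\<omega>\<in>space M. norm (trapezoid_sum Y w n p \<omega> - I (grid t m l) \<omega>) > e} < e"
    using si t e unfolding has_stratonovich_integral_def by auto
  from choice[OF this] obtain \<delta> where "\<forall>l. \<delta> l > 0 \<and>
        (\<forall>n p. partition (grid t m l) n p \<longrightarrow> (\<forall>i<n. p (Suc i) - p i < \<delta> l) \<longrightarrow>
        prob {\<omega>\<in>space M. norm (trapezoid_sum Y w n p \<omega> - I (grid t m l) \<omega>) > e} < e)" ..
  then have \<delta>: "\<And>l. \<delta> l > 0" "\<And>l n p. partition (grid t m l) n p \<Longrightarrow>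
        (\<forall>i<n. p (Suc i) - p i < \<delta> l) \<Longrightarrow>
        prob {\<omega>\<in>space M. norm (trapezoid_sum Y w n p \<omega> - I (grid t m l) \<omega>) > e} < e"
    by blast+
  define d where "d = Min (\<delta> ` {..m})"
  have d: "d > 0" "\<And>l. l \<le> m \<Longrightarrow> d \<le> \<delta> l" using \<delta>(1) by (auto simp: d_def)
  obtain r' where r': "1 / real (Suc r') < d / t" using nat_approx_posE[of "d / t"] d t by auto
  define r where "r = Suc r'"
  have r: "r > 0" "t / real r < d" using r' t by (auto simp: r_def field_simps)
  define E where "E l = {\<omega>\<in>space M. norm (partial_trapezoid Y w t m r l \<omega> - I (grid t m l) \<omega>) > e}" for l
  have [measurable]: "Y s \<in> borel_measurable M" "w s \<in> borel_measurable M" "I s \<in> borel_measurable M" if "s \<ge> 0" for s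
    using si that unfolding has_stratonovich_integral_def by auto
  have [measurable]: "Y (grid t a i) \<in> borel_measurable M" "w (grid t a i) \<in> borel_measurable M"
    "I (grid t a i) \<in> borel_measurable M" for a i
    using t by auto
  have Emeas: "E l \<in> events" for l
    unfolding E_def partial_trapezoid_def trapezoid_sum_def by measurable
  have Ep: "prob (E l) \<le> e" if l: "l \<le> m" for l
  proof -
    have "partition (grid t m l) (l * r) (grid t (m * r))"
      using t r by (auto simp: partition_def grid_refine intro: grid_mono)
    moreover have "grid t (m * r) (Suc i) - grid t (m * r) i < \<delta> l" if "i < l * r" for i
    proof -
      have "m > 0" using that l by (cases m) auto
      then have "t / real (m * r) \<le> t / real r" using t r by (intro divide_left_mono) auto
      then show ?thesis using r d(2)[OF l] by (simp add: grid_Suc)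
    qed
    ultimately show ?thesis using \<delta>(2) by (auto simp: E_def partial_trapezoid_def intro: less_imp_le)
  qed
  have "prob (\<Union>l\<in>{..m}. E l) \<le> (\<Sum>l\<in>{..m}. prob (E l))"
    using Emeas by (intro finite_measure_subadditive_finite) auto
  also have "\<dots> \<le> (\<Sum>l\<in>{..m}. e)" using Ep by (intro sum_mono) auto
  also have "\<dots> = 1 / real (Suc m)" by (simp add: e_def power2_eq_square)
  finally have "prob (\<Union>l\<in>{..m}. E l) \<le> 1 / real (Suc m)" .
  moreover have "(\<Union>l\<in>{..m}. E l) \<in> events" using Emeas by auto
  ultimately show ?thesis
    using r(1) by (intro exI[of _ r] conjI bexI[of _ "\<Union>l\<in>{..m}. E l"] ballI allI impI)
      (auto simp: E_def e_def not_less)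
qed

section \<open>A Stratonovich integral against a rotated integrand\<close>

lemma grid_block_distance:
  assumes "t \<ge> 0" "a > 0" "b > 0" "j mod b + k \<le> b"
  shows "\<bar>grid t (a * b) (j + k) - grid t (a * b) (j div b * b)\<bar> \<le> t / real a"
proof -
  have "j + k = j div b * b + (j mod b + k)" by simp
  then have "real (j + k) - real (j div b * b) = real (j mod b + k)"
    by (metis add_diff_cancel_left' of_nat_add)
  then have "grid t (a * b) (j + k) - grid t (a * b) (j div b * b) = t * real (j mod b + k) / real (a * b)"
    by (simp only: grid_def diff_divide_distrib[symmetric] right_diff_distrib[symmetric])
  moreover have "t * real (j mod b + k) / real (a * b) \<le> t * real b / real (a * b)"
    using assms by (intro divide_right_mono mult_left_mono) (auto simp del: of_nat_add)
  moreover have "t * real b / real (a * b) = t / real a" using assms by simp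
  moreover have "t * real (j mod b + k) / real (a * b) \<ge> 0" using assms by simp
  ultimately show ?thesis by linarith
qed

text \<open>
  This form separates the value at the left end, which is known before the increment of the
  Brownian motion, from the half increment that produces the covariation term.
\<close>

lemma midpoint_eq_start_plus: "(1/2) *\<^sub>R (x + y) = x + (1/2) *\<^sub>R (y - x)" for x y :: "'b::real_vector"
proof -
  have "x + (1/2) *\<^sub>R (y - x) = (1/2) *\<^sub>R (x + x) + (1/2) *\<^sub>R (y - x)"
    by (simp only: scaleR_half_double)
  also have "\<dots> = (1/2) *\<^sub>R (x + y)" by (simp only: scaleR_add_right[symmetric]) simp
  finally show ?thesis by simp
qed

lemma partial_trapezoid_Suc:
  "partial_trapezoid Y w t m r (Suc l) \<omega> = partial_trapezoid Y w t m r l \<omega> +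
     (\<Sum>i<r. (w (grid t (m * r) (Suc (l * r + i))) \<omega> - w (grid t (m * r) (l * r + i)) \<omega>) *\<^sub>R
       ((1/2) *\<^sub>R (Y (grid t (m * r) (l * r + i)) \<omega> + Y (grid t (m * r) (Suc (l * r + i))) \<omega>)))"
  unfolding partial_trapezoid_def trapezoid_sum_def sum_blocks by simp

text \<open>
  Everything needed for the alternating sums. The function \<open>ref\<close> gives the number of parts into which
  the cells of a grid with \<open>m\<close> cells have to be divided for the trapezoidal sums to reproduce \<open>I\<close> at its
  grid points.
\<close>

locale nested_grids = filtered_prob_space M F for M :: "'a measure" and F +
  fixes w :: "real \<Rightarrow> 'a \<Rightarrow> real" and t :: real
    and Y I :: "real \<Rightarrow> 'a \<Rightarrow> 'b::euclidean_space" and K :: real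
    and B :: "'b \<Rightarrow> 'b \<Rightarrow> real" and C :: real and ref :: "nat \<Rightarrow> nat"
  assumes bm: "brownian_motion M F w" and t: "t > 0"
    and Yad: "adapted F Y" and Ycont: "continuous_paths M Y" and Ybd: "\<And>s \<omega>. norm (Y s \<omega>) \<le> K"
    and Yqv: "bounded_in_prob (\<lambda>n \<omega>. \<Sum>i<n. (norm (Y (grid t n (Suc i)) \<omega> - Y (grid t n i) \<omega>))\<^sup>2)"
    and B: "bounded_bilinear B" and alt: "\<And>x. B x x = 0"
    and C: "C > 0" and BC: "\<And>x y. \<bar>B x y\<bar> \<le> norm x * norm y * C"
    and ref: "\<And>m. ref m > 0"
    and approx: "\<And>m. \<exists>E\<in>events. prob E \<le> 1 / real (Suc m) \<and> (\<forall>\<omega>\<in>space M - E. \<forall>l\<le>m.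
      norm (partial_trapezoid Y w t m (ref m) l \<omega> - I (grid t m l) \<omega>) \<le> 1 / (real (Suc m))\<^sup>2)"
begin

interpretation B: bounded_bilinear B by (rule B)

lemma K_nonneg: "K \<ge> 0" using Ybd[of 0 undefined] norm_ge_zero order_trans by blast

text \<open>
  Three nested grids for each \<open>n\<close>: the coarse one with \<open>n + 1\<close> cells, the middle one with \<open>m n\<close> cells,
  \<open>b n\<close> to each coarse cell, and the fine one with \<open>c n\<close> cells to each middle cell.
  The values of \<open>Y\<close> are \<open>u\<close> on the middle and \<open>v\<close> on the fine grid, \<open>u0\<close> is the value at the beginning of
  the coarse cell, and \<open>um\<close>, \<open>vm\<close> are trapezoidal means. The increments of \<open>w\<close> are \<open>dW\<close> and \<open>dV\<close>.
  The error \<open>e\<close> of a middle cell against the trapezoidal term is the sum of the approximation error \<open>f\<close>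
  of the fine grid, the Ito part \<open>e1\<close> and the covariation part \<open>e2\<close>.
\<close>

definition b :: "nat \<Rightarrow> nat" where "b n = ref (Suc n)"
definition m :: "nat \<Rightarrow> nat" where "m n = Suc n * b n"
definition c :: "nat \<Rightarrow> nat" where "c n = ref (m n)"
definition u :: "nat \<Rightarrow> nat \<Rightarrow> 'a \<Rightarrow> 'b" where "u n j \<omega> = Y (grid t (m n) j) \<omega>"
definition v :: "nat \<Rightarrow> nat \<Rightarrow> 'a \<Rightarrow> 'b" where "v n i \<omega> = Y (grid t (m n * c n) i) \<omega>"
definition u0 :: "nat \<Rightarrow> nat \<Rightarrow> 'a \<Rightarrow> 'b" where "u0 n j = u n (j div b n * b n)"
definition du :: "nat \<Rightarrow> nat \<Rightarrow> 'a \<Rightarrow> 'b" where "du n j \<omega> = u n (Suc j) \<omega> - u n j \<omega>"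
definition dv :: "nat \<Rightarrow> nat \<Rightarrow> 'a \<Rightarrow> 'b" where "dv n i \<omega> = v n (Suc i) \<omega> - v n i \<omega>"
definition um :: "nat \<Rightarrow> nat \<Rightarrow> 'a \<Rightarrow> 'b" where "um n j \<omega> = (1/2) *\<^sub>R (u n j \<omega> + u n (Suc j) \<omega>)"
definition vm :: "nat \<Rightarrow> nat \<Rightarrow> 'a \<Rightarrow> 'b" where "vm n i \<omega> = (1/2) *\<^sub>R (v n i \<omega> + v n (Suc i) \<omega>)"
definition dW :: "nat \<Rightarrow> nat \<Rightarrow> 'a \<Rightarrow> real" where
  "dW n j \<omega> = w (grid t (m n) (Suc j)) \<omega> - w (grid t (m n) j) \<omega>"
definition dV :: "nat \<Rightarrow> nat \<Rightarrow> 'a \<Rightarrow> real" where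
  "dV n i \<omega> = w (grid t (m n * c n) (Suc i)) \<omega> - w (grid t (m n * c n) i) \<omega>"
definition dI :: "nat \<Rightarrow> nat \<Rightarrow> 'a \<Rightarrow> 'b" where
  "dI n j \<omega> = I (grid t (m n) (Suc j)) \<omega> - I (grid t (m n) j) \<omega>"
definition defect :: "nat \<Rightarrow> nat \<Rightarrow> 'a \<Rightarrow> 'b" where
  "defect k l \<omega> = partial_trapezoid Y w t k (ref k) l \<omega> - I (grid t k l) \<omega>"
definition e :: "nat \<Rightarrow> nat \<Rightarrow> 'a \<Rightarrow> 'b" where "e n j \<omega> = dI n j \<omega> - dW n j \<omega> *\<^sub>R um n j \<omega>"
definition f :: "nat \<Rightarrow> nat \<Rightarrow> 'a \<Rightarrow> 'b" where
  "f n j \<omega> = dI n j \<omega> - (\<Sum>r<c n. dV n (j * c n + r) \<omega> *\<^sub>R vm n (j * c n + r) \<omega>)"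
definition e1 :: "nat \<Rightarrow> nat \<Rightarrow> 'a \<Rightarrow> 'b" where
  "e1 n j \<omega> = (\<Sum>r<c n. dV n (j * c n + r) \<omega> *\<^sub>R (v n (j * c n + r) \<omega> - u n j \<omega>))"
definition e2 :: "nat \<Rightarrow> nat \<Rightarrow> 'a \<Rightarrow> 'b" where
  "e2 n j \<omega> = (1/2) *\<^sub>R (\<Sum>r<c n. dV n (j * c n + r) \<omega> *\<^sub>R dv n (j * c n + r) \<omega>)
     - (1/2) *\<^sub>R (dW n j \<omega> *\<^sub>R du n j \<omega>)"

lemma pos: "b n > 0" "m n > 0" "c n > 0" "n < m n"
proof -
  show 1: "b n > 0" "c n > 0" by (auto simp: b_def c_def ref)
  then show "m n > 0" by (auto simp: m_def)
  have "Suc n * 1 \<le> Suc n * b n" using 1 by (intro mult_left_mono) auto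
  then show "n < m n" by (simp add: m_def)
qed

lemma fine_times:
  "u n j \<omega> = v n (j * c n) \<omega>"
  "w (grid t (m n) j) \<omega> = w (grid t (m n * c n) (j * c n)) \<omega>"
  by (simp_all add: u_def v_def grid_refine pos)

lemma sum_dV: "(\<Sum>r<c n. dV n (j * c n + r) \<omega>) = dW n j \<omega>"
proof -
  have "(\<Sum>r<c n. dV n (j * c n + r) \<omega>)
      = (\<Sum>r<c n. (\<lambda>r. w (grid t (m n * c n) (j * c n + r)) \<omega>) (Suc r)
          - (\<lambda>r. w (grid t (m n * c n) (j * c n + r)) \<omega>) r)"
    by (simp add: dV_def)
  also have "\<dots> = w (grid t (m n * c n) (j * c n + c n)) \<omega> - w (grid t (m n * c n) (j * c n)) \<omega>"
    by (subst sum_lessThan_telescope) simp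
  also have "\<dots> = dW n j \<omega>"
    using fine_times(2)[of n "Suc j" \<omega>] fine_times(2)[of n j \<omega>] by (simp add: dW_def add.commute)
  finally show ?thesis .
qed

lemma e_split: "e n j \<omega> = f n j \<omega> + e1 n j \<omega> + e2 n j \<omega>"
proof -
  have 1: "vm n i \<omega> = v n i \<omega> + (1/2) *\<^sub>R dv n i \<omega>" for i
    unfolding vm_def dv_def by (rule midpoint_eq_start_plus)
  have 2: "um n j \<omega> = u n j \<omega> + (1/2) *\<^sub>R du n j \<omega>"
    unfolding um_def du_def by (rule midpoint_eq_start_plus)
  show ?thesis
    unfolding e_def f_def e1_def e2_def 1 2
    by (simp add: sum_dV scaleR_right_diff_distrib scaleR_add_right sum.distrib
        sum_subtractf scaleR_sum_left[symmetric] scaleR_sum_right mult.commute)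
qed

text \<open>
  Since \<open>B\<close> is alternating, the trapezoidal term drops out and \<open>dI\<close> may be replaced by the error \<open>e\<close>.
  The weight \<open>um\<close> is then compared with the weight \<open>u0\<close>, which is constant on coarse cells, and in front
  of the Ito part it is written as an adapted value plus half an increment.
\<close>

lemma decomposition:
  "(\<Sum>j<m n. B (um n j \<omega>) (dI n j \<omega>)) =
     (\<Sum>j<m n. B (u0 n j \<omega>) (e n j \<omega>)) + (\<Sum>j<m n. B (um n j \<omega> - u0 n j \<omega>) (f n j \<omega>))
     + (\<Sum>j<m n. B (u n j \<omega> - u0 n j \<omega>) (e1 n j \<omega>)) + (1/2) * (\<Sum>j<m n. B (du n j \<omega>) (e1 n j \<omega>))
     + (\<Sum>j<m n. B (um n j \<omega> - u0 n j \<omega>) (e2 n j \<omega>))"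
proof -
  have "B (um n j \<omega>) (dI n j \<omega>) = B (u0 n j \<omega>) (e n j \<omega>) + B (um n j \<omega> - u0 n j \<omega>) (f n j \<omega>)
     + B (u n j \<omega> - u0 n j \<omega>) (e1 n j \<omega>) + (1/2) * B (du n j \<omega>) (e1 n j \<omega>)
     + B (um n j \<omega> - u0 n j \<omega>) (e2 n j \<omega>)" for j
  proof -
    have "B (um n j \<omega>) (dI n j \<omega>) = B (um n j \<omega>) (e n j \<omega>)"
      by (simp add: e_def B.diff_right B.scaleR_right alt)
    moreover have eq: "um n j \<omega> - u0 n j \<omega> = (u n j \<omega> - u0 n j \<omega>) + (1/2) *\<^sub>R du n j \<omega>"
      unfolding um_def du_def midpoint_eq_start_plus by simp
    have "B (um n j \<omega> - u0 n j \<omega>) (e1 n j \<omega>)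
        = B (u n j \<omega> - u0 n j \<omega>) (e1 n j \<omega>) + (1/2) * B (du n j \<omega>) (e1 n j \<omega>)"
      unfolding eq B.add_left B.scaleR_left by simp
    ultimately show ?thesis
      by (simp add: e_split B.add_right B.diff_left)
  qed
  then show ?thesis by (simp add: sum.distrib sum_distrib_left)
qed

text \<open>
  There are \<open>k n\<close> terms, each at most \<open>2 / (k n + 1)\<^sup>2\<close> off an event of probability at most
  \<open>1 / (k n + 1)\<close>.
\<close>

lemma defect_sum_vanishing:
  assumes k: "\<And>n. n < k n"
  shows "vanishing_in_prob (\<lambda>n \<omega>. \<Sum>l<k n. norm (defect (k n) l \<omega> - defect (k n) (Suc l) \<omega>))"
  unfolding vanishing_in_prob_def
proof (intro allI impI)
  fix \<epsilon> :: real assume e: "\<epsilon> > 0"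
  then obtain n0 where n0: "1 / real (Suc n0) < \<epsilon> / 2" using nat_approx_posE[of "\<epsilon>/2"] by auto
  have "\<exists>E\<in>events. prob E < \<epsilon> \<and>
      (\<forall>\<omega>\<in>space M - E. \<bar>\<Sum>l<k n. norm (defect (k n) l \<omega> - defect (k n) (Suc l) \<omega>)\<bar> \<le> \<epsilon>)" if n: "n \<ge> n0" for n
  proof -
    have "1 / real (Suc (k n)) \<le> 1 / real (Suc n0)"
      using n k[of n] by (intro divide_left_mono) auto
    then have k2: "1 / real (Suc (k n)) < \<epsilon> / 2" using n0 by linarith
    from approx[of "k n"] obtain E where E: "E \<in> events" "prob E \<le> 1 / real (Suc (k n))"
      "\<And>\<omega> l. \<omega> \<in> space M - E \<Longrightarrow> l \<le> k n \<Longrightarrow> norm (defect (k n) l \<omega>) \<le> 1 / (real (Suc (k n)))\<^sup>2"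
      unfolding defect_def by blast
    have "\<bar>\<Sum>l<k n. norm (defect (k n) l \<omega> - defect (k n) (Suc l) \<omega>)\<bar> \<le> \<epsilon>" if w: "\<omega> \<in> space M - E" for \<omega>
    proof -
      have "(\<Sum>l<k n. norm (defect (k n) l \<omega> - defect (k n) (Suc l) \<omega>))
          \<le> (\<Sum>l<k n. 2 / (real (Suc (k n)))\<^sup>2)"
      proof (rule sum_mono)
        fix l assume "l \<in> {..<k n}"
        then have "norm (defect (k n) l \<omega>) \<le> 1 / (real (Suc (k n)))\<^sup>2"
          "norm (defect (k n) (Suc l) \<omega>) \<le> 1 / (real (Suc (k n)))\<^sup>2"
          using E(3)[OF w] by auto
        then show "norm (defect (k n) l \<omega> - defect (k n) (Suc l) \<omega>) \<le> 2 / (real (Suc (k n)))\<^sup>2"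
          using norm_triangle_ineq4[of "defect (k n) l \<omega>" "defect (k n) (Suc l) \<omega>"] by linarith
      qed
      also have "\<dots> = real (k n) * 2 / (real (Suc (k n)))\<^sup>2" by simp
      also have "\<dots> \<le> real (Suc (k n)) * 2 / (real (Suc (k n)))\<^sup>2"
        by (intro divide_right_mono mult_right_mono) auto
      also have "\<dots> = 2 * (1 / real (Suc (k n)))"
        by (simp add: power2_eq_square divide_simps del: of_nat_Suc)
      also have "\<dots> \<le> \<epsilon>" using k2 by linarith
      finally show ?thesis by (simp add: sum_nonneg)
    qed
    moreover have "prob E < \<epsilon>" using E(2) k2 e by linarith
    ultimately show ?thesis using E(1) by blast
  qed
  then show "\<forall>\<^sub>F n in sequentially. \<exists>E\<in>events. prob E < \<epsilon> \<and>
      (\<forall>\<omega>\<in>space M - E. \<bar>\<Sum>l<k n. norm (defect (k n) l \<omega> - defect (k n) (Suc l) \<omega>)\<bar> \<le> \<epsilon>)"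
    by (auto simp: eventually_sequentially)
qed

lemma f_defect: "f n j \<omega> = defect (m n) j \<omega> - defect (m n) (Suc j) \<omega>"
  by (simp add: f_def defect_def partial_trapezoid_Suc dI_def dV_def vm_def v_def c_def)

text \<open>
  Over a coarse cell the errors add up to a difference of partial trapezoidal errors at coarse grid
  points, and these are small by the choice of \<open>b\<close>.
\<close>

lemma e_block_defect:
  "(\<Sum>r<b n. e n (l * b n + r) \<omega>) = defect (Suc n) l \<omega> - defect (Suc n) (Suc l) \<omega>"
proof -
  have "(\<Sum>r<b n. dI n (l * b n + r) \<omega>)
      = (\<Sum>r<b n. (\<lambda>r. I (grid t (m n) (l * b n + r)) \<omega>) (Suc r) - (\<lambda>r. I (grid t (m n) (l * b n + r)) \<omega>) r)"
    by (simp add: dI_def)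
  also have "\<dots> = I (grid t (m n) (l * b n + b n)) \<omega> - I (grid t (m n) (l * b n)) \<omega>"
    by (subst sum_lessThan_telescope) simp
  also have "\<dots> = I (grid t (Suc n) (Suc l)) \<omega> - I (grid t (Suc n) l) \<omega>"
    using grid_refine[OF pos(1)[of n], of t "Suc n" "Suc l"] grid_refine[OF pos(1)[of n], of t "Suc n" l]
    by (simp add: m_def add.commute)
  finally have "(\<Sum>r<b n. dI n (l * b n + r) \<omega>) = I (grid t (Suc n) (Suc l)) \<omega> - I (grid t (Suc n) l) \<omega>" .
  moreover have "partial_trapezoid Y w t (Suc n) (ref (Suc n)) (Suc l) \<omega> =
      partial_trapezoid Y w t (Suc n) (ref (Suc n)) l \<omega> +
      (\<Sum>r<b n. dW n (l * b n + r) \<omega> *\<^sub>R um n (l * b n + r) \<omega>)"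
    unfolding partial_trapezoid_Suc by (simp add: b_def m_def dW_def um_def u_def)
  ultimately show ?thesis by (simp add: e_def defect_def sum_subtractf)
qed

lemma norm_bounds:
  "norm (u n j \<omega>) \<le> K" "norm (v n j \<omega>) \<le> K" "norm (u0 n j \<omega>) \<le> K" "norm (um n j \<omega>) \<le> K"
  "norm (u n j \<omega> - u0 n j \<omega>) \<le> 2 * K" "norm (um n j \<omega> - u0 n j \<omega>) \<le> 2 * K"
  "norm (v n i \<omega> - u n j \<omega>) \<le> 2 * K"
proof -
  show 1: "norm (u n j \<omega>) \<le> K" "norm (v n j \<omega>) \<le> K" "norm (u0 n j \<omega>) \<le> K" for j
    by (simp_all add: u_def v_def u0_def Ybd)
  show 2: "norm (um n j \<omega>) \<le> K"
    using norm_triangle_ineq[of "u n j \<omega>" "u n (Suc j) \<omega>"] 1(1)[of j] 1(1)[of "Suc j"]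
    by (simp add: um_def)
  show "norm (u n j \<omega> - u0 n j \<omega>) \<le> 2 * K" "norm (um n j \<omega> - u0 n j \<omega>) \<le> 2 * K"
    "norm (v n i \<omega> - u n j \<omega>) \<le> 2 * K"
    using norm_triangle_ineq4[of "u n j \<omega>" "u0 n j \<omega>"] norm_triangle_ineq4[of "um n j \<omega>" "u0 n j \<omega>"]
      norm_triangle_ineq4[of "v n i \<omega>" "u n j \<omega>"] 1[of j] 1[of i] 2 by linarith+
qed

text \<open>
  With a weight that is constant on coarse cells only block sums of the errors occur.
\<close>

lemma coarse_part_vanishing: "vanishing_in_prob (\<lambda>n \<omega>. \<Sum>j<m n. B (u0 n j \<omega>) (e n j \<omega>))"
proof (rule vanishing_in_prob_mono[OF vanishing_in_prob_cmult[where c="K * C", OF defect_sum_vanishing[of Suc]]])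
  have "\<bar>\<Sum>j<m n. B (u0 n j \<omega>) (e n j \<omega>)\<bar>
      \<le> \<bar>K * C * (\<Sum>l<Suc n. norm (defect (Suc n) l \<omega> - defect (Suc n) (Suc l) \<omega>))\<bar>" for n \<omega>
  proof -
    have "(\<Sum>j<m n. B (u0 n j \<omega>) (e n j \<omega>))
        = (\<Sum>l<Suc n. \<Sum>r<b n. B (u n (l * b n) \<omega>) (e n (l * b n + r) \<omega>))"
      unfolding m_def sum_blocks by (intro sum.cong refl) (simp add: u0_def)
    also have "\<dots> = (\<Sum>l<Suc n. B (u n (l * b n) \<omega>) (defect (Suc n) l \<omega> - defect (Suc n) (Suc l) \<omega>))"
      by (simp only: B.sum_right[symmetric] e_block_defect)
    finally have "\<bar>\<Sum>j<m n. B (u0 n j \<omega>) (e n j \<omega>)\<bar>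
        = \<bar>\<Sum>l<Suc n. B (u n (l * b n) \<omega>) (defect (Suc n) l \<omega> - defect (Suc n) (Suc l) \<omega>)\<bar>"
      by (rule arg_cong)
    also have "\<dots> \<le> (\<Sum>l<Suc n. K * C * norm (defect (Suc n) l \<omega> - defect (Suc n) (Suc l) \<omega>))"
    proof (rule order_trans[OF sum_abs sum_mono])
      fix l
      have "\<bar>B (u n (l * b n) \<omega>) (defect (Suc n) l \<omega> - defect (Suc n) (Suc l) \<omega>)\<bar>
          \<le> norm (u n (l * b n) \<omega>) * norm (defect (Suc n) l \<omega> - defect (Suc n) (Suc l) \<omega>) * C" by (rule BC)
      also have "\<dots> \<le> K * norm (defect (Suc n) l \<omega> - defect (Suc n) (Suc l) \<omega>) * C"
        using C by (intro mult_right_mono norm_bounds) auto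
      finally show "\<bar>B (u n (l * b n) \<omega>) (defect (Suc n) l \<omega> - defect (Suc n) (Suc l) \<omega>)\<bar>
          \<le> K * C * norm (defect (Suc n) l \<omega> - defect (Suc n) (Suc l) \<omega>)" by (simp add: mult_ac)
    qed
    also have "\<dots> = K * C * (\<Sum>l<Suc n. norm (defect (Suc n) l \<omega> - defect (Suc n) (Suc l) \<omega>))"
      by (rule sum_distrib_left[symmetric])
    also have "\<dots> \<le> \<bar>\<dots>\<bar>" by (rule abs_ge_self)
    finally show ?thesis .
  qed
  then show "\<forall>\<^sub>F n in sequentially. AE \<omega> in M. \<bar>\<Sum>j<m n. B (u0 n j \<omega>) (e n j \<omega>)\<bar>
      \<le> \<bar>K * C * (\<Sum>l<Suc n. norm (defect (Suc n) l \<omega> - defect (Suc n) (Suc l) \<omega>))\<bar>"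
    by simp
qed simp

lemma refinement_defect_vanishing: "vanishing_in_prob (\<lambda>n \<omega>. \<Sum>j<m n. B (um n j \<omega> - u0 n j \<omega>) (f n j \<omega>))"
proof (rule vanishing_in_prob_mono[OF vanishing_in_prob_cmult[where c="2 * K * C", OF defect_sum_vanishing[of m]]])
  have "\<bar>\<Sum>j<m n. B (um n j \<omega> - u0 n j \<omega>) (f n j \<omega>)\<bar>
      \<le> \<bar>2 * K * C * (\<Sum>l<m n. norm (defect (m n) l \<omega> - defect (m n) (Suc l) \<omega>))\<bar>" for n \<omega>
  proof -
    have "\<bar>\<Sum>j<m n. B (um n j \<omega> - u0 n j \<omega>) (f n j \<omega>)\<bar> \<le> (\<Sum>j<m n. 2 * K * C * norm (f n j \<omega>))"
    proof (rule order_trans[OF sum_abs sum_mono])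
      fix j
      have "\<bar>B (um n j \<omega> - u0 n j \<omega>) (f n j \<omega>)\<bar> \<le> norm (um n j \<omega> - u0 n j \<omega>) * norm (f n j \<omega>) * C" by (rule BC)
      also have "\<dots> \<le> 2 * K * norm (f n j \<omega>) * C"
        using C by (intro mult_right_mono norm_bounds) auto
      finally show "\<bar>B (um n j \<omega> - u0 n j \<omega>) (f n j \<omega>)\<bar> \<le> 2 * K * C * norm (f n j \<omega>)" by (simp add: mult_ac)
    qed
    also have "\<dots> = 2 * K * C * (\<Sum>l<m n. norm (defect (m n) l \<omega> - defect (m n) (Suc l) \<omega>))"
      unfolding f_defect by (rule sum_distrib_left[symmetric])
    also have "\<dots> \<le> \<bar>\<dots>\<bar>" by (rule abs_ge_self)
    finally show ?thesis .
  qed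
  then show "\<forall>\<^sub>F n in sequentially. AE \<omega> in M. \<bar>\<Sum>j<m n. B (um n j \<omega> - u0 n j \<omega>) (f n j \<omega>)\<bar>
      \<le> \<bar>2 * K * C * (\<Sum>l<m n. norm (defect (m n) l \<omega> - defect (m n) (Suc l) \<omega>))\<bar>"
    by simp
qed (rule pos)

abbreviation osc :: "nat \<Rightarrow> 'a \<Rightarrow> real" where "osc \<equiv> modulus t Y"

lemma osc_vanishing: "vanishing_in_prob osc"
  by (rule modulus_vanishing[OF t adapted_measurable[OF Yad] Ycont])

lemma path_continuous: "AE \<omega> in M. continuous_on {0..t} (\<lambda>s. Y s \<omega>)"
  using Ycont unfolding continuous_paths_def by eventually_elim (auto elim: continuous_on_subset)

lemma osc_u:
  assumes cont: "continuous_on {0..t} (\<lambda>s. Y s \<omega>)" and j: "j < m n"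
  shows "norm (u n j \<omega> - u0 n j \<omega>) \<le> osc n \<omega>" "norm (u n (Suc j) \<omega> - u0 n j \<omega>) \<le> osc n \<omega>"
    "norm (um n j \<omega> - u0 n j \<omega>) \<le> osc n \<omega>"
proof -
  have jb: "j div b n * b n \<le> m n" using j div_times_less_eq_dividend[of j "b n"] by linarith
  have g: "grid t (m n) i \<in> {0..t}" if "i \<le> m n" for i using t that by (auto simp: grid_le)
  have md: "j mod b n + 0 \<le> b n" "j mod b n + 1 \<le> b n"
    using pos(1)[of n] mod_less_divisor[of "b n" j] by linarith+
  show 1: "norm (u n j \<omega> - u0 n j \<omega>) \<le> osc n \<omega>"
    unfolding u_def u0_def
    using grid_block_distance[OF less_imp_le[OF t] _ pos(1) md(1), of "Suc n"] j
    by (intro modulus_bound[where Z=Y and \<omega>=\<omega>, OF cont] g jb) (auto simp: m_def)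
  show 2: "norm (u n (Suc j) \<omega> - u0 n j \<omega>) \<le> osc n \<omega>"
    unfolding u_def u0_def
    using grid_block_distance[OF less_imp_le[OF t] _ pos(1) md(2), of "Suc n"] j
    by (intro modulus_bound[where Z=Y and \<omega>=\<omega>, OF cont] g jb) (auto simp: m_def)
  have "um n j \<omega> - u0 n j \<omega> = (1/2) *\<^sub>R ((u n j \<omega> - u0 n j \<omega>) + (u n (Suc j) \<omega> - u0 n j \<omega>))"
    unfolding um_def midpoint_eq_start_plus[of "u n j \<omega>"]
    by (simp add: midpoint_eq_start_plus)
  then show "norm (um n j \<omega> - u0 n j \<omega>) \<le> osc n \<omega>"
    using norm_triangle_ineq[of "u n j \<omega> - u0 n j \<omega>" "u n (Suc j) \<omega> - u0 n j \<omega>"] 1 2 by simp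
qed

lemma osc_v:
  assumes cont: "continuous_on {0..t} (\<lambda>s. Y s \<omega>)" and i: "i < m n * c n"
  shows "norm (v n i \<omega> - u n (i div c n) \<omega>) \<le> osc n \<omega>"
proof -
  have g: "grid t (m n * c n) k \<in> {0..t}" if "k \<le> m n * c n" for k using t that by (auto simp: grid_le)
  have md: "i mod c n + 0 \<le> c n"
    using pos(3)[of n] mod_less_divisor[of "c n" i] by linarith
  have le: "i div c n * c n \<le> m n * c n" using i div_times_less_eq_dividend[of i "c n"] by linarith
  have "\<bar>grid t (m n * c n) i - grid t (m n * c n) (i div c n * c n)\<bar> \<le> t / real (m n)"
    using grid_block_distance[OF less_imp_le[OF t] pos(2) pos(3) md, of n] by simp
  also have "\<dots> \<le> t / real (Suc n)" using t pos(4)[of n] pos(2)[of n] by (intro divide_left_mono) auto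
  finally show ?thesis
    unfolding fine_times unfolding v_def using i le
    by (intro modulus_bound[where Z=Y and \<omega>=\<omega>, OF cont] g) auto
qed

lemma fine_measurable:
  assumes "k \<le> i" shows "v n k \<in> borel_measurable (F (grid t (m n * c n) i))"
proof -
  have "v n k \<in> borel_measurable (F (grid t (m n * c n) k))"
    unfolding v_def using Yad t by (simp add: adapted_def)
  moreover have "grid t (m n * c n) k \<le> grid t (m n * c n) i" using t assms by (intro grid_mono) auto
  ultimately show ?thesis by (rule measurable_F_mono[rotated])
qed

text \<open>
  The values at the beginning of the middle and of the coarse cell are known at each fine time in the
  cell, so the products formed below are admissible coefficients for the isometry.
\<close>

lemma u_measurable:
  "u n (i div c n) \<in> borel_measurable (F (grid t (m n * c n) i))"
  "u0 n (i div c n) \<in> borel_measurable (F (grid t (m n * c n) i))"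
proof -
  have u: "u n j = v n (j * c n)" for j by (rule ext) (rule fine_times)
  show "u n (i div c n) \<in> borel_measurable (F (grid t (m n * c n) i))"
    unfolding u by (intro fine_measurable) simp
  have "i div c n div b n * b n * c n \<le> i div c n * c n" by (intro mult_right_mono) auto
  also have "\<dots> \<le> i" by simp
  finally show "u0 n (i div c n) \<in> borel_measurable (F (grid t (m n * c n) i))"
    unfolding u0_def u by (intro fine_measurable)
qed

text \<open>
  As a sum over fine increments the coefficients are products of two oscillations of \<open>Y\<close>; one of
  them is estimated by the modulus, the other by its uniform bound.
\<close>

lemma Ito_part_vanishing: "vanishing_in_prob (\<lambda>n \<omega>. \<Sum>j<m n. B (u n j \<omega> - u0 n j \<omega>) (e1 n j \<omega>))"
proof -
  define h where "h n i \<omega> = B (u n (i div c n) \<omega> - u0 n (i div c n) \<omega>) (v n i \<omega> - u n (i div c n) \<omega>)" for n i \<omega>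
  have eq: "(\<Sum>j<m n. B (u n j \<omega> - u0 n j \<omega>) (e1 n j \<omega>)) = (\<Sum>i<m n * c n. h n i \<omega> *
      (w (grid t (m n * c n) (Suc i)) \<omega> - w (grid t (m n * c n) i) \<omega>))" for n \<omega>
    unfolding sum_blocks
  proof (intro sum.cong refl)
    fix j
    show "B (u n j \<omega> - u0 n j \<omega>) (e1 n j \<omega>) = (\<Sum>r<c n. h n (j * c n + r) \<omega> *
      (w (grid t (m n * c n) (Suc (j * c n + r))) \<omega> - w (grid t (m n * c n) (j * c n + r)) \<omega>))"
      unfolding e1_def B.sum_right
      by (intro sum.cong refl) (simp add: h_def B.scaleR_right dV_def)
  qed
  have bd: "\<bar>h n i \<omega>\<bar> \<le> 2 * K * norm (v n i \<omega> - u n (i div c n) \<omega>) * C" for n i \<omega>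
    unfolding h_def using C by (intro order_trans[OF BC] mult_right_mono norm_bounds) auto
  show ?thesis
    unfolding eq
  proof (rule Ito_vanishing[where c="\<lambda>n. m n * c n" and h=h and C="2 * K * (2 * K) * C"
        and Z="\<lambda>n \<omega>. 2 * K * C * osc n \<omega>", OF bm t])
    show "m n * c n > 0" for n using pos by simp
    show "h n i \<in> borel_measurable (F (grid t (m n * c n) i))" for n i
      unfolding h_def[abs_def]
    proof (rule borel_measurable_continuous_Pair[where H=B])
      show "continuous_on UNIV (\<lambda>x. B (fst x) (snd x))"
        by (intro B.continuous_on continuous_intros)
    qed (intro borel_measurable_diff u_measurable fine_measurable order_refl)+
    show "\<bar>h n i \<omega>\<bar> \<le> 2 * K * (2 * K) * C" for n i \<omega>
      using C K_nonneg by (intro order_trans[OF bd] mult_right_mono mult_left_mono norm_bounds) auto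
    show "vanishing_in_prob (\<lambda>n \<omega>. 2 * K * C * osc n \<omega>)"
      by (intro vanishing_in_prob_cmult osc_vanishing)
    show "AE \<omega> in M. \<forall>i<m n * c n. \<bar>h n i \<omega>\<bar> \<le> \<bar>2 * K * C * osc n \<omega>\<bar>" for n
      using path_continuous
    proof eventually_elim
      case (elim \<omega>)
      show ?case
      proof (intro allI impI)
        fix i assume i: "i < m n * c n"
        have "\<bar>h n i \<omega>\<bar> \<le> 2 * K * osc n \<omega> * C"
          using C K_nonneg osc_v[OF elim i] by (intro order_trans[OF bd] mult_right_mono mult_left_mono) auto
        then show "\<bar>h n i \<omega>\<bar> \<le> \<bar>2 * K * C * osc n \<omega>\<bar>" by (simp add: mult_ac)
      qed
    qed
  qed
qed

text \<open>
  The isometry on the blocks formed by the middle cells, applied to each coordinate.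
\<close>

lemma e1_square_vanishing: "vanishing_in_prob (\<lambda>n \<omega>. \<Sum>j<m n. (norm (e1 n j \<omega>))\<^sup>2)"
proof -
  define h where "h \<beta> n i \<omega> = (v n i \<omega> - u n (i div c n) \<omega>) \<bullet> \<beta>" for \<beta> n i \<omega>
  have "(norm (e1 n j \<omega>))\<^sup>2 = (\<Sum>\<beta>\<in>Basis. (\<Sum>r<c n. h \<beta> n (j * c n + r) \<omega> *
      (w (grid t (m n * c n) (Suc (j * c n + r))) \<omega> - w (grid t (m n * c n) (j * c n + r)) \<omega>))\<^sup>2)" for n j \<omega>
    unfolding power2_norm_eq_inner euclidean_inner[of "e1 n j \<omega>" "e1 n j \<omega>"]
    by (intro sum.cong refl)
       (simp add: power2_eq_square e1_def h_def inner_sum_left dV_def mult.commute)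
  then have eq: "(\<Sum>j<m n. (norm (e1 n j \<omega>))\<^sup>2) = (\<Sum>\<beta>\<in>Basis. \<Sum>j<m n. (\<Sum>r<c n. h \<beta> n (j * c n + r) \<omega> *
      (w (grid t (m n * c n) (Suc (j * c n + r))) \<omega> - w (grid t (m n * c n) (j * c n + r)) \<omega>))\<^sup>2)" for n \<omega>
    by (simp only: sum.swap[of _ "{..<m n}"])
  have bd: "\<bar>h \<beta> n i \<omega>\<bar> \<le> norm (v n i \<omega> - u n (i div c n) \<omega>)" if "\<beta> \<in> Basis" for \<beta> n i \<omega>
    unfolding h_def using that by (rule Basis_le_norm)
  show ?thesis
    unfolding eq
  proof (intro vanishing_in_prob_sum finite_Basis)
    fix \<beta> :: 'b assume \<beta>: "\<beta> \<in> Basis"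
    have 1: "h \<beta> n i \<in> borel_measurable (F (grid t (m n * c n) i))" for n i
      unfolding h_def[abs_def]
      by (intro borel_measurable_inner borel_measurable_diff borel_measurable_const u_measurable
          fine_measurable order_refl)
    have 2: "\<bar>h \<beta> n i \<omega>\<bar> \<le> 2 * K" for n i \<omega>
      by (rule order_trans[OF bd[OF \<beta>] norm_bounds(7)])
    have 3: "AE \<omega> in M. \<forall>i<m n * c n. \<bar>h \<beta> n i \<omega>\<bar> \<le> \<bar>osc n \<omega>\<bar>" for n
      using path_continuous
    proof eventually_elim
      case (elim \<omega>)
      show ?case
        by (intro allI impI order_trans[OF order_trans[OF bd[OF \<beta>] osc_v[OF elim]] abs_ge_self])
    qed
    show "vanishing_in_prob (\<lambda>n \<omega>. \<Sum>j<m n. (\<Sum>r<c n. h \<beta> n (j * c n + r) \<omega> *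
      (w (grid t (m n * c n) (Suc (j * c n + r))) \<omega> - w (grid t (m n * c n) (j * c n + r)) \<omega>))\<^sup>2)"
      by (rule block_Ito_vanishing[OF bm t pos(2,3) 1 2 osc_vanishing 3])
  qed
qed

lemma bounded_qv:
  "bounded_in_prob (\<lambda>n \<omega>. \<Sum>j<m n. (norm (du n j \<omega>))\<^sup>2)"
  "bounded_in_prob (\<lambda>n \<omega>. \<Sum>i<m n * c n. (norm (dv n i \<omega>))\<^sup>2)"
  "bounded_in_prob (\<lambda>n \<omega>. \<Sum>j<m n. (dW n j \<omega>)\<^sup>2)"
  "bounded_in_prob (\<lambda>n \<omega>. \<Sum>i<m n * c n. (dV n i \<omega>)\<^sup>2)"
  unfolding du_def dv_def dW_def dV_def u_def v_def
  using bounded_in_prob_subseq[OF Yqv, of m] bounded_in_prob_subseq[OF Yqv, of "\<lambda>n. m n * c n"]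
    bounded_in_prob_subseq[OF brownian_bounded_quadratic_variation[OF bm t], of m]
    bounded_in_prob_subseq[OF brownian_bounded_quadratic_variation[OF bm t], of "\<lambda>n. m n * c n"]
  by simp_all

text \<open>
  The increments \<open>du\<close> are not known in time, so the isometry does not apply to the products. By the
  Cauchy-Schwarz inequality the bounded quadratic variation of \<open>Y\<close> is enough.
\<close>

lemma increment_Ito_part_vanishing: "vanishing_in_prob (\<lambda>n \<omega>. (1/2) * (\<Sum>j<m n. B (du n j \<omega>) (e1 n j \<omega>)))"
proof (rule vanishing_in_prob_cmult, rule vanishing_in_prob_power2D)
  show "vanishing_in_prob (\<lambda>n \<omega>. (\<Sum>j<m n. B (du n j \<omega>) (e1 n j \<omega>))\<^sup>2)"
  proof (rule vanishing_in_prob_mono[OF vanishing_in_prob_cmult[where c="C\<^sup>2",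
        OF bounded_in_prob_mult_vanishing[OF bounded_qv(1) e1_square_vanishing]]])
    have "\<bar>(\<Sum>j<m n. B (du n j \<omega>) (e1 n j \<omega>))\<^sup>2\<bar>
        \<le> \<bar>C\<^sup>2 * ((\<Sum>j<m n. (norm (du n j \<omega>))\<^sup>2) * (\<Sum>j<m n. (norm (e1 n j \<omega>))\<^sup>2))\<bar>" for n \<omega>
    proof -
      have "\<bar>\<Sum>j<m n. B (du n j \<omega>) (e1 n j \<omega>)\<bar> \<le> (\<Sum>j<m n. C * (norm (du n j \<omega>) * norm (e1 n j \<omega>)))"
        using BC by (intro order_trans[OF sum_abs sum_mono]) (simp add: mult_ac)
      then have "\<bar>\<Sum>j<m n. B (du n j \<omega>) (e1 n j \<omega>)\<bar> \<le> C * (\<Sum>j<m n. norm (du n j \<omega>) * norm (e1 n j \<omega>))"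
        by (simp add: sum_distrib_left)
      then have "(\<Sum>j<m n. B (du n j \<omega>) (e1 n j \<omega>))\<^sup>2 \<le> (C * (\<Sum>j<m n. norm (du n j \<omega>) * norm (e1 n j \<omega>)))\<^sup>2"
        by (rule power2_le_if_abs_le)
      also have "\<dots> \<le> C\<^sup>2 * ((\<Sum>j<m n. (norm (du n j \<omega>))\<^sup>2) * (\<Sum>j<m n. (norm (e1 n j \<omega>))\<^sup>2))"
        unfolding power_mult_distrib by (intro mult_left_mono Cauchy_Schwarz_ineq_sum) auto
      finally show ?thesis by (simp add: abs_mult sum_nonneg)
    qed
    then show "\<forall>\<^sub>F n in sequentially. AE \<omega> in M. \<bar>(\<Sum>j<m n. B (du n j \<omega>) (e1 n j \<omega>))\<^sup>2\<bar>
        \<le> \<bar>C\<^sup>2 * ((\<Sum>j<m n. (norm (du n j \<omega>))\<^sup>2) * (\<Sum>j<m n. (norm (e1 n j \<omega>))\<^sup>2))\<bar>" by simp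
  qed
qed

text \<open>
  The covariation parts are bounded by quadratic variations of \<open>w\<close> and \<open>Y\<close>, and their weights oscillate
  little within a coarse cell.
\<close>

lemma covariation_part_vanishing: "vanishing_in_prob (\<lambda>n \<omega>. \<Sum>j<m n. B (um n j \<omega> - u0 n j \<omega>) (e2 n j \<omega>))"
proof -
  define Q where "Q n \<omega> = ((\<Sum>i<m n * c n. (dV n i \<omega>)\<^sup>2) + (\<Sum>i<m n * c n. (norm (dv n i \<omega>))\<^sup>2))
    + ((\<Sum>j<m n. (dW n j \<omega>)\<^sup>2) + (\<Sum>j<m n. (norm (du n j \<omega>))\<^sup>2))" for n \<omega>
  have Q: "bounded_in_prob Q" unfolding Q_def by (intro bounded_in_prob_add bounded_qv)
  have amgm: "norm ((1/2) *\<^sub>R (a *\<^sub>R x)) \<le> a\<^sup>2 + (norm x)\<^sup>2" for a and x :: 'b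
  proof -
    have "2 * \<bar>a\<bar> * norm x \<le> \<bar>a\<bar>\<^sup>2 + (norm x)\<^sup>2" by (rule sum_squares_bound)
    moreover have "norm ((1/2) *\<^sub>R (a *\<^sub>R x)) = \<bar>a\<bar> * norm x / 2" by simp
    moreover have "\<bar>a\<bar> * norm x \<ge> 0" by simp
    ultimately show ?thesis unfolding power2_abs by linarith
  qed
  have e2: "norm (e2 n j \<omega>) \<le> (\<Sum>r<c n. (dV n (j * c n + r) \<omega>)\<^sup>2 + (norm (dv n (j * c n + r) \<omega>))\<^sup>2)
      + ((dW n j \<omega>)\<^sup>2 + (norm (du n j \<omega>))\<^sup>2)" for n j \<omega>
    unfolding e2_def scaleR_sum_right
    by (intro order_trans[OF norm_triangle_ineq4] add_mono order_trans[OF norm_sum] sum_mono amgm)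
  have sum_e2: "(\<Sum>j<m n. norm (e2 n j \<omega>)) \<le> Q n \<omega>" for n \<omega>
  proof -
    have "(\<Sum>j<m n. norm (e2 n j \<omega>)) \<le> (\<Sum>j<m n. (\<Sum>r<c n. (dV n (j * c n + r) \<omega>)\<^sup>2 + (norm (dv n (j * c n + r) \<omega>))\<^sup>2)
      + ((dW n j \<omega>)\<^sup>2 + (norm (du n j \<omega>))\<^sup>2))" by (intro sum_mono e2)
    also have "\<dots> = Q n \<omega>" unfolding Q_def sum_blocks by (simp add: sum.distrib)
    finally show ?thesis .
  qed
  show ?thesis
  proof (rule vanishing_in_prob_mono[OF vanishing_in_prob_cmult[where c=C,
        OF bounded_in_prob_mult_vanishing[OF Q osc_vanishing]]], rule always_eventually, rule allI)
    fix n
    show "AE \<omega> in M. \<bar>\<Sum>j<m n. B (um n j \<omega> - u0 n j \<omega>) (e2 n j \<omega>)\<bar> \<le> \<bar>C * (Q n \<omega> * osc n \<omega>)\<bar>"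
      using path_continuous
    proof eventually_elim
      case (elim \<omega>)
      have osc0: "osc n \<omega> \<ge> 0"
        by (rule modulus_nonneg[where Z=Y and \<omega>=\<omega>, OF t elim])
      have "\<bar>\<Sum>j<m n. B (um n j \<omega> - u0 n j \<omega>) (e2 n j \<omega>)\<bar> \<le> (\<Sum>j<m n. osc n \<omega> * norm (e2 n j \<omega>) * C)"
      proof (rule order_trans[OF sum_abs sum_mono])
        fix j assume "j \<in> {..<m n}"
        then show "\<bar>B (um n j \<omega> - u0 n j \<omega>) (e2 n j \<omega>)\<bar> \<le> osc n \<omega> * norm (e2 n j \<omega>) * C"
          using C osc_u(3)[OF elim, of j n] by (intro order_trans[OF BC] mult_right_mono) auto
      qed
      also have "\<dots> = C * ((\<Sum>j<m n. norm (e2 n j \<omega>)) * osc n \<omega>)"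
        by (simp add: sum_distrib_left sum_distrib_right mult_ac)
      also have "\<dots> \<le> C * (Q n \<omega> * osc n \<omega>)"
        using C osc0 sum_e2 by (intro mult_left_mono mult_right_mono) auto
      finally show ?case by simp
    qed
  qed
qed

lemma alternating_sum_vanishing:
  "vanishing_in_prob (\<lambda>n \<omega>. \<Sum>j<m n. B (um n j \<omega>) (dI n j \<omega>))"
  unfolding decomposition
  by (intro vanishing_in_prob_add coarse_part_vanishing refinement_defect_vanishing Ito_part_vanishing increment_Ito_part_vanishing covariation_part_vanishing)

end

text \<open>
  In the language of stochastic integrals: the Stratonovich integral of \<open>B Y\<close> against
  \<open>dI = Y \<circ> dw\<close> is the integral of \<open>B Y Y = 0\<close>.
\<close>

theorem (in filtered_prob_space) alternating_Stratonovich_sums_vanish: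
  fixes Y I :: "real \<Rightarrow> 'a \<Rightarrow> 'b::euclidean_space" and B :: "'b \<Rightarrow> 'b \<Rightarrow> real"
  assumes bm: "brownian_motion M F w" and t: "t > 0"
    and Y: "adapted F Y" "continuous_paths M Y" "\<And>s \<omega>. norm (Y s \<omega>) \<le> K"
    and qv: "bounded_in_prob (\<lambda>n \<omega>. \<Sum>i<n. (norm (Y (grid t n (Suc i)) \<omega> - Y (grid t n i) \<omega>))\<^sup>2)"
    and si: "has_stratonovich_integral M Y w I"
    and B: "bounded_bilinear B" "\<And>x. B x x = 0"
  obtains m :: "nat \<Rightarrow> nat" where "\<And>n. n < m n"
    and "vanishing_in_prob (\<lambda>n \<omega>. \<Sum>j<m n.
      B ((1/2) *\<^sub>R (Y (grid t (m n) j) \<omega> + Y (grid t (m n) (Suc j)) \<omega>))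
        (I (grid t (m n) (Suc j)) \<omega> - I (grid t (m n) j) \<omega>))"
proof -
  from bounded_bilinear.pos_bounded[OF B(1)] obtain C where C: "C > 0"
    "\<And>x y. norm (B x y) \<le> norm x * norm y * C" by blast
  from choice[OF allI[OF trapezoid_approximation[OF si t]]] obtain ref where
    ref: "\<forall>m. ref m > 0 \<and> (\<exists>E\<in>events. prob E \<le> 1 / real (Suc m) \<and> (\<forall>\<omega>\<in>space M - E. \<forall>l\<le>m.
     norm (partial_trapezoid Y w t m (ref m) l \<omega> - I (grid t m l) \<omega>) \<le> 1 / (real (Suc m))\<^sup>2))" ..
  have ref_pos: "\<And>m. ref m > 0"
    and ref_approx: "\<And>m. \<exists>E\<in>events. prob E \<le> 1 / real (Suc m) \<and> (\<forall>\<omega>\<in>space M - E. \<forall>l\<le>m.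
     norm (partial_trapezoid Y w t m (ref m) l \<omega> - I (grid t m l) \<omega>) \<le> 1 / (real (Suc m))\<^sup>2)"
    using ref by blast+
  have BC: "\<bar>B x y\<bar> \<le> norm x * norm y * C" for x y using C(2)[of x y] by simp
  interpret nested_grids M F w t Y I K B C ref
    by (intro nested_grids.intro nested_grids_axioms.intro filtered_prob_space_axioms)
       (fact bm t Y qv B C(1) BC ref_pos ref_approx)+
  show ?thesis
  proof (rule that[of m])
    show "n < m n" for n by (rule pos(4))
    show "vanishing_in_prob (\<lambda>n \<omega>. \<Sum>j<m n.
      B ((1/2) *\<^sub>R (Y (grid t (m n) j) \<omega> + Y (grid t (m n) (Suc j)) \<omega>))
        (I (grid t (m n) (Suc j)) \<omega> - I (grid t (m n) j) \<omega>))"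
      using alternating_sum_vanishing unfolding um_def u_def dI_def .
  qed
qed

section \<open>The stream function along its own velocity field\<close>

text \<open>
  The pairing of a vector with the quarter turn of another one. With \<open>xi k x\<close> in the first place it is
  the derivative of \<open>psi k\<close> at \<open>x\<close>.
\<close>

definition rot_prod :: "real^2 \<Rightarrow> real^2 \<Rightarrow> real" where
  "rot_prod a b = a $ 2 * b $ 1 - a $ 1 * b $ 2"

lemma rot_prod_self: "rot_prod a a = 0" by (simp add: rot_prod_def)

lemma rot_prod_bound: "\<bar>rot_prod a b\<bar> \<le> norm a * norm b * 2"
proof -
  have "\<bar>a $ i * b $ j\<bar> \<le> norm a * norm b" for i j
    unfolding abs_mult by (intro mult_mono component_le_norm_cart) auto
  from this[of 2 1] this[of 1 2] show ?thesis unfolding rot_prod_def by linarith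
qed

lemma bounded_bilinear_rot_prod: "bounded_bilinear rot_prod"
  by (rule bounded_bilinear.intro)
     (auto simp: rot_prod_def algebra_simps intro!: exI[of _ 2] rot_prod_bound[unfolded rot_prod_def, simplified])

interpretation rot_prod: bounded_bilinear rot_prod by (rule bounded_bilinear_rot_prod)

text \<open>
  With midpoint \<open>c\<close> and half length \<open>d\<close> the error is exactly \<open>2 * cos c * (sin d - d * cos d)\<close>, and
  \<open>sin d - d * cos d\<close> has the derivative \<open>d * sin d\<close>, which is at most \<open>d\<^sup>2\<close> in
  absolute value.
\<close>

lemma sin_trapezoid: "\<bar>sin q - sin p - (1/2) * (cos p + cos q) * (q - p)\<bar> \<le> \<bar>q - p\<bar> ^ 3" for p q :: real
proof -
  define d where "d = (q - p) / 2"
  define g where "g z = sin z - z * cos z" for z :: real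
  have "norm (g d - g 0) \<le> d\<^sup>2 * norm (d - 0)"
  proof (rule field_differentiable_bound[where S="cball 0 \<bar>d\<bar>" and f' = "\<lambda>z. z * sin z"])
    fix z :: real assume z: "z \<in> cball 0 \<bar>d\<bar>"
    show "(g has_field_derivative z * sin z) (at z within cball 0 \<bar>d\<bar>)"
      unfolding g_def[abs_def] by (auto intro!: derivative_eq_intros)
    have "\<bar>z * sin z\<bar> \<le> \<bar>z\<bar> * \<bar>z\<bar>" unfolding abs_mult by (intro mult_left_mono abs_sin_x_le_abs_x) auto
    also have "\<dots> \<le> \<bar>d\<bar> * \<bar>d\<bar>" using z by (intro mult_mono) auto
    finally show "norm (z * sin z) \<le> d\<^sup>2" by (simp add: power2_eq_square)
  qed auto
  then have f: "\<bar>sin d - d * cos d\<bar> \<le> \<bar>d\<bar> ^ 3"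
    by (simp add: g_def power3_eq_cube power2_eq_square)
  have "sin q - sin p - (1/2) * (cos p + cos q) * (q - p) = 2 * cos ((p + q) / 2) * (sin d - d * cos d)"
  proof -
    define c where "c = (p + q) / 2"
    have pq: "p = c - d" "q = c + d" by (simp_all add: c_def d_def field_simps)
    show ?thesis unfolding c_def[symmetric] unfolding pq
      by (simp add: sin_add sin_diff cos_add cos_diff algebra_simps)
  qed
  then have "\<bar>sin q - sin p - (1/2) * (cos p + cos q) * (q - p)\<bar>
      = \<bar>2 * cos ((p + q) / 2) * (sin d - d * cos d)\<bar>" by (rule arg_cong)
  also have "\<dots> \<le> 2 * 1 * \<bar>d\<bar> ^ 3"
    unfolding abs_mult using f by (intro mult_mono) auto
  also have "\<dots> \<le> \<bar>q - p\<bar> ^ 3" by (simp add: d_def power_divide)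
  finally show ?thesis .
qed

lemma abs_cos_diff_le: "\<bar>cos p - cos q\<bar> \<le> \<bar>p - q\<bar>" for p q :: real
proof -
  have "\<bar>cos p - cos q\<bar> = 2 * (\<bar>sin ((p + q) / 2)\<bar> * \<bar>sin ((q - p) / 2)\<bar>)"
    by (simp add: cos_diff_cos abs_mult)
  also have "\<dots> \<le> 2 * (1 * \<bar>(q - p) / 2\<bar>)"
    by (intro mult_left_mono mult_mono abs_sin_x_le_abs_x) auto
  finally show ?thesis by (simp add: abs_minus_commute)
qed

context
  fixes k :: "real^2"
begin

definition phase_sum :: "real^2 \<Rightarrow> real" where "phase_sum x = k $ 1 * x $ 1 + k $ 2 * x $ 2"
definition phase_diff :: "real^2 \<Rightarrow> real" where "phase_diff x = k $ 1 * x $ 1 - k $ 2 * x $ 2"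
definition wave_size :: real where "wave_size = \<bar>k $ 1\<bar> + \<bar>k $ 2\<bar>"

lemma wave_size_nonneg: "wave_size \<ge> 0" by (simp add: wave_size_def)

text \<open>
  In the two phases the stream function and the velocity separate into functions of one
  variable.
\<close>

lemma psi_phases: "psi k x = (sin (phase_sum x) + sin (phase_diff x)) / 2"
  by (simp add: psi_def phase_sum_def phase_diff_def sin_add sin_diff)

lemma xi_phases:
  "xi k x $ 1 = k $ 2 / 2 * (cos (phase_diff x) - cos (phase_sum x))"
  "xi k x $ 2 = k $ 1 / 2 * (cos (phase_diff x) + cos (phase_sum x))"
  by (simp_all add: xi_explicit phase_sum_def phase_diff_def cos_add cos_diff)

lemma phase_Lipschitz:
  "\<bar>phase_sum y - phase_sum x\<bar> \<le> wave_size * norm (y - x)"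
  "\<bar>phase_diff y - phase_diff x\<bar> \<le> wave_size * norm (y - x)"
proof -
  have c: "\<bar>k $ i * (y - x) $ i\<bar> \<le> \<bar>k $ i\<bar> * norm (y - x)" for i
    unfolding abs_mult by (intro mult_left_mono component_le_norm_cart) auto
  have "phase_sum y - phase_sum x = k $ 1 * (y - x) $ 1 + k $ 2 * (y - x) $ 2"
    "phase_diff y - phase_diff x = k $ 1 * (y - x) $ 1 - k $ 2 * (y - x) $ 2"
    by (simp_all add: phase_sum_def phase_diff_def algebra_simps)
  then show "\<bar>phase_sum y - phase_sum x\<bar> \<le> wave_size * norm (y - x)"
    "\<bar>phase_diff y - phase_diff x\<bar> \<le> wave_size * norm (y - x)"
    using c[of 1] c[of 2] unfolding wave_size_def distrib_right by linarith+
qed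

lemma psi_trapezoid:
  "\<bar>psi k y - psi k x - rot_prod ((1/2) *\<^sub>R (xi k x + xi k y)) (y - x)\<bar> \<le> wave_size ^ 3 * norm (y - x) ^ 3"
proof -
  let ?S = "\<lambda>q p :: real. sin q - sin p - (1/2) * (cos p + cos q) * (q - p)"
  have eq: "psi k y - psi k x - rot_prod ((1/2) *\<^sub>R (xi k x + xi k y)) (y - x)
      = (?S (phase_sum y) (phase_sum x) + ?S (phase_diff y) (phase_diff x)) / 2"
  proof -
    have d: "phase_sum y - phase_sum x = k $ 1 * (y - x) $ 1 + k $ 2 * (y - x) $ 2"
      "phase_diff y - phase_diff x = k $ 1 * (y - x) $ 1 - k $ 2 * (y - x) $ 2"
      by (simp_all add: phase_sum_def phase_diff_def algebra_simps)
    show ?thesis unfolding d unfolding rot_prod_def psi_phases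
      by (simp add: xi_phases field_simps)
  qed
  have "\<bar>psi k y - psi k x - rot_prod ((1/2) *\<^sub>R (xi k x + xi k y)) (y - x)\<bar>
      \<le> (\<bar>?S (phase_sum y) (phase_sum x)\<bar> + \<bar>?S (phase_diff y) (phase_diff x)\<bar>) / 2"
    unfolding eq using abs_triangle_ineq[of "?S (phase_sum y) (phase_sum x)" "?S (phase_diff y) (phase_diff x)"] by simp
  also have "\<dots> \<le> (\<bar>phase_sum y - phase_sum x\<bar> ^ 3 + \<bar>phase_diff y - phase_diff x\<bar> ^ 3) / 2"
    by (intro divide_right_mono add_mono sin_trapezoid) auto
  also have "\<dots> \<le> ((wave_size * norm (y - x)) ^ 3 + (wave_size * norm (y - x)) ^ 3) / 2"
    by (intro divide_right_mono add_mono power_mono phase_Lipschitz) auto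
  finally show ?thesis by (simp add: power_mult_distrib)
qed

lemma norm_real2_le: "norm x \<le> \<bar>x $ 1\<bar> + \<bar>x $ 2\<bar>" for x :: "real^2"
  using norm_le_l1_cart[of x] by (simp add: sum_2)

lemma xi_bounded: "norm (xi k x) \<le> wave_size"
proof -
  have "\<bar>c * p * q\<bar> \<le> \<bar>c\<bar>" if "\<bar>p\<bar> \<le> 1" "\<bar>q\<bar> \<le> 1" for c p q :: real
    unfolding mult.assoc abs_mult using that by (intro mult_left_le mult_le_one) auto
  then have "\<bar>xi k x $ 1\<bar> \<le> \<bar>k $ 2\<bar>" "\<bar>xi k x $ 2\<bar> \<le> \<bar>k $ 1\<bar>"
    by (simp_all add: xi_explicit)
  then show ?thesis using norm_real2_le[of "xi k x"] by (simp add: wave_size_def)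
qed

lemma xi_Lipschitz: "norm (xi k y - xi k x) \<le> wave_size\<^sup>2 * norm (y - x)"
proof -
  let ?N = "wave_size * norm (y - x)"
  have d: "\<bar>cos (phase_diff y) - cos (phase_diff x)\<bar> \<le> ?N" "\<bar>cos (phase_sum y) - cos (phase_sum x)\<bar> \<le> ?N"
    by (rule order_trans[OF abs_cos_diff_le phase_Lipschitz(2)], rule order_trans[OF abs_cos_diff_le phase_Lipschitz(1)])
  have eq: "xi k y $ 1 - xi k x $ 1 = k $ 2 * (((cos (phase_diff y) - cos (phase_diff x))
      - (cos (phase_sum y) - cos (phase_sum x))) / 2)"
    "xi k y $ 2 - xi k x $ 2 = k $ 1 * (((cos (phase_diff y) - cos (phase_diff x))
      + (cos (phase_sum y) - cos (phase_sum x))) / 2)"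
    by (simp_all add: xi_phases field_simps)
  have half: "\<bar>(p - q) / 2\<bar> \<le> z" "\<bar>(p + q) / 2\<bar> \<le> z" if "\<bar>p\<bar> \<le> z" "\<bar>q\<bar> \<le> z" for p q z :: real
    using that by (auto simp: abs_le_iff)
  have "\<bar>xi k y $ 1 - xi k x $ 1\<bar> \<le> \<bar>k $ 2\<bar> * ?N" "\<bar>xi k y $ 2 - xi k x $ 2\<bar> \<le> \<bar>k $ 1\<bar> * ?N"
    unfolding eq abs_mult by (intro mult_left_mono half d abs_ge_zero)+
  then have "norm (xi k y - xi k x) \<le> \<bar>k $ 2\<bar> * ?N + \<bar>k $ 1\<bar> * ?N"
    using norm_real2_le[of "xi k y - xi k x"] by simp
  also have "\<dots> = wave_size\<^sup>2 * norm (y - x)"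
    by (simp add: wave_size_def power2_eq_square algebra_simps)
  finally show ?thesis .
qed

lemma continuous_xi: "continuous_on UNIV (xi k)"
  by (rule lipschitz_on_continuous_on[of "wave_size\<^sup>2"])
     (auto simp: lipschitz_on_def dist_norm xi_Lipschitz)

lemma continuous_psi: "continuous_on UNIV (psi k)"
  unfolding psi_def[abs_def] by (intro continuous_intros)

text \<open>
  In each component the product terms combine by \<open>sin\<^sup>2 + cos\<^sup>2 = 1\<close>, so the component depends on one
  coordinate only.
\<close>

lemma jacobian_xi:
  "jacobian (xi k) (at x) *v xi k x =
     vector [k $ 1 * (k $ 2)\<^sup>2 * sin (k $ 1 * x $ 1) * cos (k $ 1 * x $ 1),
             - (k $ 1)\<^sup>2 * k $ 2 * sin (k $ 2 * x $ 2) * cos (k $ 2 * x $ 2)]"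
proof -
  let ?a = "k $ 1 * x $ 1" and ?b = "k $ 2 * x $ 2"
  let ?D = "\<lambda>h :: real^2. (k $ 2 * (k $ 1 * h $ 1 * cos ?a * sin ?b + k $ 2 * h $ 2 * sin ?a * cos ?b)) *\<^sub>R axis 1 (1::real)
      + (- (k $ 1 * (k $ 1 * h $ 1 * sin ?a * cos ?b + k $ 2 * h $ 2 * cos ?a * sin ?b))) *\<^sub>R axis 2 1 :: real^2"
  have xi: "xi k = (\<lambda>x. (k $ 2 * sin (k $ 1 * x $ 1) * sin (k $ 2 * x $ 2)) *\<^sub>R axis 1 1
      + (k $ 1 * cos (k $ 1 * x $ 1) * cos (k $ 2 * x $ 2)) *\<^sub>R axis 2 1)"
    by (rule ext) (simp add: xi_explicit vec_eq_iff forall_2 axis_def)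
  have D: "(xi k has_derivative ?D) (at x)"
    unfolding xi
    by (auto intro!: derivative_eq_intros bounded_linear_imp_has_derivative bounded_linear_vec_nth
        simp: algebra_simps fun_eq_iff)
  then have "xi k differentiable (at x)" by (auto simp: differentiable_def)
  then have "(xi k has_derivative (\<lambda>h. jacobian (xi k) (at x) *v h)) (at x)"
    by (simp add: jacobian_works)
  from has_derivative_unique[OF this D]
  have eq: "jacobian (xi k) (at x) *v xi k x = ?D (xi k x)" by (rule fun_cong)
  have alg: "k $ 2 * (k $ 1 * (k $ 2 * s * s') * c * s' + k $ 2 * (k $ 1 * c * c') * s * c')
      = k $ 1 * (k $ 2)\<^sup>2 * s * c * (s'\<^sup>2 + c'\<^sup>2)"
    "- (k $ 1 * (k $ 1 * (k $ 2 * s * s') * s * c' + k $ 2 * (k $ 1 * c * c') * c * s'))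
      = - (k $ 1)\<^sup>2 * k $ 2 * s' * c' * (s\<^sup>2 + c\<^sup>2)" for s c s' c' :: real
    by (simp_all add: power2_eq_square algebra_simps)
  have "k $ 2 * (k $ 1 * xi k x $ 1 * cos ?a * sin ?b + k $ 2 * xi k x $ 2 * sin ?a * cos ?b)
      = k $ 1 * (k $ 2)\<^sup>2 * sin ?a * cos ?a"
    "- (k $ 1 * (k $ 1 * xi k x $ 1 * sin ?a * cos ?b + k $ 2 * xi k x $ 2 * cos ?a * sin ?b))
      = - (k $ 1)\<^sup>2 * k $ 2 * sin ?b * cos ?b"
    using alg(1)[where s="sin ?a" and s'="sin ?b" and c="cos ?a" and c'="cos ?b"]
      alg(2)[where s="sin ?a" and s'="sin ?b" and c="cos ?a" and c'="cos ?b"]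
    unfolding xi_explicit vector_2 sin_cos_squared_add by (simp_all only: mult_1_right)
  with eq show ?thesis by (simp only: vec_eq_iff forall_2 vector_2) (simp add: axis_def)
qed

lemma drift_explicit:
  "drift k l \<alpha> x = (1/2 * damping l \<alpha>) *\<^sub>R
     vector [k $ 1 * (k $ 2)\<^sup>2 * sin (k $ 1 * x $ 1) * cos (k $ 1 * x $ 1),
             - (k $ 1)\<^sup>2 * k $ 2 * sin (k $ 2 * x $ 2) * cos (k $ 2 * x $ 2)]"
  by (simp only: drift_def jacobian_xi)

lemma continuous_drift: "continuous_on UNIV (drift k l \<alpha>)"
proof -
  have eq: "drift k l \<alpha> = (\<lambda>x. (1/2 * damping l \<alpha>) *\<^sub>R
     ((k $ 1 * (k $ 2)\<^sup>2 * sin (k $ 1 * x $ 1) * cos (k $ 1 * x $ 1)) *\<^sub>R axis 1 1 +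
      (- (k $ 1)\<^sup>2 * k $ 2 * sin (k $ 2 * x $ 2) * cos (k $ 2 * x $ 2)) *\<^sub>R axis 2 1))"
    by (rule ext) (simp add: drift_explicit vec_eq_iff forall_2 axis_def)
  show ?thesis unfolding eq by (intro continuous_intros)
qed

definition decay_rate :: "real \<Rightarrow> ennreal \<Rightarrow> real^2 \<Rightarrow> real" where
  "decay_rate l \<alpha> x = 1/2 * damping l \<alpha> * (k $ 1)\<^sup>2 * (k $ 2)\<^sup>2 *
     ((cos (k $ 1 * x $ 1))\<^sup>2 + (sin (k $ 2 * x $ 2))\<^sup>2)"

text \<open>
  The derivative of the stream function along the drift is a multiple of the stream function itself.
  This is what makes the equation for \<open>psi\<close> along the solution a closed linear one.
\<close>

lemma rot_prod_drift: "rot_prod (xi k x) (drift k l \<alpha> x) = decay_rate l \<alpha> x * psi k x"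
  by (simp add: rot_prod_def drift_explicit xi_explicit decay_rate_def psi_def power2_eq_square algebra_simps)

lemma decay_rate_nonneg: "l > 0 \<Longrightarrow> decay_rate l \<alpha> x \<ge> 0"
  unfolding decay_rate_def damping_def by (intro mult_nonneg_nonneg add_nonneg_nonneg) auto

lemma continuous_decay_rate: "continuous_on UNIV (decay_rate l \<alpha>)"
  unfolding decay_rate_def[abs_def] by (intro continuous_intros)

lemma drift_bounded: "\<exists>D. \<forall>x. norm (drift k l \<alpha> x) \<le> D"
proof -
  have sc: "\<bar>sin z * cos z\<bar> \<le> 1" for z :: real
    unfolding abs_mult by (intro mult_le_one) auto
  have b: "\<bar>c * sin z * cos z\<bar> \<le> \<bar>c\<bar>" for c z :: real
    unfolding mult.assoc abs_mult[of c] by (intro mult_left_le sc) auto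
  have "norm (drift k l \<alpha> x) \<le> \<bar>1/2 * damping l \<alpha>\<bar> * (\<bar>k $ 1 * (k $ 2)\<^sup>2\<bar> + \<bar>(k $ 1)\<^sup>2 * k $ 2\<bar>)" for x
  proof -
    have "norm (drift k l \<alpha> x) = \<bar>1/2 * damping l \<alpha>\<bar> * norm (vector [k $ 1 * (k $ 2)\<^sup>2 * sin (k $ 1 * x $ 1) * cos (k $ 1 * x $ 1),
             - (k $ 1)\<^sup>2 * k $ 2 * sin (k $ 2 * x $ 2) * cos (k $ 2 * x $ 2)] :: real^2)"
      unfolding drift_explicit by simp
    also have "\<dots> \<le> \<bar>1/2 * damping l \<alpha>\<bar> * (\<bar>k $ 1 * (k $ 2)\<^sup>2\<bar> + \<bar>(k $ 1)\<^sup>2 * k $ 2\<bar>)"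
      using b[of "k $ 1 * (k $ 2)\<^sup>2"] b[of "- (k $ 1)\<^sup>2 * k $ 2"]
      by (intro mult_left_mono order_trans[OF norm_real2_le] add_mono) auto
    finally show ?thesis .
  qed
  then show ?thesis by blast
qed

end

section \<open>Linear decay\<close>

text \<open>
  The product of \<open>y\<close> with the integrating factor has derivative zero.
\<close>

lemma linear_decay_solution:
  fixes y a :: "real \<Rightarrow> real"
  assumes y: "continuous_on {0..} y" and a: "continuous_on {0..} a"
    and eq: "\<And>t. t \<ge> 0 \<Longrightarrow> y t = y 0 - integral {0..t} (\<lambda>s. a s * y s)" and t: "t \<ge> 0"
  shows "y t = y 0 * exp (- integral {0..t} a)"
proof -
  define z where "z s = y s * exp (integral {0..s} a)" for s
  have ca: "continuous_on {0..t} a" and cy: "continuous_on {0..t} y"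
    using a y by (auto elim: continuous_on_subset)
  have "z t = z 0"
  proof -
    have "\<exists>c. \<forall>s\<in>{0..t}. z s = c"
    proof (rule has_field_derivative_zero_constant)
      fix s assume s: "s \<in> {0..t}"
      have dA: "((\<lambda>s. integral {0..s} a) has_field_derivative a s) (at s within {0..t})"
        by (rule integral_has_real_derivative[OF ca s])
      have "((\<lambda>s. integral {0..s} (\<lambda>s. a s * y s)) has_field_derivative a s * y s) (at s within {0..t})"
        by (rule integral_has_real_derivative[OF continuous_on_mult[OF ca cy] s])
      from DERIV_diff[OF DERIV_const[of "y 0"] this]
      have "((\<lambda>s. y 0 - integral {0..s} (\<lambda>s. a s * y s)) has_field_derivative - (a s * y s)) (at s within {0..t})"
        by simp
      then have dy: "(y has_field_derivative - (a s * y s)) (at s within {0..t})"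
        by (rule has_field_derivative_transform_within[OF _ zero_less_one s]) (rule eq[symmetric], simp)
      from DERIV_mult[OF dy DERIV_chain2[OF DERIV_exp dA]]
      show "(z has_field_derivative 0) (at s within {0..t})"
        unfolding z_def[abs_def] by (simp add: algebra_simps)
    qed simp
    then show ?thesis using t by auto
  qed
  then have *: "y t * exp (integral {0..t} a) = y 0" by (simp add: z_def)
  show ?thesis unfolding *[symmetric] mult.assoc exp_add[symmetric] by simp
qed

lemma linear_decay_monotone:
  fixes y a :: "real \<Rightarrow> real"
  assumes y: "continuous_on {0..} y" and a: "continuous_on {0..} a" "\<And>s. s \<ge> 0 \<Longrightarrow> a s \<ge> 0"
    and eq: "\<And>t. t \<ge> 0 \<Longrightarrow> y t = y 0 - integral {0..t} (\<lambda>s. a s * y s)"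
  shows "y 0 \<ge> 0 \<Longrightarrow> antimono_on {0..} y" "y 0 \<le> 0 \<Longrightarrow> mono_on {0..} y"
    and "t \<ge> 0 \<Longrightarrow> y t > 0 \<Longrightarrow> y 0 > 0" "t \<ge> 0 \<Longrightarrow> y t < 0 \<Longrightarrow> y 0 < 0"
proof -
  have sol: "y t = y 0 * exp (- integral {0..t} a)" if "t \<ge> 0" for t
    by (rule linear_decay_solution[OF y a(1) _ that]) (rule eq)
  have mono: "exp (- integral {0..t} a) \<le> exp (- integral {0..s} a)" if st: "0 \<le> s" "s \<le> t" for s t
  proof -
    have ca: "continuous_on {0..t} a" "continuous_on {s..t} a"
      using st by (auto intro!: continuous_on_subset[OF a(1)])
    have "integral {0..s} a + integral {s..t} a = integral {0..t} a"
      using st ca by (intro Henstock_Kurzweil_Integration.integral_combine integrable_continuous_real)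
    moreover have "integral {s..t} a \<ge> 0"
      using st by (intro Henstock_Kurzweil_Integration.integral_nonneg integrable_continuous_real ca a(2)) simp
    ultimately show ?thesis by simp
  qed
  show "antimono_on {0..} y" if "y 0 \<ge> 0"
  proof (rule monotone_onI)
    fix s t assume "s \<in> {0..}" "t \<in> {0..}" "s \<le> (t::real)"
    then have st: "0 \<le> s" "0 \<le> t" "s \<le> t" by auto
    show "y s \<ge> y t"
      using mult_left_mono[OF mono[OF st(1,3)] that] unfolding sol[OF st(1), symmetric] sol[OF st(2), symmetric] .
  qed
  show "mono_on {0..} y" if "y 0 \<le> 0"
  proof (rule monotone_onI)
    fix s t assume "s \<in> {0..}" "t \<in> {0..}" "s \<le> (t::real)"
    then have st: "0 \<le> s" "0 \<le> t" "s \<le> t" by auto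
    show "y s \<le> y t"
      using mult_left_mono_neg[OF mono[OF st(1,3)] that] unfolding sol[OF st(1), symmetric] sol[OF st(2), symmetric] .
  qed
  show "y 0 > 0" if "t \<ge> 0" "y t > 0"
    using that(2) sol[OF that(1)] by (metis exp_gt_zero zero_less_mult_pos2)
  show "y 0 < 0" if "t \<ge> 0" "y t < 0"
    using that(2) sol[OF that(1)] by (metis exp_gt_zero mult_less_0_iff not_less_iff_gr_or_eq)
qed

section \<open>The stream function along the solution\<close>

text \<open>
  On one cell the drift part of the trapezoidal sum cancels the decay integral, up to the oscillation
  of the velocity.
\<close>

lemma decay_drift_step:
  assumes X: "continuous_on {a..b} X" and ab: "a \<le> b"
    and D: "\<And>y. norm (drift k l \<alpha> y) \<le> D"
    and osc: "\<And>s. s \<in> {a..b} \<Longrightarrow> norm (xi k (X a) - xi k (X s)) \<le> \<delta>"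
      "\<And>s. s \<in> {a..b} \<Longrightarrow> norm (xi k (X b) - xi k (X s)) \<le> \<delta>"
  shows "\<bar>rot_prod ((1/2) *\<^sub>R (xi k (X a) + xi k (X b))) (integral {a..b} (\<lambda>s. - drift k l \<alpha> (X s)))
      + integral {a..b} (\<lambda>s. decay_rate k l \<alpha> (X s) * psi k (X s))\<bar> \<le> 2 * D * \<delta> * (b - a)"
proof -
  let ?y = "(1/2) *\<^sub>R (xi k (X a) + xi k (X b))"
  have comp: "continuous_on {a..b} (\<lambda>s. f (X s))" if "continuous_on UNIV f" for f :: "real^2 \<Rightarrow> 'c::topological_space"
    by (rule continuous_on_compose2[OF that X]) simp
  have cd: "continuous_on {a..b} (\<lambda>s. - drift k l \<alpha> (X s))"
    by (intro continuous_on_minus comp continuous_drift)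
  have cp: "continuous_on {a..b} (\<lambda>s. decay_rate k l \<alpha> (X s) * psi k (X s))"
    by (intro continuous_on_mult comp continuous_decay_rate continuous_psi)
  have cr: "continuous_on {a..b} (\<lambda>s. rot_prod ?y (- drift k l \<alpha> (X s)))"
    by (intro rot_prod.continuous_on continuous_on_const cd)
  have "rot_prod ?y (integral {a..b} (\<lambda>s. - drift k l \<alpha> (X s)))
      = integral {a..b} (\<lambda>s. rot_prod ?y (- drift k l \<alpha> (X s)))"
    using integral_linear[OF integrable_continuous_real[OF cd] rot_prod.bounded_linear_right[of ?y]]
    by (simp add: comp_def)
  then have "rot_prod ?y (integral {a..b} (\<lambda>s. - drift k l \<alpha> (X s)))
      + integral {a..b} (\<lambda>s. decay_rate k l \<alpha> (X s) * psi k (X s))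
    = integral {a..b} (\<lambda>s. rot_prod ?y (- drift k l \<alpha> (X s)) + decay_rate k l \<alpha> (X s) * psi k (X s))"
    using Henstock_Kurzweil_Integration.integral_add[OF integrable_continuous_real[OF cr] integrable_continuous_real[OF cp]]
    by simp
  moreover have "norm (integral {a..b} (\<lambda>s. rot_prod ?y (- drift k l \<alpha> (X s)) + decay_rate k l \<alpha> (X s) * psi k (X s)))
      \<le> 2 * D * \<delta> * (b - a)"
  proof (rule integral_bound[OF ab continuous_on_add[OF cr cp]])
    fix s assume s: "s \<in> {a..b}"
    \<comment> \<open>The decay term is \<open>rot_prod\<close> of the drift with the velocity at \<open>s\<close>, so only the difference
      of the velocities remains.\<close>
    have eq: "rot_prod ?y (- drift k l \<alpha> (X s)) + decay_rate k l \<alpha> (X s) * psi k (X s)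
      = rot_prod (xi k (X s) - ?y) (drift k l \<alpha> (X s))"
      by (simp add: rot_prod.minus_right rot_prod.diff_left rot_prod_drift)
    have "xi k (X s) - ?y = - ((1/2) *\<^sub>R ((xi k (X a) - xi k (X s)) + (xi k (X b) - xi k (X s))))"
      unfolding midpoint_eq_start_plus[of "xi k (X a)"] midpoint_eq_start_plus[of "xi k (X a) - xi k (X s)"] by simp
    then have "norm (xi k (X s) - ?y) = norm ((xi k (X a) - xi k (X s)) + (xi k (X b) - xi k (X s))) / 2"
      by simp
    then have n: "norm (xi k (X s) - ?y) \<le> \<delta>"
      using norm_triangle_ineq[of "xi k (X a) - xi k (X s)" "xi k (X b) - xi k (X s)"] osc[OF s] by linarith
    have "\<bar>rot_prod (xi k (X s) - ?y) (drift k l \<alpha> (X s))\<bar> \<le> norm (xi k (X s) - ?y) * norm (drift k l \<alpha> (X s)) * 2"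
      by (rule rot_prod_bound)
    also have "\<dots> \<le> \<delta> * D * 2"
      using n D order_trans[OF norm_ge_zero n] by (intro mult_right_mono mult_mono) auto
    finally show "norm (rot_prod ?y (- drift k l \<alpha> (X s)) + decay_rate k l \<alpha> (X s) * psi k (X s)) \<le> 2 * D * \<delta>"
      unfolding eq by (simp add: mult_ac)
  qed
  ultimately show ?thesis by simp
qed

text \<open>
  The left-hand side does not depend on the grid. On each grid it is the sum of the cubic trapezoidal errors
  \<open>S1\<close>, the alternating sum against the Stratonovich integral, and the drift errors \<open>S3\<close>. All three
  tend to 0 in probability, so it is zero almost surely.
\<close>

lemma (in filtered_prob_space) psi_decay_at_time:
  assumes bm: "brownian_motion M F w"
    and sol: "stratonovich_solution M F w (xi k) (\<lambda>y. - drift k l \<alpha> y) x0 x" and t: "t > 0"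
  shows "AE \<omega> in M. psi k (x t \<omega>) - psi k (x 0 \<omega>)
    + integral {0..t} (\<lambda>s. decay_rate k l \<alpha> (x s \<omega>) * psi k (x s \<omega>)) = 0"
proof -
  from sol obtain I where ad: "adapted F x" and cp: "continuous_paths M x"
    and sm: "\<And>i. continuous_semimartingale M F (\<lambda>t \<omega>. x t \<omega> $ i)"
    and si: "has_stratonovich_integral M (\<lambda>t \<omega>. xi k (x t \<omega>)) w I"
    and xI: "AE \<omega> in M. \<forall>t\<ge>0. x t \<omega> = x0 + I t \<omega> + integral {0..t} (\<lambda>s. - drift k l \<alpha> (x s \<omega>))"
    unfolding stratonovich_solution_def by blast
  define Y where "Y s \<omega> = xi k (x s \<omega>)" for s \<omega>
  define p where "p = grid t"
  have xc: "AE \<omega> in M. continuous_on {0..} (\<lambda>s. x s \<omega>)" using cp by (simp add: continuous_paths_def)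
  have Yc: "continuous_on A (\<lambda>s. Y s \<omega>)" if "continuous_on A (\<lambda>s. x s \<omega>)" for A \<omega>
    unfolding Y_def by (rule continuous_on_compose2[OF continuous_xi that]) simp
  have Ycp: "continuous_paths M Y"
    unfolding continuous_paths_def using xc by eventually_elim (rule Yc)
  have Yad: "adapted F Y"
    unfolding adapted_def Y_def[abs_def]
    using ad borel_measurable_continuous_onI[OF continuous_xi]
    by (auto simp: adapted_def intro: measurable_compose)
  have qx: "bounded_in_prob (\<lambda>n \<omega>. \<Sum>i<n. (norm (x (p n (Suc i)) \<omega> - x (p n i) \<omega>))\<^sup>2)"
  proof -
    have eq: "(norm h)\<^sup>2 = (h $ 1)\<^sup>2 + (h $ 2)\<^sup>2" for h :: "real^2"
      unfolding power2_norm_eq_inner by (simp add: inner_vec_def sum_2 power2_eq_square)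
    have "bounded_in_prob (\<lambda>n \<omega>. (\<Sum>i<n. (x (p n (Suc i)) \<omega> $ 1 - x (p n i) \<omega> $ 1)\<^sup>2)
        + (\<Sum>i<n. (x (p n (Suc i)) \<omega> $ 2 - x (p n i) \<omega> $ 2)\<^sup>2))"
      unfolding p_def using t
      by (intro bounded_in_prob_add semimartingale_bounded_quadratic_variation sm) auto
    then show ?thesis by (simp add: eq sum.distrib)
  qed
  have qY: "bounded_in_prob (\<lambda>n \<omega>. \<Sum>i<n. (norm (Y (grid t n (Suc i)) \<omega> - Y (grid t n i) \<omega>))\<^sup>2)"
  proof (rule bounded_in_prob_mono[OF bounded_in_prob_cmult[where c="((wave_size k)\<^sup>2)\<^sup>2", OF qx]], rule AE_I2)
    fix n \<omega>
    have "(\<Sum>i<n. (norm (Y (p n (Suc i)) \<omega> - Y (p n i) \<omega>))\<^sup>2)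
        \<le> (\<Sum>i<n. ((wave_size k)\<^sup>2)\<^sup>2 * (norm (x (p n (Suc i)) \<omega> - x (p n i) \<omega>))\<^sup>2)"
      unfolding Y_def power_mult_distrib[symmetric]
      by (intro sum_mono power_mono xi_Lipschitz norm_ge_zero)
    then show "\<bar>\<Sum>i<n. (norm (Y (grid t n (Suc i)) \<omega> - Y (grid t n i) \<omega>))\<^sup>2\<bar>
        \<le> \<bar>((wave_size k)\<^sup>2)\<^sup>2 * (\<Sum>i<n. (norm (x (p n (Suc i)) \<omega> - x (p n i) \<omega>))\<^sup>2)\<bar>"
      by (simp add: p_def sum_distrib_left[symmetric] sum_nonneg)
  qed
  have Ybd: "norm (Y s \<omega>) \<le> wave_size k" for s \<omega> by (simp add: Y_def xi_bounded)
  from alternating_Stratonovich_sums_vanish[OF bm t Yad Ycp Ybd qY si[folded Y_def]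
      bounded_bilinear_rot_prod rot_prod_self]
  obtain m where m: "\<And>n. n < m n"
    and S2: "vanishing_in_prob (\<lambda>n \<omega>. \<Sum>j<m n. rot_prod ((1/2) *\<^sub>R (Y (p (m n) j) \<omega> + Y (p (m n) (Suc j)) \<omega>))
        (I (p (m n) (Suc j)) \<omega> - I (p (m n) j) \<omega>))"
    unfolding p_def by blast
  define ym where "ym n j \<omega> = (1/2) *\<^sub>R (Y (p (m n) j) \<omega> + Y (p (m n) (Suc j)) \<omega>)" for n j \<omega>
  define S1 where "S1 n j \<omega> = psi k (x (p (m n) (Suc j)) \<omega>) - psi k (x (p (m n) j) \<omega>)
    - rot_prod (ym n j \<omega>) (x (p (m n) (Suc j)) \<omega> - x (p (m n) j) \<omega>)" for n j \<omega>
  define S3 where "S3 n j \<omega> = rot_prod (ym n j \<omega>) (integral {p (m n) j..p (m n) (Suc j)} (\<lambda>s. - drift k l \<alpha> (x s \<omega>)))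
    + integral {p (m n) j..p (m n) (Suc j)} (\<lambda>s. decay_rate k l \<alpha> (x s \<omega>) * psi k (x s \<omega>))" for n j \<omega>
  have m0: "m n > 0" for n using m[of n] by simp
  have p_in: "p (m n) j \<in> {0..t}" if "j \<le> m n" for n j
    using t that by (auto simp: p_def grid_le)
  have p_step: "p (m n) (Suc j) - p (m n) j = t / real (m n)" for n j by (simp add: p_def grid_Suc)
  have p_mono: "p (m n) j \<le> p (m n) (Suc j)" for n j using t by (simp add: p_def grid_Suc)
  have mesh: "t / real (m n) \<le> t / real (Suc n)" for n
    using t m[of n] by (intro divide_left_mono) auto
  have mx: "vanishing_in_prob (modulus t x)"
    by (rule modulus_vanishing[OF t adapted_measurable[OF ad] cp])
  have qxm: "bounded_in_prob (\<lambda>n \<omega>. \<Sum>i<m n. (norm (x (p (m n) (Suc i)) \<omega> - x (p (m n) i) \<omega>))\<^sup>2)"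
    using bounded_in_prob_subseq[OF qx, of m] .
  have S1v: "vanishing_in_prob (\<lambda>n \<omega>. \<Sum>j<m n. S1 n j \<omega>)"
  proof (rule vanishing_in_prob_mono[OF vanishing_in_prob_cmult[where c="wave_size k ^ 3",
        OF bounded_in_prob_mult_vanishing[OF qxm mx]]], rule always_eventually, rule allI)
    fix n
    show "AE \<omega> in M. \<bar>\<Sum>j<m n. S1 n j \<omega>\<bar> \<le> \<bar>wave_size k ^ 3 *
      ((\<Sum>i<m n. (norm (x (p (m n) (Suc i)) \<omega> - x (p (m n) i) \<omega>))\<^sup>2) * modulus t x n \<omega>)\<bar>"
      using xc
    proof eventually_elim
      case (elim \<omega>)
      then have c: "continuous_on {0..t} (\<lambda>s. x s \<omega>)" by (rule continuous_on_subset) auto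
      let ?d = "\<lambda>j. norm (x (p (m n) (Suc j)) \<omega> - x (p (m n) j) \<omega>)"
      have "\<bar>\<Sum>j<m n. S1 n j \<omega>\<bar> \<le> (\<Sum>j<m n. wave_size k ^ 3 * ((?d j)\<^sup>2 * modulus t x n \<omega>))"
      proof (rule order_trans[OF sum_abs sum_mono])
        fix j assume j: "j \<in> {..<m n}"
        have le: "?d j \<le> modulus t x n \<omega>"
          using p_in[of j n] p_in[of "Suc j" n] j p_step[of n j] mesh[of n] t
          by (intro modulus_bound[where Z=x and \<omega>=\<omega>, OF c]) auto
        have "\<bar>S1 n j \<omega>\<bar> \<le> wave_size k ^ 3 * ?d j ^ 3"
          unfolding S1_def ym_def Y_def by (rule psi_trapezoid)
        also have "\<dots> = wave_size k ^ 3 * ((?d j)\<^sup>2 * ?d j)" by (simp add: power3_eq_cube power2_eq_square)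
        also have "\<dots> \<le> wave_size k ^ 3 * ((?d j)\<^sup>2 * modulus t x n \<omega>)"
          using le wave_size_nonneg[of k] by (intro mult_left_mono) auto
        finally show "\<bar>S1 n j \<omega>\<bar> \<le> wave_size k ^ 3 * ((?d j)\<^sup>2 * modulus t x n \<omega>)" .
      qed
      also have "\<dots> = wave_size k ^ 3 * ((\<Sum>j<m n. (?d j)\<^sup>2) * modulus t x n \<omega>)"
        by (simp only: sum_distrib_left[symmetric] sum_distrib_right[symmetric])
      also have "\<dots> \<le> \<bar>wave_size k ^ 3 * ((\<Sum>j<m n. (?d j)\<^sup>2) * modulus t x n \<omega>)\<bar>" by (rule abs_ge_self)
      finally show ?case .
    qed
  qed
  obtain D where D: "\<And>y. norm (drift k l \<alpha> y) \<le> D" using drift_bounded by blast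
  have mY: "vanishing_in_prob (modulus t Y)"
    by (rule modulus_vanishing[OF t adapted_measurable[OF Yad] Ycp])
  have S3v: "vanishing_in_prob (\<lambda>n \<omega>. \<Sum>j<m n. S3 n j \<omega>)"
  proof (rule vanishing_in_prob_mono[OF vanishing_in_prob_cmult[where c="2 * D * t", OF mY]], rule always_eventually, rule allI)
    fix n
    show "AE \<omega> in M. \<bar>\<Sum>j<m n. S3 n j \<omega>\<bar> \<le> \<bar>2 * D * t * modulus t Y n \<omega>\<bar>"
      using xc
    proof eventually_elim
      case (elim \<omega>)
      then have cx: "continuous_on {0..t} (\<lambda>s. x s \<omega>)" by (rule continuous_on_subset) auto
      note cY = Yc[OF cx]
      have "\<bar>\<Sum>j<m n. S3 n j \<omega>\<bar> \<le> (\<Sum>j<m n. 2 * D * modulus t Y n \<omega> * (t / real (m n)))"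
      proof (rule order_trans[OF sum_abs sum_mono])
        fix j assume "j \<in> {..<m n}"
        then have j: "j \<le> m n" "Suc j \<le> m n" by auto
        have sub: "{p (m n) j..p (m n) (Suc j)} \<subseteq> {0..t}" using p_in[OF j(1)] p_in[OF j(2)] by auto
        have osc: "norm (Y r \<omega> - Y s \<omega>) \<le> modulus t Y n \<omega>"
          if "r \<in> {p (m n) j..p (m n) (Suc j)}" "s \<in> {p (m n) j..p (m n) (Suc j)}" for r s
          using that sub p_step[of n j] mesh[of n]
          by (intro modulus_bound[where Z=Y and \<omega>=\<omega>, OF cY]) auto
        have "\<bar>S3 n j \<omega>\<bar> \<le> 2 * D * modulus t Y n \<omega> * (p (m n) (Suc j) - p (m n) j)"
          unfolding S3_def ym_def Y_def[of "p (m n) j"] Y_def[of "p (m n) (Suc j)"]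
          by (rule decay_drift_step[OF continuous_on_subset[OF cx sub] p_mono D])
             (use osc p_mono in \<open>auto simp: Y_def[symmetric]\<close>)
        then show "\<bar>S3 n j \<omega>\<bar> \<le> 2 * D * modulus t Y n \<omega> * (t / real (m n))" by (simp only: p_step)
      qed
      also have "\<dots> = 2 * D * t * modulus t Y n \<omega>" using m0[of n] by simp
      also have "\<dots> \<le> \<bar>2 * D * t * modulus t Y n \<omega>\<bar>" by (rule abs_ge_self)
      finally show ?case .
    qed
  qed
  have "vanishing_in_prob (\<lambda>n \<omega>. psi k (x t \<omega>) - psi k (x 0 \<omega>)
    + integral {0..t} (\<lambda>s. decay_rate k l \<alpha> (x s \<omega>) * psi k (x s \<omega>)))"
  proof (rule vanishing_in_prob_mono[OF vanishing_in_prob_add[OF vanishing_in_prob_add[OF S1v S2] S3v]],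
      rule always_eventually, rule allI)
    fix n
    show "AE \<omega> in M. \<bar>psi k (x t \<omega>) - psi k (x 0 \<omega>)
        + integral {0..t} (\<lambda>s. decay_rate k l \<alpha> (x s \<omega>) * psi k (x s \<omega>))\<bar>
      \<le> \<bar>(\<Sum>j<m n. S1 n j \<omega>) + (\<Sum>j<m n. rot_prod ((1/2) *\<^sub>R (Y (p (m n) j) \<omega> + Y (p (m n) (Suc j)) \<omega>))
        (I (p (m n) (Suc j)) \<omega> - I (p (m n) j) \<omega>)) + (\<Sum>j<m n. S3 n j \<omega>)\<bar>"
      using xc xI
    proof eventually_elim
      case (elim \<omega>)
      have cx: "continuous_on {0..t} (\<lambda>s. x s \<omega>)" by (rule continuous_on_subset[OF elim(1)]) auto
      have comp: "continuous_on {0..t} (\<lambda>s. f (x s \<omega>))" if "continuous_on UNIV f" for f :: "real^2 \<Rightarrow> 'c::topological_space"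
        by (rule continuous_on_compose2[OF that cx]) simp
      define \<Phi> where "\<Phi> r = integral {0..r} (\<lambda>s. - drift k l \<alpha> (x s \<omega>))" for r
      define \<Psi> where "\<Psi> r = integral {0..r} (\<lambda>s. decay_rate k l \<alpha> (x s \<omega>) * psi k (x s \<omega>))" for r
      have \<Phi>: "\<Phi> b - \<Phi> a = integral {a..b} (\<lambda>s. - drift k l \<alpha> (x s \<omega>))"
        and \<Psi>: "\<Psi> b - \<Psi> a = integral {a..b} (\<lambda>s. decay_rate k l \<alpha> (x s \<omega>) * psi k (x s \<omega>))"
        if ab: "0 \<le> a" "a \<le> b" "b \<le> t" for a b
      proof -
        have sub: "{0..b} \<subseteq> {0..t}" using ab by auto
        have i1: "(\<lambda>s. - drift k l \<alpha> (x s \<omega>)) integrable_on {0..b}"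
          by (intro integrable_continuous_real continuous_on_minus continuous_on_subset[OF comp sub] continuous_drift)
        have i2: "(\<lambda>s. decay_rate k l \<alpha> (x s \<omega>) * psi k (x s \<omega>)) integrable_on {0..b}"
          by (intro integrable_continuous_real continuous_on_mult continuous_on_subset[OF comp sub]
              continuous_decay_rate continuous_psi)
        show "\<Phi> b - \<Phi> a = integral {a..b} (\<lambda>s. - drift k l \<alpha> (x s \<omega>))"
          using Henstock_Kurzweil_Integration.integral_combine[OF ab(1,2) i1] by (simp add: \<Phi>_def algebra_simps)
        show "\<Psi> b - \<Psi> a = integral {a..b} (\<lambda>s. decay_rate k l \<alpha> (x s \<omega>) * psi k (x s \<omega>))"
          using Henstock_Kurzweil_Integration.integral_combine[OF ab(1,2) i2] by (simp add: \<Psi>_def algebra_simps)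
      qed
      have step: "S1 n j \<omega> + rot_prod (ym n j \<omega>) (I (p (m n) (Suc j)) \<omega> - I (p (m n) j) \<omega>) + S3 n j \<omega>
          = (psi k (x (p (m n) (Suc j)) \<omega>) + \<Psi> (p (m n) (Suc j))) - (psi k (x (p (m n) j) \<omega>) + \<Psi> (p (m n) j))"
        if "j < m n" for j
      proof -
        have j: "j \<le> m n" "Suc j \<le> m n" using that by auto
        have pj: "0 \<le> p (m n) j" "0 \<le> p (m n) (Suc j)" "p (m n) (Suc j) \<le> t"
          using p_in[OF j(1)] p_in[OF j(2)] by auto
        have dx: "x (p (m n) (Suc j)) \<omega> - x (p (m n) j) \<omega> =
            (I (p (m n) (Suc j)) \<omega> - I (p (m n) j) \<omega>) + (\<Phi> (p (m n) (Suc j)) - \<Phi> (p (m n) j))"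
        proof -
          have "x r \<omega> = x0 + I r \<omega> + \<Phi> r" if "0 \<le> r" for r
            using elim(2) that unfolding \<Phi>_def by blast
          from this[OF pj(1)] this[OF pj(2)] show ?thesis by simp
        qed
        show ?thesis
          unfolding S1_def S3_def dx \<Phi>[OF pj(1) p_mono pj(3), symmetric] \<Psi>[OF pj(1) p_mono pj(3), symmetric]
            rot_prod.add_right by simp
      qed
      have "(\<Sum>j<m n. S1 n j \<omega>) + (\<Sum>j<m n. rot_prod (ym n j \<omega>) (I (p (m n) (Suc j)) \<omega> - I (p (m n) j) \<omega>))
          + (\<Sum>j<m n. S3 n j \<omega>)
        = (\<Sum>j<m n. S1 n j \<omega> + rot_prod (ym n j \<omega>) (I (p (m n) (Suc j)) \<omega> - I (p (m n) j) \<omega>) + S3 n j \<omega>)"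
        by (simp only: sum.distrib)
      also have "\<dots> = (\<Sum>j<m n. (\<lambda>j. psi k (x (p (m n) j) \<omega>) + \<Psi> (p (m n) j)) (Suc j)
          - (\<lambda>j. psi k (x (p (m n) j) \<omega>) + \<Psi> (p (m n) j)) j)"
        by (intro sum.cong refl) (simp only: step lessThan_iff)
      also have "\<dots> = (psi k (x (p (m n) (m n)) \<omega>) + \<Psi> (p (m n) (m n))) - (psi k (x (p (m n) 0) \<omega>) + \<Psi> (p (m n) 0))"
        by (rule sum_lessThan_telescope)
      also have "\<dots> = psi k (x t \<omega>) - psi k (x 0 \<omega>) + \<Psi> t"
        using m0[of n] by (simp add: p_def \<Psi>_def)
      finally show ?case unfolding ym_def[symmetric] \<Psi>_def by simp
    qed
  qed
  then show ?thesis by (rule AE_zero_if_vanishing_const)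
qed

text \<open>
  The null set in the statement for a single time depends on the time. Grid points of intervals of
  integer length form a countable dense set of times, and both sides are continuous in time.
\<close>

theorem (in filtered_prob_space) psi_decay:
  assumes bm: "brownian_motion M F w"
    and sol: "stratonovich_solution M F w (xi k) (\<lambda>y. - drift k l \<alpha> y) x0 x"
  shows "AE \<omega> in M. continuous_on {0..} (\<lambda>s. x s \<omega>) \<and> (\<forall>t\<ge>0. psi k (x t \<omega>) = psi k (x 0 \<omega>)
    - integral {0..t} (\<lambda>s. decay_rate k l \<alpha> (x s \<omega>) * psi k (x s \<omega>)))"
proof -
  define R where "R t \<omega> = psi k (x t \<omega>) - psi k (x 0 \<omega>)
    + integral {0..t} (\<lambda>s. decay_rate k l \<alpha> (x s \<omega>) * psi k (x s \<omega>))" for t \<omega>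
  have xc: "AE \<omega> in M. continuous_on {0..} (\<lambda>s. x s \<omega>)"
    using sol by (simp add: stratonovich_solution_def continuous_paths_def)
  have "AE \<omega> in M. R (grid (real N) n i) \<omega> = 0" for N n i
  proof (cases "grid (real N) n i = 0")
    case True
    then show ?thesis by (simp add: R_def)
  next
    case False
    then have "grid (real N) n i > 0" using grid_nonneg[of "real N" n i] by linarith
    from psi_decay_at_time[OF bm sol this] show ?thesis by (simp add: R_def)
  qed
  then have "AE \<omega> in M. \<forall>N n i. R (grid (real N) n i) \<omega> = 0" by (simp add: AE_all_countable)
  with xc show ?thesis
  proof eventually_elim
    case (elim \<omega>)
    have "R t \<omega> = 0" if t: "t \<ge> 0" for t
    proof -
      obtain N :: nat where N: "t < real N" using reals_Archimedean2 by blast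
      then have N0: "real N > 0" and tN: "t \<in> {0..real N}" using t by auto
      have cx: "continuous_on {0..real N} (\<lambda>s. x s \<omega>)" by (rule continuous_on_subset[OF elim(1)]) auto
      have comp: "continuous_on {0..real N} (\<lambda>s. f (x s \<omega>))" if "continuous_on UNIV f" for f :: "real^2 \<Rightarrow> 'c::topological_space"
        by (rule continuous_on_compose2[OF that cx]) simp
      have cR: "continuous_on {0..real N} (\<lambda>s. R s \<omega>)"
        unfolding R_def
        by (intro continuous_intros comp continuous_psi indefinite_integral_continuous_1
            integrable_continuous_real continuous_decay_rate)
      have "(\<lambda>n. R (grid (real N) n (grid_floor (real N) n t)) \<omega>) \<longlonglongrightarrow> R t \<omega>"
      proof (rule continuous_on_tendsto_compose[OF cR grid_floor_tendsto[OF N0 tN] tN])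
        show "\<forall>\<^sub>F n in sequentially. grid (real N) n (grid_floor (real N) n t) \<in> {0..real N}"
          using eventually_gt_at_top[of 0]
          by eventually_elim (use grid_le[of "real N"] grid_floor(1)[OF N0 tN] in auto)
      qed
      then have "(\<lambda>n. 0) \<longlonglongrightarrow> R t \<omega>" using elim(2) by simp
      from LIMSEQ_unique[OF this tendsto_const] show ?thesis .
    qed
    then show ?case using elim(1) by (fastforce simp: R_def)
  qed
qed

theorem proposition5p3:
  fixes M :: "'a measure" and F :: "real \<Rightarrow> 'a measure"
    and w :: "real \<Rightarrow> 'a \<Rightarrow> real" and x :: "real \<Rightarrow> 'a \<Rightarrow> real^2"
    and k x0 :: "real^2" and lam :: real and \<alpha> :: ennreal
  assumes "lam > 0"
    and "filtered_prob_space M F"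
    and "brownian_motion M F w"
    and "stratonovich_solution M F w (xi k) (\<lambda>y. - drift k lam \<alpha> y) x0 x"
  shows "AE \<omega> in M.
     (mono_on {0..} (\<lambda>t. psi k (x t \<omega>)) \<or> antimono_on {0..} (\<lambda>t. psi k (x t \<omega>))) \<and>
     (\<forall>J. is_interval J \<and> J \<subseteq> {0..} \<and> (\<forall>t\<in>J. psi k (x t \<omega>) > 0)
          \<longrightarrow> antimono_on J (\<lambda>t. psi k (x t \<omega>))) \<and>
     (\<forall>J. is_interval J \<and> J \<subseteq> {0..} \<and> (\<forall>t\<in>J. psi k (x t \<omega>) < 0)
          \<longrightarrow> mono_on J (\<lambda>t. psi k (x t \<omega>)))"
  using filtered_prob_space.psi_decay[OF assms(2-4)]
proof eventually_elim
  case (elim \<omega>)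
  let ?y = "\<lambda>t. psi k (x t \<omega>)" and ?a = "\<lambda>t. decay_rate k lam \<alpha> (x t \<omega>)"
  have comp: "continuous_on {0..} (\<lambda>s. f (x s \<omega>))" if "continuous_on UNIV f" for f :: "real^2 \<Rightarrow> real"
    by (rule continuous_on_compose2[OF that conjunct1[OF elim]]) simp
  have eq: "?y t = ?y 0 - integral {0..t} (\<lambda>s. ?a s * ?y s)" if "t \<ge> 0" for t
    using conjunct2[OF elim] that by blast
  note decay = linear_decay_monotone[where y="?y" and a="?a",
      OF comp[OF continuous_psi] comp[OF continuous_decay_rate] decay_rate_nonneg[OF assms(1)] eq, simplified]
  show ?case
  proof (intro conjI allI impI)
    show "mono_on {0..} ?y \<or> antimono_on {0..} ?y"
    proof (cases "?y 0 \<ge> 0")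
      case True
      then show ?thesis by (intro disjI2 decay(1))
    next
      case False
      then show ?thesis by (intro disjI1 decay(2)) simp
    qed
  next
    fix J assume J: "is_interval J \<and> J \<subseteq> {0..} \<and> (\<forall>t\<in>J. ?y t > 0)"
    show "antimono_on J ?y"
    proof (cases "J = {}")
      case False
      then obtain t where "t \<ge> 0" "?y t > 0" using J by auto
      then have "antimono_on {0..} ?y" using decay(3)[of t] decay(1) by simp
      then show ?thesis using J by (auto elim: monotone_on_subset)
    qed (simp add: monotone_on_def)
  next
    fix J assume J: "is_interval J \<and> J \<subseteq> {0..} \<and> (\<forall>t\<in>J. ?y t < 0)"
    show "mono_on J ?y"
    proof (cases "J = {}")
      case False
      then obtain t where "t \<ge> 0" "?y t < 0" using J by auto
      then have "mono_on {0..} ?y" using decay(4)[of t] decay(2) by simp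
      then show ?thesis using J by (auto elim: monotone_on_subset)
    qed (simp add: monotone_on_def)
  qed
qed

end
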